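(* Let $\mathbb{X},\mathbb{A},A(\cdot),c,q$ be as in the context. Suppose that: (T) there exist a continuous function $V:\mathbb{X}\to[1,\infty)$ and a constant $K$ such that $\sum_{n=0}^\infty Q_\phi^nV(x)\le KV(x)<\infty$ for all $\phi\in\mathbb{F}$ and $x\in\mathbb{X}$; (W-i) the set-valued mapping $x\mapsto A(x)$ is compact-valued and continuous on $\mathbb{X}$; (W-ii) the transition kernel $q$ is weakly continuous; and that the function $(x,a)\mapsto\int_{\mathbb{X}}V(y)\,q(dy|x,a)$ is continuous on $\mathrm{Gr}(A)$. Consider the MDP obtained from the HV transformation described in the context (with a continuous function $\mu$ and a discount factor $\tilde\beta$ as specified there). Then $\tilde p$ is a weakly continuous transition probability kernel (from $\mathrm{Gr}(\tilde A)$ to $\tilde{\mathbb{X}}$). If in addition $(x,a)\mapsto c(x,a)$ is lower semicontinuous on $\mathrm{Gr}(A)$, then there exists a stationary $\tilde\beta$-optimal policy for the MDP obtained from the HV transformation, and for this MDP a stationary policy $\phi$ is $\tilde\beta$-optimal if and only if for all $x\in\mathbb{X}$ $$\tilde v(x)=\tilde c(x,\phi(x))+\tilde\beta\int_{\mathbb{X}}\tilde v(y)\,\tilde p(dy|x,\phi(x))=\min_{a\in A(x)}\Big[\tilde c(x,a)+\tilde\beta\int_{\mathbb{X}}\tilde v(y)\,\tilde p(dy|x,a)\Big].$$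
   Context: Setting. $\mathbb{X}$ and $\mathbb{A}$ are Borel subsets of complete separable metric spaces, with Borel $\sigma$-algebras. For each $x\in\mathbb{X}$, $A(x)$ is a nonempty Borel subset of $\mathbb{A}$. $\mathrm{Gr}(A):=\{(x,a):x\in\mathbb{X},a\in A(x)\}$ is Borel in $\mathbb{X}\times\mathbb{A}$ and contains the graph of a Borel function $\mathbb{X}\to\mathbb{A}$. The one-step cost $c:\mathrm{Gr}(A)\to[0,\infty)$ is Borel. For each $(x,a)\in\mathrm{Gr}(A)$, $q(\cdot|x,a)$ is a finite measure on $(\mathbb{X},\mathcal{B}(\mathbb{X}))$, $q(B|\cdot)$ is Borel on $\mathrm{Gr}(A)$ for each $B\in\mathcal{B}(\mathbb{X})$, and $\sup_{\mathrm{Gr}(A)}q(\mathbb{X}|x,a)<\infty$ (the mass need not be one). $\mathbb{F}$ is the set of Borel $\phi:\mathbb{X}\to\mathbb{A}$ with $\phi(x)\in A(x)$ for all $x$ (stationary policies). For $\phi\in\mathbb{F}$: $Q_\phi u(x):=\int_{\mathbb{X}}u(y)\,q(dy|x,\phi(x))$, $Q_\phi^0u:=u$, $Q_\phi^nu:=Q_\phi(Q_\phi^{n-1}u)$. A set-valued mapping $s\mapsto\Phi(s)\subseteq\mathbb{T}$ between metric spaces is compact-valued if every $\Phi(s)$ is compact, and continuous if for every open $O\subseteq\mathbb{T}$ the sets $\{s:\Phi(s)\subseteq O\}$ and $\{s:\Phi(s)\cap O\neq\emptyset\}$ are open. A transition kernel $\kappa$ from $\mathbb{S}$ to $\mathbb{T}$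 (finite measures $\kappa(\cdot|s)$, Borel in $s$) is weakly continuous if $s\mapsto\int f\,d\kappa(\cdot|s)$ is continuous for every bounded continuous $f:\mathbb{T}\to\mathbb{R}$; it is a transition probability kernel if every $\kappa(\cdot|s)$ is a probability measure. Here $q$ is viewed as a kernel from $\mathrm{Gr}(A)$ to $\mathbb{X}$. HV transformation. Let $\mu:\mathbb{X}\to[1,\infty)$ be a continuous function with $V\le\mu\le KV$ and $\mu(x)\ge V(x)+\int_{\mathbb{X}}\mu(y)\,q(dy|x,a)$ for all $(x,a)\in\mathrm{Gr}(A)$ (under the hypotheses of the claim such a $\mu$ exists), and choose a discount factor $\tilde\beta\in[(K-1)/K,1)$ with $\tilde\beta>0$. The new MDP has: - state space $\tilde{\mathbb{X}}:=\mathbb{X}\cup\{\tilde x\}$, where $\tilde x\notin\mathbb{X}$ is isolated from $\mathbb{X}$ (its distance to all points of $\mathbb{X}$ is bounded below by a positive constant); - action space $\tilde{\mathbb{A}}:=\mathbb{A}\cup\{\tilde a\}$, with $\tilde A(x):=A(x)$ for $x\in\mathbb{X}$ and $\tilde A(\tilde x):=\{\tilde a\}$; - costs $\tilde c(x,a):=c(x,a)/\mu(x)$ for $(x,a)\in\mathrm{Gr}(A)$ and $\tilde c(\tilde x,\tilde a):=0$; - transition probabilities, for $(x,a)\in\mathrm{Gr}(A)$: $\tilde p(B|x,a):=\frac{1}{\tilde\beta\mu(x)}\int_B\mu(y)\,q(dy|x,a)$ for $B\in\mathcal{B}(\mathbb{X})$, $\tilde p(\{\tilde x\}|x,a):=1-\frac{1}{\tilde\beta\mu(x)}\int_{\mathbb{X}}\mu(y)\,q(dy|x,a)$;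 and $\tilde p(\{\tilde x\}|\tilde x,\tilde a):=1$. Policies are sequences of Borel-measurable, history-dependent, possibly randomized decision rules $\pi_n(\cdot|x_0a_0\cdots x_n)$ concentrated on the set of actions available at $x_n$. A stationary policy $\phi\in\mathbb{F}$ is extended to $\tilde{\mathbb{X}}$ by $\phi(\tilde x)=\tilde a$; this identifies the policies of the new MDP with those of the original one. $\tilde v^\pi(x):=\tilde{\mathbb{E}}_x^\pi\sum_{n=0}^\infty\tilde\beta^n\tilde c(x_n,a_n)\in[0,\infty]$ is the expected total discounted cost in the new MDP (process governed by $\tilde p$ and $\pi$, $x_0=x$), and $\tilde v(x):=\inf_\pi\tilde v^\pi(x)$, $x\in\tilde{\mathbb{X}}$. A policy $\pi$ is $\tilde\beta$-optimal if $\tilde v^{\pi}(x)=\tilde v(x)$ for all $x\in\tilde{\mathbb{X}}$. *)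

theory Defs
  imports "HOL-Probability.Probability"
begin

text \<open>
  The isolated points added to the state space and to the action space are modelled by
  \<^const>\<open>None\<close>, so \<^typ>\<open>'a option\<close> carries the topology of the disjoint sum of
  \<^typ>\<open>'a\<close> and a single point. Truncating the distance at 1 does not change the topology of
  \<^typ>\<open>'a\<close>, and places \<^const>\<open>None\<close> at distance 1 from every other point.
\<close>

instantiation option :: (topological_space) topological_space
begin

definition open_option_def: "open (U :: 'a option set) \<longleftrightarrow> open (Some -` U)"

instance
  by standard (auto simp: open_option_def vimage_Union)

end

instance option :: (first_countable_topology) first_countable_topology
proof
  fix z :: "'a option"
  show "\<exists>A::nat \<Rightarrow> 'a option set.
      (\<forall>i. z \<in> A i \<and> open (A i)) \<and> (\<forall>S. open S \<and> z \<in> S \<longrightarrow> (\<exists>i. A i \<subseteq> S))"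
  proof (cases z)
    case None
    have "Some -` {None :: 'a option} = {}" by auto
    then show ?thesis using None by (intro exI[of _ "\<lambda>_. {None}"]) (auto simp: open_option_def)
  next
    case (Some x)
    obtain A :: "nat \<Rightarrow> 'a set" where A: "\<And>i. x \<in> A i" "\<And>i. open (A i)"
      "\<And>S. open S \<Longrightarrow> x \<in> S \<Longrightarrow> \<exists>i. A i \<subseteq> S"
      by (metis first_countable_basis)
    have vS: "Some -` (Some ` b) = b" for b :: "'a set" by auto
    have "\<exists>i. Some ` A i \<subseteq> S" if "open S" "z \<in> S" for S
      using A(3)[of "Some -` S"] that Some by (auto simp: open_option_def image_subset_iff_subset_vimage)
    then show ?thesis using A(1,2) Some
      by (intro exI[of _ "\<lambda>i. Some ` A i"]) (auto simp: open_option_def vS)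
  qed
qed

instance option :: (second_countable_topology) second_countable_topology
proof
  obtain B :: "'a set set" where B: "countable B" "topological_basis B"
    using ex_countable_basis by blast
  let ?B = "insert {None} ((\<lambda>b. Some ` b) ` B)"
  have vS: "Some -` (Some ` b) = b" for b :: "'a set" by auto
  have "topological_basis ?B"
  proof (rule topological_basisI)
    fix U assume "U \<in> ?B"
    then consider "U = {None}" | b where "b \<in> B" "U = Some ` b" by blast
    then show "open U"
    proof cases
      case 1 then show ?thesis by (simp add: open_option_def vimage_def)
    next
      case 2 then show ?thesis
        by (simp add: open_option_def vS topological_basis_open[OF B(2)])
    qed
  next
    fix U :: "'a option set" and z assume U: "open U" "z \<in> U"
    show "\<exists>b\<in>?B. z \<in> b \<and> b \<subseteq> U"
    proof (cases z)
      case None then show ?thesis using U by auto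
    next
      case (Some x)
      then obtain b where "b \<in> B" "x \<in> b" "b \<subseteq> Some -` U"
        using topological_basisE[OF B(2), of "Some -` U" x] U by (auto simp: open_option_def)
      then show ?thesis using Some by (intro bexI[of _ "Some ` b"]) auto
    qed
  qed
  then have "open = generate_topology ?B"
    by (rule topological_basis_imp_subbasis)
  moreover have "countable ?B" using B(1) by simp
  ultimately show "\<exists>B :: 'a option set set. countable B \<and> open = generate_topology B"
    by blast
qed

instantiation option :: (metric_space) metric_space
begin

definition dist_option :: "'a option \<Rightarrow> 'a option \<Rightarrow> real" where
  "dist_option x y = (case (x, y) of
     (Some a, Some b) \<Rightarrow> min 1 (dist a b) | (None, None) \<Rightarrow> 0 | _ \<Rightarrow> 1)"

definition uniformity_option :: "('a option \<times> 'a option) filter" where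
  "uniformity_option = (INF e\<in>{0 <..}. principal {(x, y). dist x y < e})"

instance
proof
  show "uniformity = (INF e\<in>{0 <..}. principal {(x :: 'a option, y). dist x y < e})"
    by (rule uniformity_option_def)
next
  fix x y :: "'a option"
  show "dist x y = 0 \<longleftrightarrow> x = y"
    by (cases x; cases y) (auto simp: dist_option_def min_def)
next
  fix x y z :: "'a option"
  have "min 1 (dist a b) \<le> min 1 (dist a c) + min 1 (dist b c)" for a b c :: 'a
    using dist_triangle2[of a b c] zero_le_dist[of a c] zero_le_dist[of b c]
    by linarith
  then show "dist x y \<le> dist x z + dist y z"
    by (cases x; cases y; cases z) (simp_all add: dist_option_def)
next
  fix U :: "'a option set"
  have "eventually P uniformity \<longleftrightarrow> (\<exists>e>0. \<forall>x y :: 'a option. dist x y < e \<longrightarrow> P (x, y))" for P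
  proof -
    have "\<exists>x\<in>{0<..}. {(s, t). dist s t < x} \<subseteq> {(x :: 'a option, y). dist x y < a} \<inter> {(x, y). dist x y < b}"
      if "0 < a" "0 < b" for a b :: real
      using that by (intro bexI[of _ "min a b"]) auto
    then show ?thesis
      unfolding uniformity_option_def
      by (subst eventually_INF_base) (auto simp: eventually_principal subset_eq)
  qed
  then have *: "(\<forall>x\<in>U. \<forall>\<^sub>F (x', y) in uniformity. x' = x \<longrightarrow> y \<in> U) \<longleftrightarrow>
      (\<forall>x\<in>U. \<exists>e>0. \<forall>y. dist x y < e \<longrightarrow> y \<in> U)"
    by auto
  show "open U \<longleftrightarrow> (\<forall>x\<in>U. \<forall>\<^sub>F (x', y) in uniformity. x' = x \<longrightarrow> y \<in> U)"
    unfolding *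
  proof
    assume "open U"
    show "\<forall>x\<in>U. \<exists>e>0. \<forall>y. dist x y < e \<longrightarrow> y \<in> U"
    proof
      fix z assume z: "z \<in> U"
      show "\<exists>e>0. \<forall>y. dist z y < e \<longrightarrow> y \<in> U"
      proof (cases z)
        case None
        then show ?thesis using z
          by (intro exI[of _ 1]) (auto simp: dist_option_def split: option.splits)
      next
        case (Some a)
        then obtain e where e: "e > 0" "\<And>b. dist b a < e \<Longrightarrow> Some b \<in> U"
          using \<open>open U\<close> z by (auto simp: open_option_def open_dist)
        then show ?thesis using Some
          by (intro exI[of _ "min 1 e"])
             (auto simp: dist_option_def min_less_iff_disj dist_commute split: option.splits)
      qed
    qed
  next
    assume H: "\<forall>x\<in>U. \<exists>e>0. \<forall>y. dist x y < e \<longrightarrow> y \<in> U"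
    show "open U"
      unfolding open_option_def open_dist
    proof
      fix a assume "a \<in> Some -` U"
      then obtain e where e: "e > 0" "\<And>y. dist (Some a) y < e \<Longrightarrow> y \<in> U"
        using H by auto
      then have "dist b a < e \<Longrightarrow> b \<in> Some -` U" for b
        by (auto intro!: e(2) simp: dist_option_def min_less_iff_disj dist_commute)
      then show "\<exists>e>0. \<forall>y. dist y a < e \<longrightarrow> y \<in> Some -` U" using e(1) by blast
    qed
  qed
qed

end

instance option :: (complete_space) complete_space
proof
  fix X :: "nat \<Rightarrow> 'a option" assume "Cauchy X"
  then obtain N where N: "\<And>m n. m \<ge> N \<Longrightarrow> n \<ge> N \<Longrightarrow> dist (X m) (X n) < 1"
    unfolding Cauchy_def by (meson zero_less_one)
  show "convergent X"
  proof (cases "X N")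
    case None
    have "X n = None" if "n \<ge> N" for n
      using N[of N n] that None by (auto simp: dist_option_def split: option.splits)
    then have "X \<longlonglongrightarrow> None"
      by (intro tendsto_eventually) (auto simp: eventually_sequentially)
    then show ?thesis by (rule convergentI)
  next
    case (Some a)
    have S: "X n = Some (the (X n))" if "n \<ge> N" for n
      using N[of N n] that Some by (auto simp: dist_option_def split: option.splits)
    define Y where "Y n = the (X (n + N))" for n
    have XY: "X (n + N) = Some (Y n)" for n using S[of "n + N"] by (simp add: Y_def)
    have "Cauchy Y"
      unfolding Cauchy_def
    proof (intro allI impI)
      fix e :: real assume "e > 0"
      then obtain M where M: "\<And>m n. m \<ge> M \<Longrightarrow> n \<ge> M \<Longrightarrow> dist (X m) (X n) < min 1 e"
        using \<open>Cauchy X\<close> unfolding Cauchy_def by (metis min_less_iff_conj zero_less_one)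
      have "dist (Y m) (Y n) < e" if "m \<ge> M" "n \<ge> M" for m n
        using M[of "m + N" "n + N"] that by (auto simp: XY dist_option_def min_def split: if_splits)
      then show "\<exists>M. \<forall>m\<ge>M. \<forall>n\<ge>M. dist (Y m) (Y n) < e" by blast
    qed
    then obtain l where l: "Y \<longlonglongrightarrow> l" using Cauchy_convergent_iff convergent_def by blast
    have "(\<lambda>n. X (n + N)) \<longlonglongrightarrow> Some l"
      unfolding XY
    proof (rule metric_tendsto_imp_tendsto[OF l])
      show "\<forall>\<^sub>F n in sequentially. dist (Some (Y n)) (Some l) \<le> dist (Y n) l"
        by (simp add: dist_option_def)
    qed
    then have "X \<longlonglongrightarrow> Some l" by (rule LIMSEQ_offset)
    then show ?thesis by (rule convergentI)
  qed
qed

instance option :: (polish_space) polish_space ..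


section \<open>Kernels, set-valued mappings, semicontinuity\<close>

definition transition_kernel ::
  "'s::topological_space set \<Rightarrow> 't::topological_space set \<Rightarrow> ('s \<Rightarrow> 't measure) \<Rightarrow> bool" where
  "transition_kernel S T \<kappa> \<longleftrightarrow>
     (\<forall>s\<in>S. sets (\<kappa> s) = sets (restrict_space borel T) \<and> finite_measure (\<kappa> s)) \<and>
     (\<forall>B\<in>sets (restrict_space borel T).
        (\<lambda>s. emeasure (\<kappa> s) B) \<in> borel_measurable (restrict_space borel S))"

definition transition_prob_kernel ::
  "'s::topological_space set \<Rightarrow> 't::topological_space set \<Rightarrow> ('s \<Rightarrow> 't measure) \<Rightarrow> bool" where
  "transition_prob_kernel S T \<kappa> \<longleftrightarrow> transition_kernel S T \<kappa> \<and> (\<forall>s\<in>S. prob_space (\<kappa> s))"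

definition weakly_continuous ::
  "'s::topological_space set \<Rightarrow> 't::topological_space set \<Rightarrow> ('s \<Rightarrow> 't measure) \<Rightarrow> bool" where
  "weakly_continuous S T \<kappa> \<longleftrightarrow>
     (\<forall>f :: 't \<Rightarrow> real. continuous_on T f \<and> bounded (f ` T) \<longrightarrow>
        continuous_on S (\<lambda>s. \<integral>t. f t \<partial>\<kappa> s))"

definition compact_valued :: "'s set \<Rightarrow> ('s \<Rightarrow> 't::topological_space set) \<Rightarrow> bool" where
  "compact_valued S \<Phi> \<longleftrightarrow> (\<forall>s\<in>S. compact (\<Phi> s))"

definition continuous_set_valued ::
  "'s::topological_space set \<Rightarrow> 't::topological_space set \<Rightarrow> ('s \<Rightarrow> 't set) \<Rightarrow> bool" where
  "continuous_set_valued S T \<Phi> \<longleftrightarrow>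
     (\<forall>U. openin (top_of_set T) U \<longrightarrow>
        openin (top_of_set S) {s\<in>S. \<Phi> s \<subseteq> U} \<and>
        openin (top_of_set S) {s\<in>S. \<Phi> s \<inter> U \<noteq> {}})"

definition lower_semicontinuous_on :: "'s::topological_space set \<Rightarrow> ('s \<Rightarrow> real) \<Rightarrow> bool" where
  "lower_semicontinuous_on S f \<longleftrightarrow> (\<forall>r. openin (top_of_set S) {s\<in>S. r < f s})"

definition is_minimum :: "'b::order \<Rightarrow> ('a \<Rightarrow> 'b) \<Rightarrow> 'a set \<Rightarrow> bool" where
  "is_minimum m f S \<longleftrightarrow> m \<in> f ` S \<and> (\<forall>s\<in>S. m \<le> f s)"


section \<open>Markov decision processes\<close>

record ('s, 'a) mdp =
  states :: "'s set"
  actions :: "'a set"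
  avail :: "'s \<Rightarrow> 'a set"
  cost :: "'s \<times> 'a \<Rightarrow> real"
  kern :: "'s \<times> 'a \<Rightarrow> 's measure"

definition gr :: "('s, 'a) mdp \<Rightarrow> ('s \<times> 'a) set" where
  "gr D = Sigma (states D) (avail D)"

definition state_space :: "('s::topological_space, 'a) mdp \<Rightarrow> 's measure" where
  "state_space D = restrict_space borel (states D)"

definition action_space :: "('s, 'a::topological_space) mdp \<Rightarrow> 'a measure" where
  "action_space D = restrict_space borel (actions D)"

definition gr_space :: "('s::topological_space, 'a::topological_space) mdp \<Rightarrow> ('s \<times> 'a) measure" where
  "gr_space D = restrict_space borel (gr D)"

definition stationary :: "('s::topological_space, 'a::topological_space) mdp \<Rightarrow> ('s \<Rightarrow> 'a) set" where
  "stationary D =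
     {\<phi>. \<phi> \<in> measurable (state_space D) (action_space D) \<and> (\<forall>x\<in>states D. \<phi> x \<in> avail D x)}"

text \<open>The kernel consists of finite measures whose total mass need not be 1.\<close>

definition mdp_model :: "('s::polish_space, 'a::polish_space) mdp \<Rightarrow> bool" where
  "mdp_model D \<longleftrightarrow>
     states D \<in> sets borel \<and> actions D \<in> sets borel \<and>
     (\<forall>x\<in>states D. avail D x \<noteq> {} \<and> avail D x \<subseteq> actions D \<and> avail D x \<in> sets borel) \<and>
     gr D \<in> sets borel \<and> stationary D \<noteq> {} \<and>
     cost D \<in> borel_measurable (gr_space D) \<and> (\<forall>z\<in>gr D. 0 \<le> cost D z) \<and>
     transition_kernel (gr D) (states D) (kern D) \<and>
     (\<exists>C. \<forall>z\<in>gr D. measure (kern D z) (states D) \<le> C)"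

definition Qop :: "('s, 'a) mdp \<Rightarrow> ('s \<Rightarrow> 'a) \<Rightarrow> ('s \<Rightarrow> ennreal) \<Rightarrow> 's \<Rightarrow> ennreal" where
  "Qop D \<phi> u x = (\<integral>\<^sup>+y. u y \<partial>kern D (x, \<phi> x))"


subsection \<open>Policies and total discounted costs\<close>

text \<open>
  The history \<open>x\<^sub>0 a\<^sub>0 \<dots> x\<^sub>n\<close> is represented by the pair of the function
  \<open>i \<mapsto> (x\<^sub>i, a\<^sub>i)\<close> on \<open>{0..<n}\<close> and the current state \<open>x\<^sub>n\<close>.
\<close>

definition hist_space ::
  "('s::topological_space, 'a::topological_space) mdp \<Rightarrow> nat \<Rightarrow> ((nat \<Rightarrow> 's \<times> 'a) \<times> 's) measure" where
  "hist_space D n = (PiM {0..<n} (\<lambda>_. gr_space D)) \<Otimes>\<^sub>M state_space D"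

type_synonym ('s, 'a) policy = "nat \<Rightarrow> (nat \<Rightarrow> 's \<times> 'a) \<times> 's \<Rightarrow> 'a measure"

definition is_policy ::
  "('s::topological_space, 'a::topological_space) mdp \<Rightarrow> ('s, 'a) policy \<Rightarrow> bool" where
  "is_policy D \<pi> \<longleftrightarrow>
     (\<forall>n. \<pi> n \<in> measurable (hist_space D n) (prob_algebra (action_space D)) \<and>
          (\<forall>z\<in>space (hist_space D n). emeasure (\<pi> n z) (avail D (snd z)) = 1))"

definition stationary_policy ::
  "('s, 'a::topological_space) mdp \<Rightarrow> ('s \<Rightarrow> 'a) \<Rightarrow> ('s, 'a) policy" where
  "stationary_policy D \<phi> n = (\<lambda>(h, x). return (action_space D) (\<phi> x))"

text \<open>
  The conditional law of \<open>(x\<^sub>n, a\<^sub>n)\<close> given \<open>h = (x\<^sub>0, a\<^sub>0, \<dots>, x\<^sub>n\<^sub>-\<^sub>1, a\<^sub>n\<^sub>-\<^sub>1)\<close>. The restriction to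
  \<^term>\<open>avail D x\<close>, a set of full measure, makes \<^term>\<open>Pair x\<close> map into \<^term>\<open>gr D\<close>.
\<close>

definition step_law ::
  "('s::topological_space, 'a::topological_space) mdp \<Rightarrow> ('s, 'a) policy \<Rightarrow> 's \<Rightarrow>
     nat \<Rightarrow> (nat \<Rightarrow> 's \<times> 'a) \<Rightarrow> ('s \<times> 'a) measure" where
  "step_law D \<pi> x\<^sub>0 n h =
     (if n = 0 then return (state_space D) x\<^sub>0 else kern D (h (n - 1))) \<bind>
     (\<lambda>x. distr (restrict_space (\<pi> n (h, x)) (avail D x)) (gr_space D) (Pair x))"

text \<open>
  The law of the process \<open>(x\<^sub>n, a\<^sub>n)\<^sub>n\<close> given by the Ionescu Tulcea theorem, i.e. the measure
  called \<open>PF.lim\<close> inside the locale \<^locale>\<open>Ionescu_Tulcea\<close>.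
\<close>

definition traj_law ::
  "('s::topological_space, 'a::topological_space) mdp \<Rightarrow> ('s, 'a) policy \<Rightarrow> 's \<Rightarrow>
     (nat \<Rightarrow> 's \<times> 'a) measure" where
  "traj_law D \<pi> x =
     projective_family.lim UNIV
       (Ionescu_Tulcea.CI (step_law D \<pi> x) (\<lambda>_. gr_space D)) (\<lambda>_. gr_space D)"

definition total_cost ::
  "real \<Rightarrow> ('s::topological_space, 'a::topological_space) mdp \<Rightarrow> ('s, 'a) policy \<Rightarrow> 's \<Rightarrow> ennreal" where
  "total_cost \<beta> D \<pi> x = (\<integral>\<^sup>+\<omega>. (\<Sum>n. ennreal (\<beta> ^ n * cost D (\<omega> n))) \<partial>traj_law D \<pi> x)"

definition opt_value ::
  "real \<Rightarrow> ('s::topological_space, 'a::topological_space) mdp \<Rightarrow> 's \<Rightarrow> ennreal" where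
  "opt_value \<beta> D x = (INF \<pi>\<in>{\<pi>. is_policy D \<pi>}. total_cost \<beta> D \<pi> x)"

definition optimal_policy ::
  "real \<Rightarrow> ('s::topological_space, 'a::topological_space) mdp \<Rightarrow> ('s, 'a) policy \<Rightarrow> bool" where
  "optimal_policy \<beta> D \<pi> \<longleftrightarrow>
     is_policy D \<pi> \<and> (\<forall>x\<in>states D. total_cost \<beta> D \<pi> x = opt_value \<beta> D x)"

definition one_step_value ::
  "real \<Rightarrow> ('s, 'a) mdp \<Rightarrow> ('s \<Rightarrow> ennreal) \<Rightarrow> 's \<times> 'a \<Rightarrow> ennreal" where
  "one_step_value \<beta> D u z = ennreal (cost D z) + ennreal \<beta> * (\<integral>\<^sup>+y. u y \<partial>kern D z)"


subsection \<open>The process is well defined\<close>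

lemma sets_kern:
  assumes "mdp_model D" "z \<in> gr D"
  shows "sets (kern D z) = sets (state_space D)" "space (kern D z) = states D"
proof -
  show "sets (kern D z) = sets (state_space D)"
    using assms by (auto simp: mdp_model_def transition_kernel_def state_space_def)
  from sets_eq_imp_space_eq[OF this] show "space (kern D z) = states D"
    by (simp add: state_space_def space_restrict_space)
qed

lemma measurable_choice:
  fixes D :: "('s::polish_space, 'a::polish_space) mdp"
  assumes D: "mdp_model D" and \<pi>: "is_policy D \<pi>"
  shows "(\<lambda>(h, x). distr (restrict_space (\<pi> n (h, x)) (avail D x)) (gr_space D) (Pair x))
    \<in> measurable (hist_space D n) (prob_algebra (gr_space D))"
proof -
  let ?A = "\<lambda>x. avail D x"
  let ?k = "\<lambda>(h, x). distr (restrict_space (\<pi> n (h, x)) (?A x)) (gr_space D) (Pair x)"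
  have gr: "gr D \<in> sets borel" using D by (simp add: mdp_model_def)
  have \<pi>n: "\<pi> n \<in> measurable (hist_space D n) (prob_algebra (action_space D))"
    using \<pi> by (simp add: is_policy_def)
  have space_hist: "x \<in> states D" if "(h, x) \<in> space (hist_space D n)" for h x
    using that by (simp add: hist_space_def space_pair_measure state_space_def space_restrict_space)
  have sets_\<pi>: "sets (\<pi> n z) = sets (action_space D)" "prob_space (\<pi> n z)"
    if "z \<in> space (hist_space D n)" for z
    using measurable_space[OF \<pi>n that] by (auto simp: space_prob_algebra)
  have A: "?A x \<in> sets (action_space D)" "?A x \<subseteq> actions D" if "x \<in> states D" for x
    using D that by (auto simp: mdp_model_def action_space_def sets_restrict_space_iff)
  have Pm: "Pair x \<in> measurable (restrict_space (\<pi> n (h, x)) (?A x)) (gr_space D)"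
    if z: "(h, x) \<in> space (hist_space D n)" for h x
  proof -
    have "Pair x \<in> borel_measurable (action_space D)"
      unfolding action_space_def by (intro measurable_restrict_space1) (simp add: borel_prod[symmetric])
    then have "Pair x \<in> borel_measurable (\<pi> n (h, x))"
      by (simp cong: measurable_cong_sets add: sets_\<pi>[OF z])
    then show ?thesis
      unfolding gr_space_def using space_hist[OF z]
      by (intro measurable_restrict_space2 measurable_restrict_space1)
         (auto simp: gr_def space_restrict_space)
  qed
  have prob: "prob_space (?k z)" if "z \<in> space (hist_space D n)" for z
  proof (cases z)
    case (Pair h x)
    have z: "(h, x) \<in> space (hist_space D n)" using that Pair by simp
    have "emeasure (\<pi> n (h, x)) (?A x) = 1" using \<pi> z unfolding is_policy_def by (metis snd_conv)
    then have "prob_space (restrict_space (\<pi> n (h, x)) (?A x))"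
      using A[OF space_hist[OF z]] sets_\<pi>[OF z] sets.sets_into_space[of "?A x" "\<pi> n (h, x)"]
      by (intro prob_spaceI) (simp add: emeasure_restrict_space space_restrict_space Int_absorb2)
    then show ?thesis using Pm[OF z] Pair by (auto intro!: prob_space.prob_space_distr)
  qed
  show ?thesis
  proof (rule measurable_prob_algebraI[OF prob measurable_subprob_algebra])
    fix z assume "z \<in> space (hist_space D n)"
    then show "subprob_space (?k z)" by (intro prob_space_imp_subprob_space prob)
    show "sets (?k z) = sets (gr_space D)" by (cases z) simp
  next
    fix B assume B: "B \<in> sets (gr_space D)"
    then have B': "B \<in> sets borel" "B \<subseteq> gr D"
      using gr by (auto simp: gr_space_def sets_restrict_space)
    have eq: "emeasure (?k z) B = emeasure (\<pi> n z) {a \<in> actions D. (snd z, a) \<in> B}"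
      if "z \<in> space (hist_space D n)" for z
    proof (cases z)
      case (Pair h x)
      have z: "(h, x) \<in> space (hist_space D n)" using that Pair by simp
      have s: "space (\<pi> n (h, x)) = actions D"
        using sets_eq_imp_space_eq[OF sets_\<pi>(1)[OF z]]
        by (simp add: action_space_def space_restrict_space)
      have "emeasure (?k z) B = emeasure (restrict_space (\<pi> n (h, x)) (?A x))
          (Pair x -` B \<inter> space (restrict_space (\<pi> n (h, x)) (?A x)))"
        using emeasure_distr[OF Pm[OF z] B] Pair by simp
      also have "\<dots> = emeasure (\<pi> n (h, x))
          (Pair x -` B \<inter> space (restrict_space (\<pi> n (h, x)) (?A x)))"
        using A[OF space_hist[OF z]] sets_\<pi>[OF z]
        by (intro emeasure_restrict_space) (auto simp: space_restrict_space s Int_absorb2)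
      also have "Pair x -` B \<inter> space (restrict_space (\<pi> n (h, x)) (?A x)) =
          {a \<in> actions D. (snd z, a) \<in> B}"
        using B'(2) A[OF space_hist[OF z]] Pair by (auto simp: space_restrict_space s gr_def)
      finally show ?thesis using Pair by simp
    qed
    have "(\<lambda>p. (snd (fst p), snd p)) \<in> borel_measurable (hist_space D n \<Otimes>\<^sub>M action_space D)"
    proof (intro borel_measurable_Pair)
      have "snd \<in> measurable (hist_space D n) (state_space D)"
        unfolding hist_space_def by simp
      then have "snd \<in> borel_measurable (hist_space D n)"
        unfolding state_space_def by (simp add: measurable_restrict_space2_iff)
      then show "(\<lambda>p. snd (fst p)) \<in> borel_measurable (hist_space D n \<Otimes>\<^sub>M action_space D)"
        by (rule measurable_compose[OF measurable_fst])
      have "snd \<in> measurable (hist_space D n \<Otimes>\<^sub>M action_space D) (action_space D)" by simp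
      then show "snd \<in> borel_measurable (hist_space D n \<Otimes>\<^sub>M action_space D)"
        unfolding action_space_def by (simp add: measurable_restrict_space2_iff)
    qed
    from measurable_sets[OF this B'(1)]
    have "Sigma (space (hist_space D n)) (\<lambda>z. {a \<in> actions D. (snd z, a) \<in> B})
        \<in> sets (hist_space D n \<Otimes>\<^sub>M action_space D)"
      by (rule back_subst[of "\<lambda>S. S \<in> _"])
         (auto simp: space_pair_measure action_space_def space_restrict_space)
    from emeasure_measurable_subprob_algebra2[OF this measurable_prob_algebraD[OF \<pi>n]]
    show "(\<lambda>z. emeasure (?k z) B) \<in> borel_measurable (hist_space D n)"
      by (subst measurable_cong[OF eq])
  qed
qed

lemma Ionescu_Tulcea_step_law:
  fixes D :: "('s::polish_space, 'a::polish_space) mdp"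
  assumes D: "mdp_model D" and p: "transition_prob_kernel (gr D) (states D) (kern D)"
    and \<pi>: "is_policy D \<pi>" and x: "x \<in> states D"
  shows "Ionescu_Tulcea (step_law D \<pi> x) (\<lambda>_. gr_space D)"
proof -
  have "step_law D \<pi> x n \<in>
      measurable (PiM {0..<n} (\<lambda>_. gr_space D)) (prob_algebra (gr_space D))" for n
    unfolding step_law_def
  proof (rule measurable_bind_prob_space2[where N = "state_space D"])
    show "(\<lambda>h. if n = 0 then return (state_space D) x else kern D (h (n - 1))) \<in>
        measurable (PiM {0..<n} (\<lambda>_. gr_space D)) (prob_algebra (state_space D))"
    proof (cases "n = 0")
      case True
      then show ?thesis
        using x by (auto intro!: measurable_const simp: space_prob_algebra prob_space_return
            state_space_def space_restrict_space)
    next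
      case False
      have "kern D \<in> measurable (gr_space D) (prob_algebra (state_space D))"
        using p unfolding transition_prob_kernel_def transition_kernel_def
        by (intro measurable_prob_algebraI measurable_subprob_algebra)
           (auto simp: gr_space_def state_space_def space_restrict_space
             intro: prob_space_imp_subprob_space)
      moreover have "(\<lambda>h. h (n - 1)) \<in> measurable (PiM {0..<n} (\<lambda>_. gr_space D)) (gr_space D)"
        using False by (intro measurable_component_singleton) auto
      ultimately show ?thesis using False by (simp add: measurable_compose)
    qed
    show "(\<lambda>(h, y). distr (restrict_space (\<pi> n (h, y)) (avail D y)) (gr_space D) (Pair y)) \<in>
        measurable (PiM {0..<n} (\<lambda>_. gr_space D) \<Otimes>\<^sub>M state_space D) (prob_algebra (gr_space D))"
      using measurable_choice[OF D \<pi>, of n] by (simp add: hist_space_def)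
  qed
  note M = this
  show ?thesis
  proof (rule Ionescu_Tulcea.intro)
    show "step_law D \<pi> x n \<in>
        measurable (PiM {0..<n} (\<lambda>_. gr_space D)) (subprob_algebra (gr_space D))" for n
      by (rule measurable_prob_algebraD[OF M])
    show "h \<in> space (PiM {0..<n} (\<lambda>_. gr_space D)) \<Longrightarrow> prob_space (step_law D \<pi> x n h)" for n h
      using measurable_space[OF M] by (simp add: space_prob_algebra)
  qed
qed

lemma is_policy_stationary_policy:
  assumes "mdp_model D" and \<phi>: "\<phi> \<in> stationary D"
  shows "is_policy D (stationary_policy D \<phi>)"
proof -
  have A: "avail D x \<in> sets (action_space D)" if "x \<in> states D" for x
    using assms that by (auto simp: mdp_model_def action_space_def sets_restrict_space_iff)
  have "\<phi> \<in> measurable (state_space D) (action_space D)"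
    using \<phi> by (simp add: stationary_def)
  from measurable_compose[OF measurable_snd measurable_compose[OF this measurable_return_prob_space]]
  have "stationary_policy D \<phi> n \<in> measurable (hist_space D n) (prob_algebra (action_space D))" for n
    by (simp add: stationary_policy_def hist_space_def case_prod_beta')
  moreover have "emeasure (stationary_policy D \<phi> n z) (avail D (snd z)) = 1"
    if "z \<in> space (hist_space D n)" for n z
    using that \<phi> A by (auto simp: stationary_policy_def hist_space_def space_pair_measure
        state_space_def space_restrict_space stationary_def)
  ultimately show ?thesis by (simp add: is_policy_def)
qed



section \<open>The HV transformation\<close>

definition hv_states :: "('x, 'a) mdp \<Rightarrow> 'x option set" where
  "hv_states D = insert None (Some ` states D)"

text \<open>
  Off the graph of the new action sets the value of the kernel is irrelevant. The lemmas
  \<open>hv_kern_Some\<close> and \<open>hv_kern_None\<close> below show that \<^const>\<open>measure_of\<close> is applied to a measure.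
\<close>

definition hv_kern ::
  "real \<Rightarrow> ('x \<Rightarrow> real) \<Rightarrow> ('x::topological_space, 'a) mdp \<Rightarrow>
     'x option \<times> 'a option \<Rightarrow> 'x option measure" where
  "hv_kern \<beta> \<mu> D z =
     measure_of (hv_states D) (sets (restrict_space borel (hv_states D)))
       (case z of
          (Some x, Some a) \<Rightarrow> (\<lambda>B.
             ennreal (1 / (\<beta> * \<mu> x)) *
               (\<integral>\<^sup>+y. ennreal (\<mu> y) * indicator B (Some y) \<partial>kern D (x, a)) +
             (1 - ennreal (1 / (\<beta> * \<mu> x)) * (\<integral>\<^sup>+y. ennreal (\<mu> y) \<partial>kern D (x, a))) *
               indicator B None)
        | _ \<Rightarrow> (\<lambda>B. indicator B None))"

definition hv_mdp ::
  "real \<Rightarrow> ('x \<Rightarrow> real) \<Rightarrow> ('x::topological_space, 'a) mdp \<Rightarrow> ('x option, 'a option) mdp" where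
  "hv_mdp \<beta> \<mu> D =
     \<lparr> states = hv_states D,
       actions = insert None (Some ` actions D),
       avail = (\<lambda>x. case x of Some x \<Rightarrow> Some ` avail D x | None \<Rightarrow> {None}),
       cost = (\<lambda>z. case z of (Some x, Some a) \<Rightarrow> cost D (x, a) / \<mu> x | _ \<Rightarrow> 0),
       kern = hv_kern \<beta> \<mu> D \<rparr>"

text \<open>Since \<^term>\<open>map_option \<phi> None = None\<close>, this is \<open>\<phi>\<close> extended by the added action.\<close>

definition hv_policy ::
  "real \<Rightarrow> ('x \<Rightarrow> real) \<Rightarrow> ('x::topological_space, 'a::topological_space) mdp \<Rightarrow> ('x \<Rightarrow> 'a) \<Rightarrow>
     ('x option, 'a option) policy" where
  "hv_policy \<beta> \<mu> D \<phi> = stationary_policy (hv_mdp \<beta> \<mu> D) (map_option \<phi>)"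

lemma measurable_Some_hv:
  fixes D :: "('x::topological_space, 'a) mdp"
  shows "Some \<in> measurable (state_space D) (restrict_space borel (hv_states D))"
proof -
  have "continuous_on UNIV (Some :: 'x \<Rightarrow> 'x option)"
    by (simp add: continuous_on_open_vimage open_option_def)
  then have "Some \<in> borel_measurable (state_space D)"
    unfolding state_space_def
    by (intro measurable_restrict_space1 borel_measurable_continuous_onI)
  then show ?thesis
    by (intro measurable_restrict_space2)
       (auto simp: state_space_def space_restrict_space hv_states_def)
qed

lemma hv_kern_Some:
  fixes D :: "('x::polish_space, 'a::polish_space) mdp"
  assumes D: "mdp_model D" and xa: "(x, a) \<in> gr D" and \<mu>: "continuous_on (states D) \<mu>"
  shows "sets (hv_kern \<beta> \<mu> D (Some x, Some a)) = sets (restrict_space borel (hv_states D))"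
    and "B \<in> sets (state_space D) \<Longrightarrow> emeasure (hv_kern \<beta> \<mu> D (Some x, Some a)) (Some ` B) =
        ennreal (1 / (\<beta> * \<mu> x)) * (\<integral>\<^sup>+y\<in>B. ennreal (\<mu> y) \<partial>kern D (x, a))"
    and "emeasure (hv_kern \<beta> \<mu> D (Some x, Some a)) {None} =
        1 - ennreal (1 / (\<beta> * \<mu> x)) * (\<integral>\<^sup>+y. ennreal (\<mu> y) \<partial>kern D (x, a))"
proof -
  let ?S = "restrict_space borel (hv_states D)" and ?q = "kern D (x, a)"
  let ?c = "ennreal (1 / (\<beta> * \<mu> x))"
  let ?r = "1 - ?c * (\<integral>\<^sup>+y. ennreal (\<mu> y) \<partial>?q)"
  let ?f = "\<lambda>B. ?c * (\<integral>\<^sup>+y. ennreal (\<mu> y) * indicator B (Some y) \<partial>?q) + ?r * indicator B None"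
  let ?d = "distr (density ?q (\<lambda>y. ?c * ennreal (\<mu> y))) ?S Some"
  note q = sets_kern[OF D xa]
  have \<mu>m[measurable]: "\<mu> \<in> borel_measurable ?q"
    using borel_measurable_continuous_on_restrict[OF \<mu>]
    by (simp cong: measurable_cong_sets add: q(1) state_space_def)
  have Some_q[measurable]: "Some \<in> measurable ?q ?S"
    using measurable_Some_hv[of D] by (simp cong: measurable_cong_sets add: q(1))
  have sS: "space ?S = hv_states D" by (simp add: space_restrict_space)
  have N: "{None} \<in> sets ?S"
  proof -
    have "{None} = hv_states D \<inter> {None}" by (auto simp: hv_states_def)
    then show ?thesis unfolding sets_restrict_space by (rule image_eqI) (simp add: borel_closed)
  qed
  have eq: "?f B = emeasure ?d B + ?r * emeasure (return ?S None) B" if B: "B \<in> sets ?S" for B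
  proof -
    have "(\<integral>\<^sup>+y. (?c * ennreal (\<mu> y)) * indicator (Some -` B \<inter> space ?q) y \<partial>?q) =
        ?c * (\<integral>\<^sup>+y. ennreal (\<mu> y) * indicator B (Some y) \<partial>?q)"
      using B Some_q
      by (subst nn_integral_cmult[symmetric])
         (auto intro!: nn_integral_cong measurable_compose[OF Some_q] simp: mult.assoc split: split_indicator)
    moreover have "emeasure ?d B =
        (\<integral>\<^sup>+y. (?c * ennreal (\<mu> y)) * indicator (Some -` B \<inter> space ?q) y \<partial>?q)"
      using B Some_q measurable_sets[OF Some_q B]
      by (subst emeasure_distr) (auto simp: emeasure_density)
    ultimately show ?thesis using B by simp
  qed
  have "measure_space (space ?S) (sets ?S) ?f"
    unfolding measure_space_def
  proof (intro conjI)
    show "sigma_algebra (space ?S) (sets ?S)" by (rule sets.sigma_algebra_axioms)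
    show "positive (sets ?S) ?f" by (simp add: positive_def)
    show "countably_additive (sets ?S) ?f"
    proof (rule countably_additiveI)
      fix A :: "nat \<Rightarrow> 'x option set"
      assume A: "range A \<subseteq> sets ?S" "disjoint_family A" "(\<Union>i. A i) \<in> sets ?S"
      have "(\<Sum>i. ?f (A i)) = (\<Sum>i. emeasure ?d (A i) + ?r * emeasure (return ?S None) (A i))"
        using A(1) by (intro suminf_cong eq) auto
      also have "\<dots> = (\<Sum>i. emeasure ?d (A i)) + ?r * (\<Sum>i. emeasure (return ?S None) (A i))"
        by (subst suminf_add[symmetric]) auto
      also have "\<dots> = emeasure ?d (\<Union>i. A i) + ?r * emeasure (return ?S None) (\<Union>i. A i)"
        using A by (subst (1 2) suminf_emeasure) auto
      finally show "(\<Sum>i. ?f (A i)) = ?f (\<Union>i. A i)" using eq[OF A(3)] by simp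
    qed
  qed
  then have em: "emeasure (hv_kern \<beta> \<mu> D (Some x, Some a)) B = ?f B" if "B \<in> sets ?S" for B
    using that emeasure_measure_of_sigma[of "hv_states D" "sets ?S" ?f B]
    by (simp add: hv_kern_def sS measure_space_def)
  show sets: "sets (hv_kern \<beta> \<mu> D (Some x, Some a)) = sets ?S"
    using sets.sets_measure_of_eq[of ?S] sets.space_closed[of ?S] by (simp add: hv_kern_def sS)
  show "emeasure (hv_kern \<beta> \<mu> D (Some x, Some a)) {None} = ?r"
    using em[OF N] by simp
  show "emeasure (hv_kern \<beta> \<mu> D (Some x, Some a)) (Some ` B) =
      ?c * (\<integral>\<^sup>+y\<in>B. ennreal (\<mu> y) \<partial>?q)" if B: "B \<in> sets (state_space D)"
  proof -
    have "indicator (Some ` B) (Some y) = (indicator B y :: ennreal)" for y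
      by (auto split: split_indicator)
    moreover have "Some ` B \<in> sets ?S"
    proof -
      have "B \<in> sets borel" "B \<subseteq> states D"
        using B D by (auto simp: state_space_def mdp_model_def sets_restrict_space)
      have the_Some: "Some -` (the -` U) = U" "Some -` range Some = (UNIV :: 'x set)" for U :: "'x set"
        by auto
      have "continuous_on UNIV (the :: 'x option \<Rightarrow> 'x)"
        by (simp add: continuous_on_open_vimage open_option_def the_Some)
      then have "the -` B \<in> sets borel"
        using measurable_sets[OF borel_measurable_continuous_onI \<open>B \<in> sets borel\<close>, of the] by simp
      moreover have "open (range (Some :: 'x \<Rightarrow> 'x option))"
        by (simp add: open_option_def the_Some)
      ultimately have "the -` B \<inter> range Some \<in> sets borel" by auto
      moreover have "Some ` B = hv_states D \<inter> (the -` B \<inter> range Some)"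
        using \<open>B \<subseteq> states D\<close> by (auto simp: hv_states_def)
      ultimately show ?thesis unfolding sets_restrict_space by blast
    qed
    ultimately show ?thesis using em[of "Some ` B"] by simp
  qed
qed

lemma hv_kern_None: "hv_kern \<beta> \<mu> D (None, None) = return (restrict_space borel (hv_states D)) None"
  by (simp add: hv_kern_def return_def space_restrict_space)

end

theory Submission
  imports Defs
begin

text \<open>
  By the drift inequality and \<open>V \<le> \<mu> \<le> K V\<close>, the mass of \<open>\<mu> q / (\<beta> \<mu>)\<close> is at most
  \<open>(K - 1) / (\<beta> K) \<le> 1\<close>, so \<open>p\<close> is a probability kernel. It is weakly continuous because
  \<open>(x, a) \<mapsto> \<integral>g dq\<close> is continuous for every continuous \<open>g\<close> with \<open>0 \<le> g \<le> C V\<close>: the integrals of \<open>g\<close>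
  and of \<open>C V - g\<close> are lower semicontinuous and add up to a continuous function.

  For the discounted problem the value iterates \<open>v\<^sub>n\<close> started at 0 are lower semicontinuous and
  increase to a fixed point \<open>v\<close> of the optimality operator, by compactness of the action sets. Backward
  induction along the Ionescu Tulcea construction shows that every policy costs at least \<open>v\<^sub>n\<close>, hence
  at least \<open>v\<close>. Conversely, a stationary policy attaining the minimum in the optimality equation
  costs at most \<open>v\<close>, and a Borel one exists by lexicographic minimisation of the distances to a
  dense sequence over the compact sets of minimisers. Costs may be infinite throughout, so no
  contraction argument is used.
\<close>

text \<open>The obstacle on the analytic side is that \<open>V\<close> and \<open>\<mu>\<close> are
  unbounded, so weak continuity alone gives only lower semicontinuity of their integrals; the
  assumed continuity of the integral of \<open>V\<close> supplies the missing upper half.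
  Semicontinuity is formulated in \<open>ennreal\<close>, so that integrals and suprema always
  exist. On the control side, nonnegativity of the costs does the main work. The cost of a policy is
  the supremum of its finite-horizon costs with terminal cost 0, so every \<open>v\<close> whose
  one-step value along a stationary policy is at most \<open>v\<close> dominates the cost of that
  policy. This is why solving the optimality equation already makes a policy optimal, even at states
  of infinite value. The new state space and the new graph are disjoint sums of the old ones with a
  single isolated point. Topological and measurable statements about them are therefore checked
  after pulling back to the old part.\<close>

section \<open>Lower semicontinuous functions\<close>

text \<open>The values are extended, unlike in \<open>lower_semicontinuous_on\<close>, and openness
  is relative to \<open>S\<close>, because state spaces and graphs are merely Borel subsets of the
  ambient spaces.\<close>

definition lsc :: "'s::topological_space set \<Rightarrow> ('s \<Rightarrow> ennreal) \<Rightarrow> bool" where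
  "lsc S f \<longleftrightarrow> (\<forall>r. openin (top_of_set S) {s\<in>S. r < f s})"

lemma lsc_cong: "(\<And>x. x \<in> S \<Longrightarrow> f x = g x) \<Longrightarrow> lsc S f \<longleftrightarrow> lsc S g"
  unfolding lsc_def by (intro all_cong1 arg_cong[where f="openin _"]) auto

lemma lsc_SUP:
  assumes "\<And>i. i \<in> I \<Longrightarrow> lsc S (f i)"
  shows "lsc S (\<lambda>x. SUP i\<in>I. f i x)"
  unfolding lsc_def
proof
  fix r
  have "{s \<in> S. r < (SUP i\<in>I. f i s)} = (\<Union>i\<in>I. {s \<in> S. r < f i s})"
    by (auto simp: less_SUP_iff)
  then show "openin (top_of_set S) {s \<in> S. r < (SUP i\<in>I. f i s)}"
    using assms by (auto simp: lsc_def)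
qed

lemma lsc_continuous:
  assumes "continuous_on S f" shows "lsc S f"
  unfolding lsc_def
proof
  fix r
  have "{s \<in> S. r < f s} = S \<inter> f -` {r<..}" by auto
  then show "openin (top_of_set S) {s \<in> S. r < f s}"
    using continuous_openin_preimage_gen[OF assms open_greaterThan, of r] by simp
qed

text \<open>Addition on \<open>ennreal\<close> is continuous, also at infinity, so the strict
  inequality survives on a product of left neighbourhoods of \<open>a\<close> and \<open>b\<close>.
  Positivity is what makes these neighbourhoods nontrivial.\<close>

lemma ennreal_less_addE:
  fixes r a b :: ennreal
  assumes "r < a + b" "0 < a" "0 < b"
  obtains s t where "s < a" "t < b" "r < s + t"
proof -
  have "((\<lambda>p. fst p + snd p) \<longlongrightarrow> a + b) (at_left a \<times>\<^sub>F at_left b)"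
    by (intro tendsto_add filterlim_compose[OF _ filterlim_fst] filterlim_compose[OF _ filterlim_snd]) auto
  from order_tendstoD(1)[OF this assms(1)]
  have "\<forall>\<^sub>F p in at_left a \<times>\<^sub>F at_left b. r < fst p + snd p" .
  moreover have "\<forall>\<^sub>F p in at_left a \<times>\<^sub>F at_left b. fst p < a \<and> snd p < b"
    using eventually_prodI[of "\<lambda>s. s < a" "at_left a" "\<lambda>t. t < b" "at_left b"]
    by (simp add: case_prod_beta eventually_at_filter)
  ultimately have "\<forall>\<^sub>F p in at_left a \<times>\<^sub>F at_left b. r < fst p + snd p \<and> fst p < a \<and> snd p < b"
    by (rule eventually_conj)
  moreover have "at_left c \<noteq> bot" if "0 < c" for c :: ennreal
  proof
    assume "at_left c = bot"
    then have "eventually (\<lambda>_. False) (at_left c)" by simp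
    then show False using eventually_at_left[OF that, of "\<lambda>_. False"] dense by auto
  qed
  then have "at_left a \<times>\<^sub>F at_left b \<noteq> bot"
    using assms(2,3) by (simp add: prod_filter_eq_bot)
  ultimately show ?thesis using that eventually_happens by blast
qed

text \<open>A superlevel set of the sum is the union of the sets where \<open>f > a\<close> and
  \<open>g > b\<close>, over all pairs with \<open>r < a + b\<close>. This avoids subtracting
  possibly infinite values. Points where one summand vanishes admit no smaller level and are covered
  by the superlevel sets of the single functions.\<close>

lemma lsc_add:
  assumes f: "lsc S f" and g: "lsc S g"
  shows "lsc S (\<lambda>x. f x + g x)"
  unfolding lsc_def
proof
  fix r
  have o: "openin (top_of_set S) {s \<in> S. a < f s}" "openin (top_of_set S) {s \<in> S. a < g s}" for a
    using f g by (auto simp: lsc_def)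
  have eq: "{s \<in> S. r < f s + g s} = {s \<in> S. r < f s} \<union> {s \<in> S. r < g s} \<union>
      (\<Union>p\<in>{(a, b). r < a + b}. {s \<in> S. fst p < f s} \<inter> {s \<in> S. snd p < g s})" (is "?L = ?R")
  proof (intro antisym subsetI)
    fix s assume s: "s \<in> ?L"
    show "s \<in> ?R"
    proof (cases "f s = 0 \<or> g s = 0")
      case True then show ?thesis using s by auto
    next
      case False
      then obtain a b where "a < f s" "b < g s" "r < a + b"
        using ennreal_less_addE[of r "f s" "g s"] s by (auto simp: zero_less_iff_neq_zero)
      then show ?thesis using s by auto
    qed
  next
    fix s assume "s \<in> ?R"
    then show "s \<in> ?L"
      by (auto intro: less_le_trans add_increasing add_increasing2 dest: add_strict_mono)
  qed
  show "openin (top_of_set S) ?L"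
    unfolding eq using openin_Int[OF o]
    by (intro openin_Un openin_Union o) (auto simp: Collect_conj_eq)
qed

lemma lsc_cmult:
  assumes f: "lsc S f" and c: "c < \<top>"
  shows "lsc S (\<lambda>x. c * f x)"
proof (cases "c = 0")
  case True then show ?thesis by (simp add: lsc_continuous)
next
  case False
  have "r < c * t \<longleftrightarrow> r / c < t" for r t
    using False c by (simp add: mult.commute divide_less_ennreal)
  then show ?thesis using f by (simp add: lsc_def)
qed

lemma borel_measurable_lsc:
  assumes "lsc S f" shows "f \<in> borel_measurable (restrict_space borel S)"
proof (rule borel_measurableI_greater)
  fix r
  obtain T where "open T" "{s \<in> S. r < f s} = S \<inter> T"
    using assms by (auto simp: lsc_def openin_open)
  then show "{x \<in> space (restrict_space borel S). r < f x} \<in> sets (restrict_space borel S)"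
    by (auto simp: sets_restrict_space space_restrict_space)
qed

text \<open>Truncation at \<open>n\<close> makes the function finite, and an infimal convolution
  with \<open>n\<close> times the distance makes it Lipschitz. Lower semicontinuity is used only to
  show that nothing is lost in the supremum.\<close>

lemma lsc_approximation:
  fixes u :: "'s::metric_space \<Rightarrow> ennreal"
  assumes u: "lsc S u"
  obtains f :: "nat \<Rightarrow> 's \<Rightarrow> real" where "\<And>n. continuous_on S (f n)"
    "\<And>n x. x \<in> S \<Longrightarrow> 0 \<le> f n x" "\<And>n x. x \<in> S \<Longrightarrow> f n x \<le> real n"
    "\<And>x. x \<in> S \<Longrightarrow> incseq (\<lambda>n. f n x)" "\<And>x. x \<in> S \<Longrightarrow> u x = (SUP n. ennreal (f n x))"
proof
  define w where "w n y = enn2real (min (u y) (of_nat n))" for n y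
  \<comment> \<open>The Pasch-Hausdorff envelope: the largest \<open>n\<close>-Lipschitz function on
    \<open>S\<close> below the truncation \<open>w n\<close>.\<close>
  define f where "f n x = (INF y\<in>S. w n y + real n * dist x y)" for n x
  have w: "0 \<le> w n y" "ennreal (w n y) = min (u y) (of_nat n)" "w n y \<le> real n" for n y
  proof -
    have "min (u y) (of_nat n) < \<top>" by (simp add: min_less_iff_disj of_nat_less_top)
    then show "ennreal (w n y) = min (u y) (of_nat n)" by (simp add: w_def)
    then have "ennreal (w n y) \<le> ennreal (real n)" by (simp add: ennreal_of_nat_eq_real_of_nat)
    then show "w n y \<le> real n" by simp
    show "0 \<le> w n y" by (simp add: w_def)
  qed
  have bdd: "bdd_below ((\<lambda>y. w n y + real n * dist x y) ` S)" for n x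
    using w by (intro bdd_belowI2[of _ 0]) auto
  have f_le: "f n x \<le> w n y + real n * dist x y" if "y \<in> S" for n x y
    unfolding f_def using that bdd by (rule cINF_lower[rotated])
  show f0: "0 \<le> f n x" if "x \<in> S" for n x
    unfolding f_def using that w by (intro cINF_greatest) auto
  have fw: "f n x \<le> w n x" if "x \<in> S" for n x
    using f_le[OF that, of n x] by simp
  then show "f n x \<le> real n" if "x \<in> S" for n x
    using w(3) that order_trans by blast
  have lip: "f n x \<le> f n x' + real n * dist x x'" if "x \<in> S" for n x x'
  proof -
    have "f n x - real n * dist x x' \<le> f n x'"
      unfolding f_def[of n x']
    proof (rule cINF_greatest)
      fix y assume "y \<in> S"
      have "f n x \<le> w n y + real n * dist x y" by (rule f_le[OF \<open>y \<in> S\<close>])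
      also have "\<dots> \<le> w n y + real n * (dist x x' + dist x' y)"
        by (intro add_left_mono mult_left_mono dist_triangle) auto
      finally show "f n x - real n * dist x x' \<le> w n y + real n * dist x' y"
        by (simp add: algebra_simps)
    qed (use that in auto)
    then show ?thesis by simp
  qed
  have "\<bar>f n x - f n y\<bar> \<le> real n * dist x y" if "x \<in> S" "y \<in> S" for n x y
    using lip[OF that(1), of n y] lip[OF that(2), of n x] by (simp add: dist_commute abs_le_iff)
  then have "(real n)-lipschitz_on S (f n)" for n
    by (intro lipschitz_onI) (auto simp: dist_real_def)
  then show "continuous_on S (f n)" for n by (rule lipschitz_on_continuous_on)
  show inc: "incseq (\<lambda>n. f n x)" if "x \<in> S" for x
  proof (rule incseq_SucI)
    fix n
    have "w n y \<le> w (Suc n) y" for y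
      unfolding w_def by (intro enn2real_mono min.mono) (auto simp: min_less_iff_disj of_nat_less_top)
    then show "f n x \<le> f (Suc n) x"
      unfolding f_def using that bdd
      by (intro cINF_mono) (auto intro!: bexI add_mono mult_right_mono)
  qed
  show "u x = (SUP n. ennreal (f n x))" if x: "x \<in> S" for x
  proof (rule antisym)
    show "(SUP n. ennreal (f n x)) \<le> u x"
    proof (rule SUP_least)
      fix n
      have "ennreal (f n x) \<le> ennreal (w n x)" using fw[OF x] by (intro ennreal_leI)
      then show "ennreal (f n x) \<le> u x" by (simp add: w)
    qed
    show "u x \<le> (SUP n. ennreal (f n x))"
    proof (rule dense_le)
      fix r assume r: "r < u x"
      then obtain r' where r': "r = ennreal r'" "0 \<le> r'" by (cases r) auto
      obtain T where T: "open T" "{s\<in>S. r < u s} = S \<inter> T"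
        using u by (auto simp: lsc_def openin_open)
      then have "x \<in> T" using r x by auto
      then obtain d where d: "d > 0" "\<And>y. dist x y < d \<Longrightarrow> y \<in> T"
        using T(1) by (auto simp: open_contains_ball mem_ball subset_eq)
      \<comment> \<open>The two bounds serve two regions: within distance \<open>d\<close> of
        \<open>x\<close> the function \<open>u\<close> exceeds \<open>r\<close>, so truncation at
        \<open>n \<ge> r'\<close> keeps \<open>w n y \<ge> r'\<close>; farther away the penalty
        \<open>n * d\<close> alone reaches \<open>r'\<close>.\<close>
      obtain n where n: "real n \<ge> r'" "real n \<ge> r' / d"
        using real_arch_simple[of "max r' (r' / d)"] by auto
      have "r' \<le> f n x"
        unfolding f_def
      proof (rule cINF_greatest)
        fix y assume y: "y \<in> S"
        show "r' \<le> w n y + real n * dist x y"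
        proof (cases "dist x y < d")
          case True
          then have "r < u y" using d(2) T(2) y by auto
          moreover have "r \<le> of_nat n" using n(1) r' by (simp add: ennreal_of_nat_eq_real_of_nat)
          ultimately have "ennreal r' \<le> ennreal (w n y)" by (simp add: w r')
          then have "r' \<le> w n y" using w(1) by simp
          then show ?thesis by (simp add: add_increasing2)
        next
          case False
          have "r' \<le> real n * d" using n(2) d(1) by (simp add: field_simps)
          also have "\<dots> \<le> real n * dist x y" using False by (intro mult_left_mono) auto
          finally show ?thesis using w(1)[of n y] by simp
        qed
      qed (use x in auto)
      then show "r \<le> (SUP n. ennreal (f n x))"
        unfolding r'(1) by (intro SUP_upper2[of n]) (auto intro: ennreal_leI)
    qed
  qed
qed

text \<open>One half of the portmanteau theorem, for extended-valued integrands: each bounded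
  continuous approximation from below has a continuous integral, and by monotone convergence the
  integral of \<open>u\<close> is the supremum of these.\<close>

lemma lsc_nn_integral:
  fixes \<kappa> :: "'s::topological_space \<Rightarrow> 't::metric_space measure"
  assumes \<kappa>: "transition_kernel G S \<kappa>" and w: "weakly_continuous G S \<kappa>" and u: "lsc S u"
  shows "lsc G (\<lambda>z. \<integral>\<^sup>+y. u y \<partial>\<kappa> z)"
proof -
  obtain f :: "nat \<Rightarrow> 't \<Rightarrow> real" where f: "\<And>n. continuous_on S (f n)"
    "\<And>n x. x \<in> S \<Longrightarrow> 0 \<le> f n x" "\<And>n x. x \<in> S \<Longrightarrow> f n x \<le> real n"
    "\<And>x. x \<in> S \<Longrightarrow> incseq (\<lambda>n. f n x)" "\<And>x. x \<in> S \<Longrightarrow> u x = (SUP n. ennreal (f n x))"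
    using lsc_approximation[OF u] by metis
  have sets: "sets (\<kappa> z) = sets (restrict_space borel S)" and fin: "finite_measure (\<kappa> z)"
    and sp: "space (\<kappa> z) = S" if "z \<in> G" for z
    using \<kappa> that sets_eq_imp_space_eq[of "\<kappa> z" "restrict_space borel S"]
    by (auto simp: transition_kernel_def space_restrict_space)
  have m: "f n \<in> borel_measurable (\<kappa> z)" if "z \<in> G" for n z
    using borel_measurable_continuous_on_restrict[OF f(1)]
    by (simp cong: measurable_cong_sets add: sets[OF that])
  have int: "(\<integral>\<^sup>+y. ennreal (f n y) \<partial>\<kappa> z) = ennreal (\<integral>y. f n y \<partial>\<kappa> z)" if z: "z \<in> G" for n z
  proof -
    interpret finite_measure "\<kappa> z" by (rule fin[OF z])
    have "integrable (\<kappa> z) (f n)"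
      using f(2,3) by (intro integrable_const_bound[of _ "real n"] m z) (auto simp: sp[OF z])
    then show ?thesis
      using f(2) by (intro nn_integral_eq_integral) (auto simp: sp[OF z])
  qed
  have "lsc G (\<lambda>z. SUP n. \<integral>\<^sup>+y. ennreal (f n y) \<partial>\<kappa> z)"
  proof (rule lsc_SUP)
    fix n
    have "bounded (f n ` S)"
      using f(2,3) by (auto simp: bounded_iff intro!: exI[of _ "real n"])
    then have "continuous_on G (\<lambda>z. \<integral>y. f n y \<partial>\<kappa> z)"
      using w f(1) by (auto simp: weakly_continuous_def)
    then have "lsc G (\<lambda>z. ennreal (\<integral>y. f n y \<partial>\<kappa> z))"
      by (intro lsc_continuous continuous_on_ennreal)
    then show "lsc G (\<lambda>z. \<integral>\<^sup>+y. ennreal (f n y) \<partial>\<kappa> z)"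
      by (subst lsc_cong[OF int])
  qed
  moreover have "(SUP n. \<integral>\<^sup>+y. ennreal (f n y) \<partial>\<kappa> z) = (\<integral>\<^sup>+y. u y \<partial>\<kappa> z)" if z: "z \<in> G" for z
  proof -
    have "(SUP n. \<integral>\<^sup>+y. ennreal (f n y) \<partial>\<kappa> z) = (\<integral>\<^sup>+y. (SUP n. ennreal (f n y)) \<partial>\<kappa> z)"
      using m[OF z] f(4)
      by (intro nn_integral_monotone_convergence_SUP_AE[symmetric])
         (auto simp: sp[OF z] incseq_Suc_iff intro!: ennreal_leI)
    also have "\<dots> = (\<integral>\<^sup>+y. u y \<partial>\<kappa> z)"
      by (intro nn_integral_cong) (simp add: sp[OF z] f(5))
    finally show ?thesis .
  qed
  ultimately show ?thesis by (subst (asm) lsc_cong) auto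
qed

lemma lsc_compose:
  assumes f: "lsc T f" and h: "continuous_on S h" "h \<in> S \<rightarrow> T"
  shows "lsc S (\<lambda>x. f (h x))"
  unfolding lsc_def
proof
  fix r
  obtain U where U: "open U" "{t \<in> T. r < f t} = T \<inter> U"
    using f by (auto simp: lsc_def openin_open)
  have "{s \<in> S. r < f (h s)} = S \<inter> h -` U"
    using U(2) h(2) by (auto simp: Pi_iff set_eq_iff)
  then show "openin (top_of_set S) {s \<in> S. r < f (h s)}"
    using continuous_openin_preimage_gen[OF h(1) U(1)] by simp
qed

lemma lsc_subset: "lsc T f \<Longrightarrow> S \<subseteq> T \<Longrightarrow> lsc S f"
  using lsc_compose[of T f S "\<lambda>x. x"] by (auto simp: Pi_iff)

text \<open>Without a minimiser the open sets of points strictly worse than some \<open>b\<close>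
  would cover \<open>K\<close>. The best of the finitely many indices of a subcover would then lie
  in none of its sets.\<close>

lemma lsc_attains_inf:
  assumes K: "compact K" "K \<noteq> {}" and g: "lsc K g"
  shows "\<exists>a\<in>K. \<forall>b\<in>K. g a \<le> g b"
proof (rule ccontr)
  assume "\<not> ?thesis"
  then have ex: "\<exists>b\<in>K. g b < g a" if "a \<in> K" for a
    using that by (meson not_le)
  have "\<exists>U. open U \<and> {a \<in> K. g b < g a} = K \<inter> U" for b
    using g by (auto simp: lsc_def openin_open)
  then obtain U where U: "\<And>b. open (U b)" "\<And>b. {a \<in> K. g b < g a} = K \<inter> U b"
    by metis
  have "K \<subseteq> (\<Union>b\<in>K. U b)" using ex U(2) by blast
  then obtain C where C: "C \<subseteq> K" "finite C" "K \<subseteq> (\<Union>b\<in>C. U b)"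
    using compactE_image[OF K(1), of K U] U(1) by metis
  then have "C \<noteq> {}" using K(2) by auto
  then obtain a where a: "a \<in> C" "\<forall>b\<in>C. g a \<le> g b"
    using ex_is_arg_min_if_finite[OF C(2), of g] by (auto simp: is_arg_min_linorder)
  then obtain b where "b \<in> C" "a \<in> U b" using C by blast
  then show False using U(2)[of b] a C(1) by (auto simp: not_le[symmetric])
qed

text \<open>The tube lemma encloses the compact fibre over \<open>x\<close> in a box
  \<open>U \<times> Q\<close> inside the open set, and upper semicontinuity keeps the fibres over
  nearby points inside \<open>Q\<close>.\<close>

lemma openin_fibre_subset:
  fixes A :: "'s::topological_space \<Rightarrow> 'a::topological_space set"
  assumes A: "\<And>x. x \<in> S \<Longrightarrow> compact (A x)"
    and usc: "\<And>U. open U \<Longrightarrow> openin (top_of_set S) {x\<in>S. A x \<subseteq> U}"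
    and W: "openin (top_of_set (Sigma S A)) W"
  shows "openin (top_of_set S) {x\<in>S. {x} \<times> A x \<subseteq> W}"
proof (subst openin_subopen, safe)
  fix x assume x: "x \<in> S" "{x} \<times> A x \<subseteq> W"
  obtain W' where W': "open W'" "W = Sigma S A \<inter> W'" using W by (auto simp: openin_open)
  obtain U Q where U: "open U" "open Q" "x \<in> U" "A x \<subseteq> Q" "U \<times> Q \<subseteq> W'"
    using tube_lemma_right[of euclidean euclidean W' "A x" x] A[OF x(1)] x(2) W'
    by (auto simp: euclidean_product_topology)
  have "openin (top_of_set S) ((S \<inter> U) \<inter> {y\<in>S. A y \<subseteq> Q})"
    using U by (intro openin_Int usc openin_open_Int) auto
  moreover have "(S \<inter> U) \<inter> {y\<in>S. A y \<subseteq> Q} \<subseteq> {x\<in>S. {x} \<times> A x \<subseteq> W}"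
    unfolding W'(2) using U(5) by blast
  ultimately show "\<exists>T. openin (top_of_set S) T \<and> x \<in> T \<and> T \<subseteq> {x\<in>S. {x} \<times> A x \<subseteq> W}"
    using x(1) U(3,4) by blast
qed

section \<open>Measurable selection of minimisers\<close>

text \<open>Measurability is tested on closed sets because these are stable under intersection with
  the closed sublevel sets of a distance function. This keeps the class closed under repeated
  minimisation of distances.\<close>

definition compact_measurable :: "'s measure \<Rightarrow> ('s \<Rightarrow> 'a::topological_space set) \<Rightarrow> bool" where
  "compact_measurable M \<Phi> \<longleftrightarrow> (\<forall>x\<in>space M. compact (\<Phi> x) \<and> \<Phi> x \<noteq> {}) \<and>
     (\<forall>F. closed F \<longrightarrow> {x\<in>space M. \<Phi> x \<inter> F \<noteq> {}} \<in> sets M)"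

definition argmins :: "('a \<Rightarrow> 'b::linorder) \<Rightarrow> 'a set \<Rightarrow> 'a set" where
  "argmins g K = {a\<in>K. \<forall>b\<in>K. g a \<le> g b}"

text \<open>The minimisers are what remains of \<open>K\<close> after removing, for every
  \<open>b\<close>, the relatively open set of points worse than \<open>b\<close>; hence they form a
  closed subset of \<open>K\<close>.\<close>

lemma compact_argmins:
  assumes K: "compact K" and g: "lsc K g"
  shows "compact (argmins g K)"
proof -
  have "closedin (top_of_set K) (K - (\<Union>b\<in>K. {a\<in>K. g b < g a}))"
    using g by (intro closedin_diff openin_Union) (auto simp: lsc_def)
  moreover have "K - (\<Union>b\<in>K. {a\<in>K. g b < g a}) = argmins g K"
    by (auto simp: argmins_def not_less)
  ultimately show ?thesis using closedin_compact[OF K] by simp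
qed

text \<open>The minimisers meet \<open>F\<close> exactly when the minimum over the part of the fibre
  in \<open>F\<close> equals the minimum over the whole fibre. Both minima are attained, so
  countably many levels suffice to compare them.\<close>

lemma compact_measurable_argmins:
  fixes \<Phi> :: "'s \<Rightarrow> 'a::t2_space set"
  assumes \<Phi>: "compact_measurable M \<Phi>"
    and g: "\<And>x. x \<in> space M \<Longrightarrow> lsc (\<Phi> x) (g x)"
    and m: "\<And>F r. closed F \<Longrightarrow> {x\<in>space M. \<exists>a\<in>\<Phi> x \<inter> F. g x a \<le> r} \<in> sets M"
  shows "compact_measurable M (\<lambda>x. argmins (g x) (\<Phi> x))"
  unfolding compact_measurable_def
proof (intro conjI ballI allI impI)
  fix x assume x: "x \<in> space M"
  then have c: "compact (\<Phi> x)" "\<Phi> x \<noteq> {}" using \<Phi> by (auto simp: compact_measurable_def)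
  show "compact (argmins (g x) (\<Phi> x))" by (rule compact_argmins[OF c(1) g[OF x]])
  show "argmins (g x) (\<Phi> x) \<noteq> {}"
    using lsc_attains_inf[OF c g[OF x]] by (auto simp: argmins_def)
next
  fix F :: "'a set" assume F: "closed F"
  have c: "compact (\<Phi> x)" "\<Phi> x \<noteq> {}" if "x \<in> space M" for x
    using \<Phi> that by (auto simp: compact_measurable_def)
  let ?L = "\<lambda>F r. {x\<in>space M. \<exists>a\<in>\<Phi> x \<inter> F. g x a \<le> r}"
  \<comment> \<open>The removed union consists of the points where some rational level is reached on
    the whole fibre but not inside \<open>F\<close>, that is, where the minimum over
    \<open>F\<close> is strictly larger.\<close>
  have eq: "{x\<in>space M. argmins (g x) (\<Phi> x) \<inter> F \<noteq> {}} = {x\<in>space M. \<Phi> x \<inter> F \<noteq> {}} -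
      (\<Union>r\<in>\<rat>. ?L UNIV (ennreal r) - ?L F (ennreal r))" (is "?A = ?B")
  proof (intro antisym subsetI)
    fix x assume "x \<in> ?A" then show "x \<in> ?B" by (auto simp: argmins_def intro: order_trans)
  next
    fix x assume x: "x \<in> ?B"
    then have xM: "x \<in> space M" by auto
    have "compact (\<Phi> x \<inter> F)" "\<Phi> x \<inter> F \<noteq> {}" "lsc (\<Phi> x \<inter> F) (g x)"
      using c[OF xM] F x lsc_subset[OF g[OF xM]] by (auto intro: compact_Int_closed)
    from lsc_attains_inf[OF this]
    obtain a where a: "a \<in> \<Phi> x \<inter> F" "\<And>b. b \<in> \<Phi> x \<inter> F \<Longrightarrow> g x a \<le> g x b" by blast
    have "g x a \<le> g x b" if b: "b \<in> \<Phi> x" for b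
    proof (rule ccontr)
      assume "\<not> g x a \<le> g x b"
      then obtain r where r: "r \<in> \<rat>" "g x b < ennreal r" "ennreal r < g x a"
        using ennreal_rat_dense[of "g x b" "g x a"] by (auto simp: not_le Rats_def)
      then have "x \<in> ?L UNIV (ennreal r) - ?L F (ennreal r)"
        using b xM a(2) by (fastforce simp: not_le)
      then show False using x r(1) by blast
    qed
    then show "x \<in> ?A" using a xM by (auto simp: argmins_def)
  qed
  show "?A \<in> sets M"
    unfolding eq using \<Phi> F
    by (intro sets.Diff sets.countable_UN' m[OF F] m[OF closed_UNIV] countable_rat image_subsetI)
       (auto simp: compact_measurable_def)
qed

text \<open>Successive minimisation of the distances to a dense sequence shrinks each compact fibre
  to exactly one point, since a point is determined by those distances. Uniqueness makes the
  selection measurable: lying in a closed set becomes a countable conjunction of hitting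
  conditions.\<close>

lemma compact_measurable_selection:
  fixes \<Phi> :: "'s \<Rightarrow> 'a::{metric_space, second_countable_topology} set"
  assumes \<Phi>: "compact_measurable M \<Phi>"
  shows "\<exists>\<phi>\<in>borel_measurable M. \<forall>x\<in>space M. \<phi> x \<in> \<Phi> x"
proof -
  obtain D :: "'a set" where D: "countable D" "\<And>U. open U \<Longrightarrow> U \<noteq> {} \<Longrightarrow> \<exists>d\<in>D. d \<in> U"
    using countable_dense_exists by blast
  then have "D \<noteq> {}" using open_UNIV by blast
  define d where "d = from_nat_into D"
  define \<Psi> where "\<Psi> = rec_nat \<Phi> (\<lambda>i \<Psi> x. argmins (\<lambda>a. ennreal (dist a (d i))) (\<Psi> x))"
  have \<Psi>_simps: "\<Psi> 0 = \<Phi>" "\<Psi> (Suc i) = (\<lambda>x. argmins (\<lambda>a. ennreal (dist a (d i))) (\<Psi> i x))" for i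
    by (simp_all add: \<Psi>_def)
  have cm: "compact_measurable M (\<Psi> i)" for i
  proof (induction i)
    case (Suc i)
    have lsc: "lsc A (\<lambda>a. ennreal (dist a (d i)))" for A
      by (intro lsc_continuous continuous_on_ennreal continuous_intros)
    have "closed {a. ennreal (dist a (d i)) \<le> r}" for r
    proof -
      have "open {a. r < ennreal (dist a (d i))}" using lsc[of UNIV] by (simp add: lsc_def)
      moreover have "- {a. r < ennreal (dist a (d i))} = {a. ennreal (dist a (d i)) \<le> r}" by auto
      ultimately show ?thesis by (metis closed_Compl)
    qed
    then have "{x\<in>space M. \<Psi> i x \<inter> (F \<inter> {a. ennreal (dist a (d i)) \<le> r}) \<noteq> {}} \<in> sets M" if "closed F" for F r
      using Suc closed_Int[OF that] by (simp add: compact_measurable_def)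
    moreover have "{x\<in>space M. \<Psi> i x \<inter> (F \<inter> {a. ennreal (dist a (d i)) \<le> r}) \<noteq> {}} =
        {x\<in>space M. \<exists>a\<in>\<Psi> i x \<inter> F. ennreal (dist a (d i)) \<le> r}" for F r by blast
    ultimately show ?case
      unfolding \<Psi>_simps by (intro compact_measurable_argmins Suc lsc) simp
  qed (simp add: \<Phi> \<Psi>_simps)
  have dec: "decseq (\<lambda>i. \<Psi> i x)" for x
    by (intro decseq_SucI) (auto simp: \<Psi>_simps argmins_def)
  \<comment> \<open>Cantor's intersection theorem, with an additional closed set:
    \<open>F = UNIV\<close> yields existence of the selection, and a general \<open>F\<close> its
    measurability.\<close>
  have nested: "(\<Inter>i. \<Psi> i x \<inter> F) \<noteq> {}"
    if x: "x \<in> space M" and F: "closed F" and ne: "\<And>i. \<Psi> i x \<inter> F \<noteq> {}" for x F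
  proof -
    have K: "compact (\<Psi> i x)" for i using cm x by (simp add: compact_measurable_def)
    have "\<Psi> 0 x \<inter> (\<Inter>i\<in>UNIV. \<Psi> i x \<inter> F) \<noteq> {}"
    proof (rule compact_imp_fip_image[OF K])
      show "closed (\<Psi> i x \<inter> F)" for i using compact_imp_closed[OF K] F by (rule closed_Int)
      fix I :: "nat set" assume "finite I"
      then obtain n where "I \<subseteq> {..n}" using finite_nat_iff_bounded_le by blast
      then have "\<Psi> n x \<inter> F \<subseteq> \<Psi> 0 x \<inter> (\<Inter>i\<in>I. \<Psi> i x \<inter> F)"
        using decseqD[OF dec, of _ n x] by blast
      then show "\<Psi> 0 x \<inter> (\<Inter>i\<in>I. \<Psi> i x \<inter> F) \<noteq> {}" using ne[of n] by blast
    qed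
    then show ?thesis by blast
  qed
  define \<phi> where "\<phi> x = (SOME a. a \<in> (\<Inter>i. \<Psi> i x))" for x
  have \<phi>: "\<phi> x \<in> \<Psi> i x" if "x \<in> space M" for x i
  proof -
    have "(\<Inter>i. \<Psi> i x) \<noteq> {}"
      using nested[OF that closed_UNIV] cm that by (simp add: compact_measurable_def)
    then have "\<phi> x \<in> (\<Inter>i. \<Psi> i x)" unfolding \<phi>_def by (metis ex_in_conv someI_ex)
    then show ?thesis by simp
  qed
  \<comment> \<open>Two common points both minimise the distance to every \<open>d i\<close>, so
    they are equidistant from a dense set; a dense point closer to \<open>a\<close> than half their
    distance refutes \<open>a \<noteq> b\<close>.\<close>
  have unique: "a = b" if "\<And>i. a \<in> \<Psi> i x" "\<And>i. b \<in> \<Psi> i x" for a b x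
  proof (rule ccontr)
    assume "a \<noteq> b"
    then obtain e where e: "e \<in> D" "dist e a < dist a b / 2"
      using D(2)[of "ball a (dist a b / 2)"] by (auto simp: dist_commute)
    then obtain i where i: "d i = e"
      unfolding d_def using from_nat_into_surj[OF D(1)] by blast
    have "dist a (d i) = dist b (d i)"
      using that[of "Suc i"] that[of i] by (auto simp: \<Psi>_simps argmins_def intro!: antisym)
    then show False using e(2) i dist_triangle2[of a b e] by (simp add: dist_commute)
  qed
  have "\<phi> \<in> borel_measurable M"
  proof (rule borel_measurableI)
    fix U :: "'a set" assume "open U"
    then have F: "closed (- U)" by auto
    \<comment> \<open>If every stage meets the closed complement, some point of the complement
      belongs to all stages, and by uniqueness that point is \<open>\<phi> x\<close>.\<close>
    have "{x\<in>space M. \<phi> x \<in> - U} = (\<Inter>i. {x\<in>space M. \<Psi> i x \<inter> - U \<noteq> {}})"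
    proof (intro antisym subsetI)
      fix x assume x: "x \<in> (\<Inter>i. {x\<in>space M. \<Psi> i x \<inter> - U \<noteq> {}})"
      then have xM: "x \<in> space M" by auto
      obtain a where "\<And>i. a \<in> \<Psi> i x" "a \<in> - U" using nested[OF xM F] x by auto
      then show "x \<in> {x\<in>space M. \<phi> x \<in> - U}" using unique \<phi>[OF xM] xM by blast
    qed (use \<phi> in auto)
    also have "\<dots> \<in> sets M"
      using cm F by (intro sets.countable_INT) (auto simp: compact_measurable_def)
    finally have "space M - {x\<in>space M. \<phi> x \<in> - U} \<in> sets M" by blast
    moreover have "space M - {x\<in>space M. \<phi> x \<in> - U} = \<phi> -` U \<inter> space M" by auto
    ultimately show "\<phi> -` U \<inter> space M \<in> sets M" by simp
  qed
  then show ?thesis using \<phi>[of _ 0] by (auto simp: \<Psi>_simps)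
qed

section \<open>Minimisation over compact, upper semicontinuous fibres\<close>

locale compact_fibres =
  fixes S :: "'s::topological_space set"
    and A :: "'s \<Rightarrow> 'a::{metric_space, second_countable_topology} set"
  assumes compact: "x \<in> S \<Longrightarrow> compact (A x)"
    and nonempty: "x \<in> S \<Longrightarrow> A x \<noteq> {}"
    and usc: "open U \<Longrightarrow> openin (top_of_set S) {x\<in>S. A x \<subseteq> U}"
begin

text \<open>The points of the graph lying outside \<open>F\<close> or satisfying
  \<open>r < f\<close> form a relatively open set; the condition says that the whole fibre over
  \<open>x\<close> is contained in it.\<close>

lemma openin_fibres_greater:
  assumes f: "lsc (Sigma S A) f" and F: "closed F"
  shows "openin (top_of_set S) {x\<in>S. \<forall>a\<in>A x \<inter> F. r < f (x, a)}"
proof -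
  let ?W = "Sigma S A \<inter> (UNIV \<times> - F) \<union> {z\<in>Sigma S A. r < f z}"
  have "openin (top_of_set (Sigma S A)) ?W"
    using f F by (intro openin_Un openin_open_Int open_Times) (auto simp: lsc_def)
  from openin_fibre_subset[OF compact usc this]
  have "openin (top_of_set S) {x\<in>S. {x} \<times> A x \<subseteq> ?W}" .
  moreover have "{x\<in>S. {x} \<times> A x \<subseteq> ?W} = {x\<in>S. \<forall>a\<in>A x \<inter> F. r < f (x, a)}" by auto
  ultimately show ?thesis by simp
qed

lemma lsc_fibre: "lsc (Sigma S A) f \<Longrightarrow> x \<in> S \<Longrightarrow> lsc (A x) (\<lambda>a. f (x, a))"
  by (rule lsc_compose[of "Sigma S A"]) (auto intro!: continuous_intros)

lemma INF_attained:
  assumes "lsc (Sigma S A) f" "x \<in> S"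
  shows "\<exists>a\<in>A x. f (x, a) = (INF a\<in>A x. f (x, a))"
  using lsc_attains_inf[OF compact nonempty lsc_fibre[OF assms]] assms(2)
  by (metis (no_types, lifting) INF_greatest INF_lower antisym)

text \<open>This is the semicontinuous half of Berge's maximum theorem. As the infimum is attained,
  it exceeds \<open>r\<close> exactly when \<open>f\<close> exceeds \<open>r\<close> on the whole
  fibre.\<close>

lemma lsc_INF:
  assumes f: "lsc (Sigma S A) f"
  shows "lsc S (\<lambda>x. INF a\<in>A x. f (x, a))"
  unfolding lsc_def
proof
  fix r
  have "r < (INF a\<in>A x. f (x, a)) \<longleftrightarrow> (\<forall>a\<in>A x \<inter> UNIV. r < f (x, a))" if "x \<in> S" for x
    using INF_attained[OF f that] by (metis INF_lower Int_UNIV_right less_le_trans)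
  then have "{x\<in>S. r < (INF a\<in>A x. f (x, a))} = {x\<in>S. \<forall>a\<in>A x \<inter> UNIV. r < f (x, a)}" by blast
  then show "openin (top_of_set S) {x\<in>S. r < (INF a\<in>A x. f (x, a))}"
    using openin_fibres_greater[OF f closed_UNIV] by simp
qed

lemma measurable_argmin:
  assumes f: "lsc (Sigma S A) f"
  shows "\<exists>\<phi>\<in>borel_measurable (restrict_space borel S). \<forall>x\<in>S. \<phi> x \<in> A x \<and> f (x, \<phi> x) = (INF a\<in>A x. f (x, a))"
proof -
  let ?M = "restrict_space borel S"
  have sp: "space ?M = S" by (simp add: space_restrict_space)
  have op: "U \<in> sets ?M" if "openin (top_of_set S) U" for U
    using that by (auto simp: openin_open sets_restrict_space)
  have cl: "{x\<in>S. \<exists>a\<in>A x \<inter> F. f (x, a) \<le> r} \<in> sets ?M"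
    if f: "lsc (Sigma S A) f" and F: "closed F" for f r F
  proof -
    have "space ?M - {x\<in>S. \<forall>a\<in>A x \<inter> F. r < f (x, a)} \<in> sets ?M"
      using op[OF openin_fibres_greater[OF f F]] by blast
    moreover have "space ?M - {x\<in>S. \<forall>a\<in>A x \<inter> F. r < f (x, a)} = {x\<in>S. \<exists>a\<in>A x \<inter> F. f (x, a) \<le> r}"
      by (auto simp: sp) (auto simp: not_less[symmetric])
    ultimately show ?thesis by simp
  qed
  have "compact_measurable ?M A"
  proof -
    have "{x\<in>S. A x \<inter> F \<noteq> {}} \<in> sets ?M" if "closed F" for F
    proof -
      \<comment> \<open>Hitting sets of the fibres themselves are sublevel conditions for the zero
        function.\<close>
      have "{x\<in>S. A x \<inter> F \<noteq> {}} = {x\<in>S. \<exists>a\<in>A x \<inter> F. (0::ennreal) \<le> 0}" by auto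
      then show ?thesis using cl[of "\<lambda>_. 0" F 0] that by (simp add: lsc_continuous)
    qed
    then show ?thesis using compact nonempty by (simp add: compact_measurable_def sp)
  qed
  then have "compact_measurable ?M (\<lambda>x. argmins (\<lambda>a. f (x, a)) (A x))"
    using cl[OF f] lsc_fibre[OF f] by (intro compact_measurable_argmins) (auto simp: sp)
  from compact_measurable_selection[OF this] obtain \<phi> where
    \<phi>: "\<phi> \<in> borel_measurable ?M" "\<And>x. x \<in> S \<Longrightarrow> \<phi> x \<in> argmins (\<lambda>a. f (x, a)) (A x)"
    by (auto simp: sp)
  have "f (x, \<phi> x) = (INF a\<in>A x. f (x, a))" if "x \<in> S" for x
    using \<phi>(2)[OF that] by (intro antisym INF_greatest INF_lower) (auto simp: argmins_def)
  then show ?thesis using \<phi> by (auto simp: argmins_def)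
qed

end

section \<open>Total costs of policies\<close>

locale stochastic_mdp =
  fixes D :: "('s::polish_space, 'a::polish_space) mdp"
  assumes model: "mdp_model D"
    and prob_kernel: "transition_prob_kernel (gr D) (states D) (kern D)"
begin

lemma space_gr_space [simp]: "space (gr_space D) = gr D"
  by (simp add: gr_space_def space_restrict_space)

lemma space_state_space [simp]: "space (state_space D) = states D"
  by (simp add: state_space_def space_restrict_space)

lemma measurable_kern [measurable]: "kern D \<in> measurable (gr_space D) (prob_algebra (state_space D))"
  using prob_kernel unfolding transition_prob_kernel_def transition_kernel_def
  by (intro measurable_prob_algebraI measurable_subprob_algebra)
     (auto simp: gr_space_def state_space_def space_restrict_space intro: prob_space_imp_subprob_space)

lemma measurable_cost [measurable]: "cost D \<in> borel_measurable (gr_space D)"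
  using model by (simp add: mdp_model_def)

lemma cost_nonneg: "z \<in> gr D \<Longrightarrow> 0 \<le> cost D z"
  using model by (simp add: mdp_model_def)

lemma measurable_one_step_value [measurable]:
  assumes [measurable]: "u \<in> borel_measurable (state_space D)"
  shows "one_step_value \<beta> D u \<in> borel_measurable (gr_space D)"
  unfolding one_step_value_def
  using measurable_compose[OF measurable_prob_algebraD[OF measurable_kern] nn_integral_measurable_subprob_algebra[OF assms]]
  by measurable

lemma measurable_Pair_avail:
  assumes "x \<in> states D" "sets M = sets (action_space D)"
  shows "Pair x \<in> measurable (restrict_space M (avail D x)) (gr_space D)"
proof -
  have "Pair x \<in> borel_measurable (action_space D)"
    unfolding action_space_def by (intro measurable_restrict_space1) (simp add: borel_prod[symmetric])
  then have "Pair x \<in> borel_measurable M"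
    by (simp cong: measurable_cong_sets add: assms(2))
  then show ?thesis
    unfolding gr_space_def using assms(1)
    by (intro measurable_restrict_space2 measurable_restrict_space1)
       (auto simp: gr_def space_restrict_space)
qed

lemma one_step_value_mono:
  assumes "\<And>y. y \<in> states D \<Longrightarrow> u y \<le> v y" "z \<in> gr D"
  shows "one_step_value \<beta> D u z \<le> one_step_value \<beta> D v z"
  unfolding one_step_value_def using assms sets_kern(2)[OF model assms(2)]
  by (intro add_left_mono mult_left_mono nn_integral_mono) auto

lemma one_step_value_SUP:
  assumes z: "z \<in> gr D" and u: "\<And>n. u n \<in> borel_measurable (state_space D)"
    and mono: "\<And>n y. y \<in> states D \<Longrightarrow> u n y \<le> u (Suc n) y"
    and v: "\<And>y. y \<in> states D \<Longrightarrow> v y = (SUP n. u n y)"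
  shows "one_step_value \<beta> D v z = (SUP n. one_step_value \<beta> D (u n) z)"
proof -
  note q = sets_kern[OF model z]
  have "(\<integral>\<^sup>+y. v y \<partial>kern D z) = (\<integral>\<^sup>+y. (SUP n. u n y) \<partial>kern D z)"
    by (intro nn_integral_cong) (simp add: v q)
  also have "\<dots> = (SUP n. \<integral>\<^sup>+y. u n y \<partial>kern D z)"
    using u q mono by (intro nn_integral_monotone_convergence_SUP_AE) (auto cong: measurable_cong_sets)
  finally show ?thesis
    unfolding one_step_value_def by (simp add: SUP_mult_left_ennreal ennreal_SUP_add_right)
qed

section \<open>Conditional laws and integrals along histories\<close>

abbreviation hists :: "nat \<Rightarrow> (nat \<Rightarrow> 's \<times> 'a) measure" where
  "hists n \<equiv> PiM {0..<n} (\<lambda>_. gr_space D)"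

text \<open>The first stage of \<open>step_law\<close>, before the action is drawn. Separating it
  allows statements about a state to be integrated without reference to the policy.\<close>

definition state_law :: "'s \<Rightarrow> nat \<Rightarrow> (nat \<Rightarrow> 's \<times> 'a) \<Rightarrow> 's measure" where
  "state_law x n h = (if n = 0 then return (state_space D) x else kern D (h (n - 1)))"

lemma hists_gr: "h \<in> space (hists n) \<Longrightarrow> i < n \<Longrightarrow> h i \<in> gr D"
  by (auto simp: space_PiM PiE_iff)

lemma sets_state_law [measurable_cong]:
  "h \<in> space (hists n) \<Longrightarrow> sets (state_law x n h) = sets (state_space D)"
  using sets_kern[OF model hists_gr[of h n "n - 1"]] by (auto simp: state_law_def)

lemma space_state_law: "h \<in> space (hists n) \<Longrightarrow> space (state_law x n h) = states D"
  using sets_eq_imp_space_eq[OF sets_state_law] by simp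

lemma measurable_state_law:
  assumes "x \<in> states D"
  shows "state_law x n \<in> measurable (hists n) (subprob_algebra (state_space D))"
proof (cases "n = 0")
  case True
  then show ?thesis using assms unfolding state_law_def
    by (auto intro!: measurable_const prob_space_imp_subprob_space prob_space_return simp: space_subprob_algebra)
next
  case False
  then have "(\<lambda>h. h (n - 1)) \<in> measurable (hists n) (gr_space D)"
    by (intro measurable_component_singleton) auto
  from measurable_compose[OF this measurable_prob_algebraD[OF measurable_kern]]
  show ?thesis using False by (simp add: state_law_def[abs_def])
qed

context
  fixes \<pi> :: "('s, 'a) policy"
  assumes policy: "is_policy D \<pi>"
begin

lemma policy_kernel:
  assumes "h \<in> space (hists n)" "y \<in> states D"
  shows "sets (\<pi> n (h, y)) = sets (action_space D)" "emeasure (\<pi> n (h, y)) (avail D y) = 1"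
    "avail D y \<inter> space (\<pi> n (h, y)) \<in> sets (\<pi> n (h, y))"
proof -
  have h: "(h, y) \<in> space (hist_space D n)"
    using assms by (simp add: hist_space_def space_pair_measure)
  then show s: "sets (\<pi> n (h, y)) = sets (action_space D)"
    using policy measurable_space[of "\<pi> n" "hist_space D n" "prob_algebra (action_space D)"]
    by (auto simp: is_policy_def space_prob_algebra)
  show "emeasure (\<pi> n (h, y)) (avail D y) = 1"
    using policy h unfolding is_policy_def by (metis snd_conv)
  have "avail D y \<in> sets (action_space D)"
    using model assms(2) by (auto simp: mdp_model_def action_space_def sets_restrict_space_iff)
  then show "avail D y \<inter> space (\<pi> n (h, y)) \<in> sets (\<pi> n (h, y))" by (auto simp: s)
qed

lemma nn_integral_step_law:
  assumes h: "h \<in> space (hists n)" and g: "g \<in> borel_measurable (gr_space D)"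
  shows "(\<integral>\<^sup>+z. g z \<partial>step_law D \<pi> x n h) =
    (\<integral>\<^sup>+y. (\<integral>\<^sup>+a\<in>avail D y. g (y, a) \<partial>\<pi> n (h, y)) \<partial>state_law x n h)"
proof -
  let ?k = "\<lambda>y. distr (restrict_space (\<pi> n (h, y)) (avail D y)) (gr_space D) (Pair y)"
  have "(\<lambda>y. (h, y)) \<in> measurable (state_space D) (hist_space D n)"
    using h by (simp add: hist_space_def)
  from measurable_compose[OF this measurable_prob_algebraD[OF measurable_choice[OF model policy]]]
  have "?k \<in> measurable (state_space D) (subprob_algebra (gr_space D))" by simp
  then have "?k \<in> measurable (state_law x n h) (subprob_algebra (gr_space D))"
    by (simp cong: measurable_cong_sets add: sets_state_law[OF h])
  from nn_integral_bind[OF g this]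
  have "(\<integral>\<^sup>+z. g z \<partial>step_law D \<pi> x n h) = (\<integral>\<^sup>+y. (\<integral>\<^sup>+z. g z \<partial>?k y) \<partial>state_law x n h)"
    unfolding step_law_def state_law_def .
  also have "\<dots> = (\<integral>\<^sup>+y. (\<integral>\<^sup>+a\<in>avail D y. g (y, a) \<partial>\<pi> n (h, y)) \<partial>state_law x n h)"
  proof (rule nn_integral_cong)
    fix y assume "y \<in> space (state_law x n h)"
    then have y: "y \<in> states D" by (simp add: space_state_law[OF h])
    show "(\<integral>\<^sup>+z. g z \<partial>?k y) = (\<integral>\<^sup>+a\<in>avail D y. g (y, a) \<partial>\<pi> n (h, y))"
      using policy_kernel[OF h y] g
      by (simp add: nn_integral_distr measurable_Pair_avail[OF y] nn_integral_restrict_space)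
  qed
  finally show ?thesis .
qed

text \<open>The action law gives mass 1 to the available actions, so averaging a function that is at
  least \<open>w y\<close> at each of them yields at least \<open>w y\<close>.\<close>

lemma nn_integral_step_law_ge:
  assumes h: "h \<in> space (hists n)" and g: "g \<in> borel_measurable (gr_space D)"
    and le: "\<And>y a. y \<in> states D \<Longrightarrow> a \<in> avail D y \<Longrightarrow> w y \<le> g (y, a)"
  shows "(\<integral>\<^sup>+y. w y \<partial>state_law x n h) \<le> (\<integral>\<^sup>+z. g z \<partial>step_law D \<pi> x n h)"
  unfolding nn_integral_step_law[OF h g]
proof (rule nn_integral_mono)
  fix y assume "y \<in> space (state_law x n h)"
  then have y: "y \<in> states D" by (simp add: space_state_law[OF h])
  have "w y = w y * emeasure (\<pi> n (h, y)) (avail D y)"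
    using policy_kernel[OF h y] by simp
  also have "\<dots> = (\<integral>\<^sup>+a\<in>avail D y. w y \<partial>\<pi> n (h, y))"
    using policy_kernel[OF h y] model y
    by (subst nn_integral_cmult_indicator)
       (auto simp: mdp_model_def action_space_def sets_restrict_space_iff)
  also have "\<dots> \<le> (\<integral>\<^sup>+a\<in>avail D y. g (y, a) \<partial>\<pi> n (h, y))"
    using le[OF y] by (intro nn_integral_mono) (auto split: split_indicator)
  finally show "w y \<le> (\<integral>\<^sup>+a\<in>avail D y. g (y, a) \<partial>\<pi> n (h, y))" .
qed

context
  fixes x :: 's
  assumes x: "x \<in> states D"
begin

interpretation IT: Ionescu_Tulcea "step_law D \<pi> x" "\<lambda>_. gr_space D"
  by (rule Ionescu_Tulcea_step_law[OF model prob_kernel policy x])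

text \<open>The law of the first \<open>n\<close> state-action pairs. The start
  \<open>\<lambda>_. undefined\<close> is the empty history, the only element of a product over the
  empty index set.\<close>

definition hist_law :: "nat \<Rightarrow> (nat \<Rightarrow> 's \<times> 'a) measure" where
  "hist_law n = IT.C 0 n (\<lambda>_. undefined)"

lemma undefined_in_hists_0: "(\<lambda>_. undefined) \<in> space (hists 0)"
  by (simp add: space_PiM)

lemma sets_hist_law [measurable_cong]: "sets (hist_law n) = sets (hists n)"
  using IT.sets_C[OF undefined_in_hists_0, of n] by (simp add: hist_law_def)

lemma space_hist_law: "space (hist_law n) = space (hists n)"
  by (rule sets_eq_imp_space_eq[OF sets_hist_law])

lemma nn_integral_hist_law_0:
  "f \<in> borel_measurable (hists 0) \<Longrightarrow> (\<integral>\<^sup>+h. f h \<partial>hist_law 0) = f (\<lambda>_. undefined)"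
  using undefined_in_hists_0 by (simp add: hist_law_def nn_integral_return)

lemma nn_integral_hist_law_Suc:
  assumes f: "f \<in> borel_measurable (hists (Suc n))"
  shows "(\<integral>\<^sup>+h. f h \<partial>hist_law (Suc n)) = (\<integral>\<^sup>+h. (\<integral>\<^sup>+z. f (h(n := z)) \<partial>step_law D \<pi> x n h) \<partial>hist_law n)"
proof -
  have "IT.eP n \<in> measurable (hist_law n) (subprob_algebra (hists (Suc n)))"
    using IT.measurable_eP[of n] by (simp cong: measurable_cong_sets add: sets_hist_law)
  from nn_integral_bind[OF f this]
  have "(\<integral>\<^sup>+h. f h \<partial>hist_law (Suc n)) = (\<integral>\<^sup>+h. (\<integral>\<^sup>+h. f h \<partial>IT.eP n h) \<partial>hist_law n)"
    by (simp add: hist_law_def)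
  also have "\<dots> = (\<integral>\<^sup>+h. (\<integral>\<^sup>+z. f (h(n := z)) \<partial>step_law D \<pi> x n h) \<partial>hist_law n)"
    using f by (intro nn_integral_cong IT.nn_integral_eP) (auto simp: space_hist_law)
  finally show ?thesis .
qed

definition partial_cost :: "real \<Rightarrow> nat \<Rightarrow> (nat \<Rightarrow> 's \<times> 'a) \<Rightarrow> ennreal" where
  "partial_cost \<beta> n h = (\<Sum>k<n. ennreal (\<beta> ^ k * cost D (h k)))"

lemma measurable_partial_cost:
  assumes "{0..<n} \<subseteq> I"
  shows "partial_cost \<beta> n \<in> borel_measurable (PiM I (\<lambda>_. gr_space D))"
proof -
  have "(\<lambda>h. cost D (h k)) \<in> borel_measurable (PiM I (\<lambda>_. gr_space D))" if "k < n" for k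
    using assms that by (intro measurable_compose[OF measurable_component_singleton[of k I "\<lambda>_. gr_space D"] measurable_cost]) auto
  then show ?thesis
    unfolding partial_cost_def[abs_def] by (intro borel_measurable_sum) auto
qed

text \<open>Nonnegative costs allow monotone convergence in the horizon. Each truncated cost depends
  on finitely many coordinates only, so the limit measure can be replaced by its projection to
  them.\<close>

lemma total_cost_eq_SUP:
  "total_cost \<beta> D \<pi> x = (SUP n. \<integral>\<^sup>+h. partial_cost \<beta> n h \<partial>hist_law n)"
proof -
  have sets: "sets IT.PF.lim = sets (PiM UNIV (\<lambda>_. gr_space D))" by simp
  have m: "partial_cost \<beta> n \<in> borel_measurable IT.PF.lim" for n
    using measurable_partial_cost[of n UNIV \<beta>] by (simp cong: measurable_cong_sets)
  have "(\<Sum>n. ennreal (\<beta> ^ n * cost D (\<omega> n))) = (SUP n. partial_cost \<beta> n \<omega>)" for \<omega>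
    unfolding partial_cost_def by (rule suminf_eq_SUP)
  then have "total_cost \<beta> D \<pi> x = (\<integral>\<^sup>+\<omega>. (SUP n. partial_cost \<beta> n \<omega>) \<partial>IT.PF.lim)"
    by (simp add: total_cost_def traj_law_def)
  also have "\<dots> = (SUP n. \<integral>\<^sup>+\<omega>. partial_cost \<beta> n \<omega> \<partial>IT.PF.lim)"
    by (intro nn_integral_monotone_convergence_SUP m) (auto simp: incseq_Suc_iff le_fun_def partial_cost_def)
  finally have "total_cost \<beta> D \<pi> x = (SUP n. \<integral>\<^sup>+\<omega>. partial_cost \<beta> n \<omega> \<partial>IT.PF.lim)" .
  moreover have "(\<integral>\<^sup>+\<omega>. partial_cost \<beta> n \<omega> \<partial>IT.PF.lim) = (\<integral>\<^sup>+h. partial_cost \<beta> n h \<partial>hist_law n)" for n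
  proof -
    have restr: "partial_cost \<beta> n (restrict \<omega> {0..<n}) = partial_cost \<beta> n \<omega>" for \<omega>
      by (simp add: partial_cost_def)
    \<comment> \<open>The finite-dimensional law \<open>IT.CI\<close> is built from the process run
      up to \<open>IT.up_to\<close>. For an initial segment that horizon is its length, so the
      remaining restriction leaves the cost unchanged.\<close>
    have up: "IT.up_to {0..<n} = n"
      using IT.up_to[of "{0..<n}"] by (intro antisym) (auto simp: IT.up_to_iff_Ico)
    have mr: "(\<lambda>\<omega>. restrict \<omega> {0..<n}) \<in> measurable (PiM I (\<lambda>_. gr_space D)) (hists n)"
      if "{0..<n} \<subseteq> I" for I by (rule measurable_restrict_subset[OF that])
    have "(\<integral>\<^sup>+\<omega>. partial_cost \<beta> n \<omega> \<partial>IT.PF.lim) =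
        (\<integral>\<^sup>+h. partial_cost \<beta> n h \<partial>distr IT.PF.lim (hists n) (\<lambda>\<omega>. restrict \<omega> {0..<n}))"
      using mr[of UNIV] measurable_partial_cost[of n "{0..<n}" \<beta>]
      by (subst nn_integral_distr) (auto simp: restr cong: measurable_cong_sets)
    also have "\<dots> = (\<integral>\<^sup>+h. partial_cost \<beta> n h \<partial>IT.CI {0..<n})"
      by (subst IT.distr_lim) auto
    also have "\<dots> = (\<integral>\<^sup>+h. partial_cost \<beta> n h \<partial>hist_law n)"
      unfolding IT.CI_def up hist_law_def[symmetric]
      using mr[of "{0..<n}"] measurable_partial_cost[of n "{0..<n}" \<beta>]
      by (subst nn_integral_distr) (auto simp: restr cong: measurable_cong_sets)
    finally show ?thesis .
  qed
  ultimately show ?thesis by simp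
qed

text \<open>Here \<open>u j\<close> stands for a value with \<open>j\<close> steps to go. The
  relation \<open>R\<close> is kept abstract so that one argument yields both the lower bound for
  arbitrary policies and the exact cost of a stationary policy.\<close>

lemma backward_induction:
  assumes R: "R = (\<le>) \<or> R = ((=) :: ennreal \<Rightarrow> ennreal \<Rightarrow> bool)" and \<beta>: "0 \<le> \<beta>"
    and u: "\<And>j. u j \<in> borel_measurable (state_space D)" "u 0 = (\<lambda>_. 0)"
    and step: "\<And>j n h. h \<in> space (hists n) \<Longrightarrow> R (\<integral>\<^sup>+y. u (Suc j) y \<partial>state_law x n h)
        (\<integral>\<^sup>+z. one_step_value \<beta> D (u j) z \<partial>step_law D \<pi> x n h)"
  shows "R (u n x) (\<integral>\<^sup>+h. partial_cost \<beta> n h \<partial>hist_law n)"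
proof -
  have R_trans: "R a c" if "R a b" "R b c" for a b c
    using R that by auto
  have R_int: "R (\<integral>\<^sup>+h. f h \<partial>M) (\<integral>\<^sup>+h. g h \<partial>M)" if "\<And>h. h \<in> space M \<Longrightarrow> R (f h) (g h)"
    for f g and M :: "(nat \<Rightarrow> 's \<times> 'a) measure"
    using R that by (elim disjE) (auto intro!: nn_integral_mono nn_integral_cong)
  have R_affine: "R (s + b * p) (s + b * q)" if "R p q" for s b p q
    using R that by (elim disjE) (auto intro!: add_left_mono mult_left_mono)
  \<comment> \<open>Cost already incurred before time \<open>m\<close>, plus the discounted
    expectation of the value of the remaining \<open>n - m\<close> steps. At \<open>m = 0\<close>
    its integral is \<open>u n x\<close>; at \<open>m = n\<close> the second term vanishes because
    \<open>u 0 = 0\<close>.\<close>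
  define F where "F m h = partial_cost \<beta> m h + ennreal (\<beta> ^ m) * (\<integral>\<^sup>+y. u (n - m) y \<partial>state_law x m h)" for m h
  have F[measurable]: "F m \<in> borel_measurable (hists m)" for m
    unfolding F_def
    using measurable_partial_cost[of m "{0..<m}" \<beta>]
      measurable_compose[OF measurable_state_law[OF x] nn_integral_measurable_subprob_algebra[OF u(1)]]
    by (intro borel_measurable_add borel_measurable_times borel_measurable_const) auto
  have "R (u n x) (\<integral>\<^sup>+h. F m h \<partial>hist_law m)" if "m \<le> n" for m
    using that
  proof (induction m)
    case 0
    have "(\<integral>\<^sup>+h. F 0 h \<partial>hist_law 0) = u n x"
      unfolding nn_integral_hist_law_0[OF F]
      using x u(1) by (simp add: F_def partial_cost_def state_law_def nn_integral_return)
    then show ?case using R by auto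
  next
    case (Suc m)
    have "R (F m h) (\<integral>\<^sup>+z. F (Suc m) (h(m := z)) \<partial>step_law D \<pi> x m h)" if h: "h \<in> space (hists m)" for h
    proof -
      have sets: "sets (step_law D \<pi> x m h) = sets (gr_space D)"
        and prob: "prob_space (step_law D \<pi> x m h)"
        using IT.sets_P[of h m] IT.prob_space_P[of h m] h by auto
      have sp: "space (step_law D \<pi> x m h) = gr D"
        using sets_eq_imp_space_eq[OF sets] by simp
      have [measurable]: "one_step_value \<beta> D (u (n - Suc m)) \<in> borel_measurable (step_law D \<pi> x m h)"
        using measurable_one_step_value[OF u(1)] by (simp cong: measurable_cong_sets add: sets)
      \<comment> \<open>The cost at time \<open>m\<close> and the next expected value, each carrying
        the factor \<open>\<beta> ^ m\<close>, combine into a one-step value at the new pair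
        \<open>z\<close>.\<close>
      have "F (Suc m) (h(m := z)) = partial_cost \<beta> m h + ennreal (\<beta> ^ m) * one_step_value \<beta> D (u (n - Suc m)) z"
        if "z \<in> gr D" for z
      proof -
        have "partial_cost \<beta> m (h(m := z)) = partial_cost \<beta> m h"
          by (simp add: partial_cost_def)
        then show ?thesis
          using \<beta> cost_nonneg[OF that]
          by (simp add: F_def one_step_value_def state_law_def partial_cost_def ennreal_mult
              distrib_left mult.assoc add.assoc mult.commute[of \<beta>])
      qed
      then have "(\<integral>\<^sup>+z. F (Suc m) (h(m := z)) \<partial>step_law D \<pi> x m h) =
          (\<integral>\<^sup>+z. partial_cost \<beta> m h + ennreal (\<beta> ^ m) * one_step_value \<beta> D (u (n - Suc m)) z \<partial>step_law D \<pi> x m h)"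
        by (intro nn_integral_cong) (simp add: sp)
      also have "\<dots> = partial_cost \<beta> m h + ennreal (\<beta> ^ m) *
          (\<integral>\<^sup>+z. one_step_value \<beta> D (u (n - Suc m)) z \<partial>step_law D \<pi> x m h)"
        by (simp add: nn_integral_add nn_integral_cmult prob_space.emeasure_space_1[OF prob])
      finally show ?thesis
        unfolding F_def[of m] using R_affine[OF step[OF h, of "n - Suc m"]] Suc.prems
        by (simp add: Suc_diff_Suc)
    qed
    then have "R (\<integral>\<^sup>+h. F m h \<partial>hist_law m) (\<integral>\<^sup>+h. F (Suc m) h \<partial>hist_law (Suc m))"
      unfolding nn_integral_hist_law_Suc[OF F] by (intro R_int) (simp add: space_hist_law)
    then show ?case using Suc R_trans by auto
  qed
  from this[of n] show ?thesis by (simp add: F_def[abs_def] u(2))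
qed

text \<open>The inequality of \<open>step\<close> holds at every available action, hence also after
  averaging over any randomised, history-dependent choice. The finite-horizon bound passes to the
  total cost by nonnegativity.\<close>

lemma total_cost_ge:
  assumes \<beta>: "0 \<le> \<beta>"
    and u: "\<And>j. u j \<in> borel_measurable (state_space D)" "u 0 = (\<lambda>_. 0)"
    and step: "\<And>j y a. y \<in> states D \<Longrightarrow> a \<in> avail D y \<Longrightarrow> u (Suc j) y \<le> one_step_value \<beta> D (u j) (y, a)"
  shows "u n x \<le> total_cost \<beta> D \<pi> x"
proof -
  have "u n x \<le> (\<integral>\<^sup>+h. partial_cost \<beta> n h \<partial>hist_law n)"
    by (rule backward_induction[where R = "(\<le>)" and u = u, OF _ \<beta> u]) (auto intro!: nn_integral_step_law_ge measurable_one_step_value u step)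
  then show ?thesis unfolding total_cost_eq_SUP by (rule SUP_upper2[OF UNIV_I])
qed

end

end

section \<open>Stationary policies as iterated one-policy operators\<close>

definition policy_op :: "real \<Rightarrow> ('s \<Rightarrow> 'a) \<Rightarrow> ('s \<Rightarrow> ennreal) \<Rightarrow> 's \<Rightarrow> ennreal" where
  "policy_op \<beta> \<phi> u y = one_step_value \<beta> D u (y, \<phi> y)"

lemma stationaryD:
  assumes "\<phi> \<in> stationary D"
  shows "y \<in> states D \<Longrightarrow> \<phi> y \<in> avail D y" "(\<lambda>y. (y, \<phi> y)) \<in> measurable (state_space D) (gr_space D)"
proof -
  show av: "y \<in> states D \<Longrightarrow> \<phi> y \<in> avail D y" for y using assms by (simp add: stationary_def)
  have "\<phi> \<in> borel_measurable (state_space D)"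
    using assms by (simp add: stationary_def action_space_def measurable_restrict_space2_iff)
  moreover have "(\<lambda>y. y) \<in> borel_measurable (state_space D)"
    unfolding state_space_def by (rule measurable_restrict_space1) simp
  ultimately have "(\<lambda>y. (y, \<phi> y)) \<in> borel_measurable (state_space D)" by (intro borel_measurable_Pair)
  then show "(\<lambda>y. (y, \<phi> y)) \<in> measurable (state_space D) (gr_space D)"
    unfolding gr_space_def using av by (intro measurable_restrict_space2) (auto simp: gr_def)
qed

lemma measurable_policy_op:
  assumes "\<phi> \<in> stationary D" "u \<in> borel_measurable (state_space D)"
  shows "policy_op \<beta> \<phi> u \<in> borel_measurable (state_space D)"
  unfolding policy_op_def[abs_def]
  by (rule measurable_compose[OF stationaryD(2)[OF assms(1)] measurable_one_step_value[OF assms(2)]])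

lemma nn_integral_step_law_stationary:
  assumes \<phi>: "\<phi> \<in> stationary D" and h: "h \<in> space (hists n)" and g: "g \<in> borel_measurable (gr_space D)"
  shows "(\<integral>\<^sup>+z. g z \<partial>step_law D (stationary_policy D \<phi>) x n h) = (\<integral>\<^sup>+y. g (y, \<phi> y) \<partial>state_law x n h)"
  unfolding nn_integral_step_law[OF is_policy_stationary_policy[OF model \<phi>] h g]
proof (rule nn_integral_cong)
  fix y assume "y \<in> space (state_law x n h)"
  then have y: "y \<in> states D" by (simp add: space_state_law[OF h])
  have av: "avail D y \<inter> space (action_space D) \<in> sets (action_space D)" "\<phi> y \<in> space (action_space D)"
    using model y stationaryD(1)[OF \<phi> y]
    by (auto simp: mdp_model_def action_space_def sets_restrict_space_iff space_restrict_space)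
  have "(\<lambda>a. g (y, a)) \<in> borel_measurable (restrict_space (action_space D) (avail D y))"
    by (rule measurable_compose[OF measurable_Pair_avail[OF y refl] g])
  \<comment> \<open>Measurability of \<open>g\<close> is known on the graph only; the indicator
    extends the integrand by zero to all actions, where the Dirac measure lives.\<close>
  then have "(\<lambda>a. g (y, a) * indicator (avail D y) a) \<in> borel_measurable (action_space D)"
    by (subst (asm) borel_measurable_restrict_space_iff_ennreal[OF av(1)])
  then show "(\<integral>\<^sup>+a\<in>avail D y. g (y, a) \<partial>stationary_policy D \<phi> n (h, y)) = g (y, \<phi> y)"
    using av(2) stationaryD(1)[OF \<phi> y] by (simp add: stationary_policy_def nn_integral_return)
qed

lemma total_cost_stationary:
  assumes \<phi>: "\<phi> \<in> stationary D" and x: "x \<in> states D" and \<beta>: "0 \<le> \<beta>"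
  shows "total_cost \<beta> D (stationary_policy D \<phi>) x = (SUP n. (policy_op \<beta> \<phi> ^^ n) (\<lambda>_. 0) x)"
proof -
  note \<pi> = is_policy_stationary_policy[OF model \<phi>]
  have m: "(policy_op \<beta> \<phi> ^^ n) (\<lambda>_. 0) \<in> borel_measurable (state_space D)" for n
    by (induction n) (auto intro: measurable_policy_op[OF \<phi>])
  have "(policy_op \<beta> \<phi> ^^ n) (\<lambda>_. 0) x = (\<integral>\<^sup>+h. partial_cost \<beta> n h \<partial>hist_law (stationary_policy D \<phi>) x n)" for n
  proof (rule backward_induction[where R = "(=)", OF \<pi> x _ \<beta> m])
    fix j n h assume "h \<in> space (hists n)"
    then show "(\<integral>\<^sup>+y. (policy_op \<beta> \<phi> ^^ Suc j) (\<lambda>_. 0) y \<partial>state_law x n h) =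
        (\<integral>\<^sup>+z. one_step_value \<beta> D ((policy_op \<beta> \<phi> ^^ j) (\<lambda>_. 0)) z \<partial>step_law D (stationary_policy D \<phi>) x n h)"
      unfolding nn_integral_step_law_stationary[OF \<phi> \<open>h \<in> _\<close> measurable_one_step_value[OF m]]
      by (intro nn_integral_cong) (simp add: policy_op_def)
  qed simp_all
  then show ?thesis by (simp add: total_cost_eq_SUP[OF \<pi> x])
qed

end

section \<open>The discounted optimality equation\<close>

locale continuous_mdp = stochastic_mdp +
  assumes weak: "weakly_continuous (gr D) (states D) (kern D)"
    and avail_compact: "compact_valued (states D) (avail D)"
    and avail_cont: "continuous_set_valued (states D) (actions D) (avail D)"
    and cost_lsc: "lsc (gr D) (\<lambda>z. ennreal (cost D z))"
  fixes \<beta> :: real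
  assumes discount_nonneg: "0 \<le> \<beta>"
begin

sublocale compact_fibres "states D" "avail D"
proof
  fix x assume "x \<in> states D"
  then show "compact (avail D x)" "avail D x \<noteq> {}"
    using avail_compact model by (auto simp: compact_valued_def mdp_model_def)
next
  fix U :: "'b set" assume "open U"
  \<comment> \<open>Continuity of the action sets is stated for sets open in
    \<open>actions D\<close>; as the fibres lie in \<open>actions D\<close>, intersecting with it
    does not change the inclusion.\<close>
  then have "openin (top_of_set (actions D)) (actions D \<inter> U)" by (rule openin_open_Int)
  then have "openin (top_of_set (states D)) {x \<in> states D. avail D x \<subseteq> actions D \<inter> U}"
    using avail_cont by (simp only: continuous_set_valued_def)
  moreover have "{x \<in> states D. avail D x \<subseteq> actions D \<inter> U} = {x \<in> states D. avail D x \<subseteq> U}"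
    using model by (auto simp: mdp_model_def)
  ultimately show "openin (top_of_set (states D)) {x \<in> states D. avail D x \<subseteq> U}"
    by (simp only:)
qed

lemma lsc_one_step_value:
  assumes "lsc (states D) u"
  shows "lsc (Sigma (states D) (avail D)) (one_step_value \<beta> D u)"
proof -
  have "lsc (gr D) (\<lambda>z. \<integral>\<^sup>+y. u y \<partial>kern D z)"
    using prob_kernel weak assms by (intro lsc_nn_integral) (auto simp: transition_prob_kernel_def)
  then show ?thesis
    unfolding one_step_value_def[abs_def] gr_def[symmetric]
    by (intro lsc_add lsc_cmult cost_lsc) auto
qed

section \<open>Value iteration and its limit\<close>

definition bellman :: "('a \<Rightarrow> ennreal) \<Rightarrow> 'a \<Rightarrow> ennreal" where
  "bellman u x = (INF a\<in>avail D x. one_step_value \<beta> D u (x, a))"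

definition iter_value :: "nat \<Rightarrow> 'a \<Rightarrow> ennreal" where
  "iter_value n = (bellman ^^ n) (\<lambda>_. 0)"

definition limit_value :: "'a \<Rightarrow> ennreal" where
  "limit_value x = (SUP n. iter_value n x)"

lemma lsc_iter_value: "lsc (states D) (iter_value n)"
proof (induction n)
  case (Suc n)
  then show ?case
    using lsc_INF[OF lsc_one_step_value[OF Suc]] by (simp add: iter_value_def bellman_def[abs_def])
qed (simp add: iter_value_def lsc_continuous)

lemma measurable_iter_value: "iter_value n \<in> borel_measurable (state_space D)"
  unfolding state_space_def by (rule borel_measurable_lsc[OF lsc_iter_value])

lemma iter_value_Suc: "iter_value (Suc n) = bellman (iter_value n)"
  by (simp add: iter_value_def)

lemma bellman_mono:
  assumes "\<And>y. y \<in> states D \<Longrightarrow> u y \<le> v y" "x \<in> states D"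
  shows "bellman u x \<le> bellman v x"
  unfolding bellman_def using assms
  by (intro INF_superset_mono one_step_value_mono) (auto simp: gr_def)

lemma iter_value_mono_Suc: "x \<in> states D \<Longrightarrow> iter_value n x \<le> iter_value (Suc n) x"
proof (induction n arbitrary: x)
  case (Suc n)
  then show ?case unfolding iter_value_Suc[of n] iter_value_Suc[of "Suc n"] by (intro bellman_mono)
qed (simp add: iter_value_def)

lemma lsc_limit_value: "lsc (states D) limit_value"
  unfolding limit_value_def[abs_def] by (intro lsc_SUP lsc_iter_value)

lemma one_step_value_limit_value:
  assumes z: "z \<in> gr D"
  shows "one_step_value \<beta> D limit_value z = (SUP n. one_step_value \<beta> D (iter_value n) z)"
  using measurable_iter_value iter_value_mono_Suc limit_value_def by (rule one_step_value_SUP[OF z])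

text \<open>Minimisation commutes with the increasing limit: the sets of actions whose one-step value
  with respect to \<open>iter_value n\<close> is at most the limit are nested, nonempty and compact.\<close>

lemma bellman_limit_value:
  assumes x: "x \<in> states D"
  shows "bellman limit_value x = limit_value x"
proof (rule antisym)
  have gr: "(x, a) \<in> gr D" if "a \<in> avail D x" for a using x that by (simp add: gr_def)
  show "limit_value x \<le> bellman limit_value x"
    unfolding limit_value_def[of x]
  proof (rule SUP_least)
    fix n
    have "iter_value n x \<le> bellman (iter_value n) x"
      using iter_value_mono_Suc[OF x] by (simp add: iter_value_Suc)
    also have "\<dots> \<le> bellman limit_value x"
      using x by (intro bellman_mono) (auto simp: limit_value_def intro: SUP_upper)
    finally show "iter_value n x \<le> bellman limit_value x" .
  qed
  let ?g = "\<lambda>n a. one_step_value \<beta> D (iter_value n) (x, a)"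
  let ?K = "\<lambda>n. {a \<in> avail D x. ?g n a \<le> limit_value x}"
  have mono: "?g n a \<le> ?g (Suc n) a" if "a \<in> avail D x" for n a
    by (intro one_step_value_mono iter_value_mono_Suc gr that)
  have K: "closedin (top_of_set (avail D x)) (?K n)" for n
  proof -
    have "openin (top_of_set (avail D x)) {a \<in> avail D x. limit_value x < ?g n a}"
      using lsc_fibre[OF lsc_one_step_value[OF lsc_iter_value] x] by (simp add: lsc_def)
    moreover have "avail D x - {a \<in> avail D x. limit_value x < ?g n a} = ?K n" by auto
    ultimately show ?thesis using closedin_diff[OF closedin_topspace] by fastforce
  qed
  have "avail D x \<inter> (\<Inter>n\<in>UNIV. ?K n) \<noteq> {}"
  proof (rule compact_imp_fip_image[OF compact[OF x]])
    show "closed (?K n)" for n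
      using closedin_compact[OF compact[OF x] K] by (rule compact_imp_closed)
    fix I :: "nat set" assume "finite I"
    then obtain n where n: "I \<subseteq> {..n}" using finite_nat_iff_bounded_le by blast
    \<comment> \<open>A minimiser at an index above all of \<open>I\<close> serves every
      \<open>i \<in> I\<close>, since the one-step values increase with the index and its own value
      is the next iterate.\<close>
    obtain a where a: "a \<in> avail D x" "?g n a = bellman (iter_value n) x"
      using INF_attained[OF lsc_one_step_value[OF lsc_iter_value] x] unfolding bellman_def by blast
    have "?g i a \<le> limit_value x" if "i \<in> I" for i
    proof -
      have "incseq (\<lambda>n. ?g n a)" by (rule incseq_SucI) (rule mono[OF a(1)])
      then have "?g i a \<le> ?g n a" by (rule incseqD) (use n that in auto)
      also have "\<dots> \<le> limit_value x"
        unfolding a(2) iter_value_Suc[symmetric] limit_value_def by (rule SUP_upper) simp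
      finally show ?thesis .
    qed
    then show "avail D x \<inter> (\<Inter>n\<in>I. ?K n) \<noteq> {}" using a(1) by blast
  qed
  then obtain a where a: "a \<in> avail D x" "\<And>n. ?g n a \<le> limit_value x" by blast
  have "bellman limit_value x \<le> one_step_value \<beta> D limit_value (x, a)"
    unfolding bellman_def by (rule INF_lower[OF a(1)])
  also have "\<dots> \<le> limit_value x"
    unfolding one_step_value_limit_value[OF gr[OF a(1)]] by (rule SUP_least[OF a(2)])
  finally show "bellman limit_value x \<le> limit_value x" .
qed

lemma limit_value_le_total_cost:
  assumes "is_policy D \<pi>" "x \<in> states D"
  shows "limit_value x \<le> total_cost \<beta> D \<pi> x"
  unfolding limit_value_def
proof (rule SUP_least)
  fix n
  show "iter_value n x \<le> total_cost \<beta> D \<pi> x"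
    using assms discount_nonneg measurable_iter_value
    by (rule total_cost_ge) (auto simp: iter_value_Suc bellman_def iter_value_def intro: INF_lower)
qed

text \<open>The iterates of the monotone operator start at 0, hence below \<open>v\<close>, and a
  supersolution keeps them there. Nothing about the tail of \<open>v\<close> has to vanish, because
  the tail is simply dropped.\<close>

lemma total_cost_stationary_le:
  assumes \<phi>: "\<phi> \<in> stationary D" and x: "x \<in> states D"
    and v: "\<And>y. y \<in> states D \<Longrightarrow> one_step_value \<beta> D v (y, \<phi> y) \<le> v y"
  shows "total_cost \<beta> D (stationary_policy D \<phi>) x \<le> v x"
proof -
  have "(policy_op \<beta> \<phi> ^^ n) (\<lambda>_. 0) y \<le> v y" if "y \<in> states D" for n y
    using that
  proof (induction n arbitrary: y)
    case (Suc n)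
    have "(policy_op \<beta> \<phi> ^^ Suc n) (\<lambda>_. 0) y =
        one_step_value \<beta> D ((policy_op \<beta> \<phi> ^^ n) (\<lambda>_. 0)) (y, \<phi> y)" by (simp add: policy_op_def)
    also have "\<dots> \<le> one_step_value \<beta> D v (y, \<phi> y)"
      using Suc stationaryD(1)[OF \<phi>] by (intro one_step_value_mono) (simp_all add: gr_def)
    finally have "(policy_op \<beta> \<phi> ^^ Suc n) (\<lambda>_. 0) y \<le> one_step_value \<beta> D v (y, \<phi> y)" .
    then show ?case using v[OF Suc.prems] by (rule order_trans)
  qed simp
  then show ?thesis
    using x by (simp add: total_cost_stationary[OF \<phi> x discount_nonneg] SUP_least)
qed

text \<open>The cost is the supremum of increasing iterates. Monotone convergence moves the supremum
  through the one-step value, which merely shifts the index.\<close>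

lemma total_cost_stationary_fixpoint:
  assumes \<phi>: "\<phi> \<in> stationary D" and x: "x \<in> states D"
  shows "total_cost \<beta> D (stationary_policy D \<phi>) x =
    one_step_value \<beta> D (total_cost \<beta> D (stationary_policy D \<phi>)) (x, \<phi> x)"
proof -
  define u where "u n = (policy_op \<beta> \<phi> ^^ n) (\<lambda>_. 0)" for n
  have u_Suc: "u (Suc n) y = one_step_value \<beta> D (u n) (y, \<phi> y)" for n y
    by (simp add: u_def policy_op_def)
  have gr: "(y, \<phi> y) \<in> gr D" if "y \<in> states D" for y
    using that stationaryD(1)[OF \<phi>] by (simp add: gr_def)
  have mono: "u n y \<le> u (Suc n) y" if "y \<in> states D" for n y
    using that
  proof (induction n arbitrary: y)
    case (Suc n)
    then show ?case unfolding u_Suc[of n] u_Suc[of "Suc n"] by (intro one_step_value_mono gr)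
  qed (simp add: u_def)
  have m: "u n \<in> borel_measurable (state_space D)" for n
    unfolding u_def by (induction n) (auto intro: measurable_policy_op[OF \<phi>])
  have tc: "total_cost \<beta> D (stationary_policy D \<phi>) y = (SUP n. u n y)" if "y \<in> states D" for y
    unfolding u_def by (rule total_cost_stationary[OF \<phi> that discount_nonneg])
  have "one_step_value \<beta> D (total_cost \<beta> D (stationary_policy D \<phi>)) (x, \<phi> x) = (SUP n. u (Suc n) x)"
    unfolding u_Suc by (rule one_step_value_SUP[OF gr[OF x] m mono tc])
  also have "\<dots> = (SUP n. u n x)"
    by (rule SUP_eq) (auto intro: mono[OF x])
  finally show ?thesis by (simp add: tc[OF x])
qed

lemma exists_minimising_policy:
  "\<exists>\<phi>\<in>stationary D. \<forall>x\<in>states D. one_step_value \<beta> D limit_value (x, \<phi> x) = limit_value x"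
proof -
  obtain \<phi> where \<phi>: "\<phi> \<in> borel_measurable (restrict_space borel (states D))"
    "\<And>x. x \<in> states D \<Longrightarrow> \<phi> x \<in> avail D x"
    "\<And>x. x \<in> states D \<Longrightarrow> one_step_value \<beta> D limit_value (x, \<phi> x) = bellman limit_value x"
    using measurable_argmin[OF lsc_one_step_value[OF lsc_limit_value]] unfolding bellman_def by blast
  have "\<phi> \<in> stationary D"
    using \<phi>(1,2) model unfolding stationary_def state_space_def action_space_def
    by (auto intro!: measurable_restrict_space2 simp: space_restrict_space mdp_model_def subset_iff)
  then show ?thesis using \<phi>(3) bellman_limit_value by auto
qed

lemma opt_value_eq: "x \<in> states D \<Longrightarrow> opt_value \<beta> D x = limit_value x"
proof (rule antisym)
  assume x: "x \<in> states D"
  obtain \<phi> where \<phi>: "\<phi> \<in> stationary D" "\<And>x. x \<in> states D \<Longrightarrow> one_step_value \<beta> D limit_value (x, \<phi> x) = limit_value x"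
    using exists_minimising_policy by blast
  have "opt_value \<beta> D x \<le> total_cost \<beta> D (stationary_policy D \<phi>) x"
    unfolding opt_value_def using is_policy_stationary_policy[OF model \<phi>(1)] by (blast intro: INF_lower)
  also have "\<dots> \<le> limit_value x" by (rule total_cost_stationary_le[OF \<phi>(1) x]) (simp only: \<phi>(2) order_refl)
  finally show "opt_value \<beta> D x \<le> limit_value x" .
next
  assume "x \<in> states D"
  then show "limit_value x \<le> opt_value \<beta> D x"
    unfolding opt_value_def using limit_value_le_total_cost by (blast intro: INF_greatest)
qed

text \<open>The two functions are known to agree on \<open>states D\<close> only, which is the space
  of every kernel measure used here.\<close>

lemma one_step_value_opt_value:
  "z \<in> gr D \<Longrightarrow> one_step_value \<beta> D (opt_value \<beta> D) z = one_step_value \<beta> D limit_value z"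
  by (rule antisym; rule one_step_value_mono; simp only: opt_value_eq order_refl)

lemma bellman_opt_value:
  assumes x: "x \<in> states D"
  shows "(INF a\<in>avail D x. one_step_value \<beta> D (opt_value \<beta> D) (x, a)) = opt_value \<beta> D x"
proof -
  have "(INF a\<in>avail D x. one_step_value \<beta> D (opt_value \<beta> D) (x, a)) = bellman limit_value x"
    unfolding bellman_def by (rule INF_cong[OF refl], rule one_step_value_opt_value) (simp add: gr_def x)
  then show ?thesis by (simp only: bellman_limit_value[OF x] opt_value_eq[OF x])
qed

lemma exists_conserving_policy:
  "\<exists>\<phi>\<in>stationary D. \<forall>x\<in>states D. one_step_value \<beta> D (opt_value \<beta> D) (x, \<phi> x) = opt_value \<beta> D x"
proof -
  obtain \<phi> where \<phi>: "\<phi> \<in> stationary D"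
    "\<And>x. x \<in> states D \<Longrightarrow> one_step_value \<beta> D limit_value (x, \<phi> x) = limit_value x"
    using exists_minimising_policy by blast
  have "one_step_value \<beta> D (opt_value \<beta> D) (x, \<phi> x) = opt_value \<beta> D x" if x: "x \<in> states D" for x
  proof -
    have "(x, \<phi> x) \<in> gr D" using stationaryD(1)[OF \<phi>(1) x] x by (simp add: gr_def)
    then show ?thesis by (simp only: one_step_value_opt_value \<phi>(2)[OF x] opt_value_eq[OF x])
  qed
  then show ?thesis using \<phi>(1) by blast
qed

text \<open>An optimal stationary policy has cost \<open>opt_value\<close>, and its cost solves the
  equation of the policy. Conversely, the equation makes \<open>opt_value\<close> a supersolution
  for the policy, hence an upper bound for its cost.\<close>

lemma optimal_iff_conserving:
  assumes \<phi>: "\<phi> \<in> stationary D"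
  shows "optimal_policy \<beta> D (stationary_policy D \<phi>) \<longleftrightarrow>
    (\<forall>x\<in>states D. one_step_value \<beta> D (opt_value \<beta> D) (x, \<phi> x) = opt_value \<beta> D x)"
proof
  assume opt: "optimal_policy \<beta> D (stationary_policy D \<phi>)"
  show "\<forall>x\<in>states D. one_step_value \<beta> D (opt_value \<beta> D) (x, \<phi> x) = opt_value \<beta> D x"
  proof
    fix x assume x: "x \<in> states D"
    then have "(x, \<phi> x) \<in> gr D" using stationaryD(1)[OF \<phi>] by (simp add: gr_def)
    then have "one_step_value \<beta> D (opt_value \<beta> D) (x, \<phi> x) =
        one_step_value \<beta> D (total_cost \<beta> D (stationary_policy D \<phi>)) (x, \<phi> x)"
      using opt by (intro antisym one_step_value_mono) (simp_all add: optimal_policy_def)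
    then show "one_step_value \<beta> D (opt_value \<beta> D) (x, \<phi> x) = opt_value \<beta> D x"
      using opt x total_cost_stationary_fixpoint[OF \<phi> x] by (simp add: optimal_policy_def)
  qed
next
  assume *: "\<forall>x\<in>states D. one_step_value \<beta> D (opt_value \<beta> D) (x, \<phi> x) = opt_value \<beta> D x"
  note \<pi> = is_policy_stationary_policy[OF model \<phi>]
  have "total_cost \<beta> D (stationary_policy D \<phi>) x = opt_value \<beta> D x" if x: "x \<in> states D" for x
  proof (rule antisym)
    show "total_cost \<beta> D (stationary_policy D \<phi>) x \<le> opt_value \<beta> D x"
      using * by (intro total_cost_stationary_le[OF \<phi> x]) simp
    show "opt_value \<beta> D x \<le> total_cost \<beta> D (stationary_policy D \<phi>) x"
      unfolding opt_value_def using \<pi> by (blast intro: INF_lower)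
  qed
  then show "optimal_policy \<beta> D (stationary_policy D \<phi>)" using \<pi> by (simp add: optimal_policy_def)
qed

end

section \<open>Adjoining an isolated point\<close>

lemma vimage_Some_image: "Some -` (Some ` B) = B" "Some -` (the -` B) = B" "Some -` {None} = {}" "Some -` range Some = UNIV"
  by auto

lemma open_Some_image: "open U \<Longrightarrow> open (Some ` U)"
  by (simp add: open_option_def vimage_Some_image)

lemma open_None: "open {None :: 'x::topological_space option}"
  by (simp add: open_option_def vimage_Some_image)

lemma continuous_on_the: "continuous_on UNIV (the :: 'x::topological_space option \<Rightarrow> 'x)"
  by (simp add: continuous_on_open_vimage open_option_def vimage_Some_image)

lemma continuous_on_Some: "continuous_on UNIV (Some :: 'x::topological_space \<Rightarrow> 'x option)"
  by (simp add: continuous_on_open_vimage open_option_def)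

lemma open_Some2_image:
  assumes "open U" shows "open (map_prod Some Some ` U)"
  unfolding open_prod_def
proof
  fix z assume "z \<in> map_prod Some Some ` U"
  then obtain x a where z: "z = (Some x, Some a)" "(x, a) \<in> U" by auto
  then obtain A B where "open A" "open B" "x \<in> A" "a \<in> B" "A \<times> B \<subseteq> U"
    using assms by (auto simp: open_prod_def)
  then show "\<exists>A B. open A \<and> open B \<and> z \<in> A \<times> B \<and> A \<times> B \<subseteq> map_prod Some Some ` U"
    using z by (intro exI[of _ "Some ` A"] exI[of _ "Some ` B"]) (auto intro: open_Some_image)
qed

lemma borel_Some_image:
  assumes "B \<in> sets borel" shows "Some ` B \<in> sets borel"
proof -
  have "the -` B \<inter> range Some \<in> sets borel"
    using measurable_sets[OF borel_measurable_continuous_onI[OF continuous_on_the] assms]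
      borel_open[OF open_Some_image[OF open_UNIV]] by auto
  moreover have "the -` B \<inter> range Some = Some ` B" by auto
  ultimately show ?thesis by simp
qed

lemma borel_Some2_image:
  assumes "B \<in> sets borel" shows "map_prod Some Some ` B \<in> sets borel"
proof -
  have "continuous_on UNIV (map_prod the the :: 'a option \<times> 'b option \<Rightarrow> _)"
    unfolding map_prod_def case_prod_beta
    by (intro continuous_on_Pair continuous_on_compose2[OF continuous_on_the] continuous_intros) auto
  then have "map_prod the the -` B \<inter> range (map_prod Some Some) \<in> sets borel"
    using measurable_sets[OF borel_measurable_continuous_onI assms, of "map_prod the the"]
      borel_open[OF open_Some2_image[OF open_UNIV]] by auto
  moreover have "map_prod the the -` B \<inter> range (map_prod Some Some) = map_prod Some Some ` B" by force
  ultimately show ?thesis by simp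
qed

text \<open>As \<open>None\<close> is isolated, its membership in \<open>W\<close> can be prescribed
  freely; only the trace on the old part matters.\<close>

lemma openin_insert_None:
  assumes W: "W \<subseteq> insert None (Some ` S)" and o: "openin (top_of_set S) {x\<in>S. Some x \<in> W}"
  shows "openin (top_of_set (insert None (Some ` S))) W"
proof -
  obtain T where T: "open T" "{x\<in>S. Some x \<in> W} = S \<inter> T" using o by (auto simp: openin_open)
  have "open (W \<inter> {None})" using open_None by (cases "None \<in> W") auto
  then have "open (Some ` T \<union> (W \<inter> {None}))" by (intro open_Un open_Some_image T)
  moreover have "W = insert None (Some ` S) \<inter> (Some ` T \<union> (W \<inter> {None}))"
    using W T(2) by (auto simp: set_eq_iff)
  ultimately show ?thesis by (auto simp: openin_open)
qed

text \<open>The analogue for graphs: pairs with exactly one component \<open>None\<close> do not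
  occur, so the new graph adds only the isolated point \<open>(None, None)\<close>.\<close>

lemma openin_insert_None2:
  fixes S :: "('x::topological_space \<times> 'a::topological_space) set"
  assumes W: "W \<subseteq> insert (None, None) (map_prod Some Some ` S)"
    and o: "openin (top_of_set S) {z\<in>S. map_prod Some Some z \<in> W}"
  shows "openin (top_of_set (insert (None, None) (map_prod Some Some ` S))) W"
proof -
  obtain T where T: "open T" "{z\<in>S. map_prod Some Some z \<in> W} = S \<inter> T" using o by (auto simp: openin_open)
  have "open ({None :: 'x option} \<times> {None :: 'a option})" by (intro open_Times open_None)
  then have "open (W \<inter> {(None, None)})" by (cases "(None, None) \<in> W") auto
  then have "open (map_prod Some Some ` T \<union> (W \<inter> {(None, None)}))" by (intro open_Un open_Some2_image T)
  moreover have "W = insert (None, None) (map_prod Some Some ` S) \<inter> (map_prod Some Some ` T \<union> (W \<inter> {(None, None)}))"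
  proof (rule set_eqI)
    fix z
    have "(Some x, Some a) \<in> map_prod Some Some ` U \<longleftrightarrow> (x, a) \<in> U"
      for x a and U :: "('x \<times> 'a) set" by force
    moreover have "(Some x, Some a) \<in> W \<longleftrightarrow> (x, a) \<in> S \<and> (x, a) \<in> T" for x a
    proof -
      have "(x, a) \<in> S" if "(Some x, Some a) \<in> W" using W that by auto
      moreover have "(x, a) \<in> {z\<in>S. map_prod Some Some z \<in> W} \<longleftrightarrow> (x, a) \<in> S \<inter> T"
        by (simp only: T(2))
      ultimately show ?thesis by auto
    qed
    ultimately show "z \<in> W \<longleftrightarrow> z \<in> insert (None, None) (map_prod Some Some ` S) \<inter> (map_prod Some Some ` T \<union> (W \<inter> {(None, None)}))"
      using W by (cases z; cases "fst z"; cases "snd z") auto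
  qed
  ultimately show ?thesis by (auto simp: openin_open)
qed

lemma continuous_on_insert_None2:
  fixes S :: "('x::topological_space \<times> 'a::topological_space) set" and f :: "_ \<Rightarrow> 'c::topological_space"
  assumes f: "continuous_on S (\<lambda>z. f (map_prod Some Some z))"
  shows "continuous_on (insert (None, None) (map_prod Some Some ` S)) f"
  unfolding continuous_openin_preimage_eq
proof (intro allI impI)
  let ?S = "insert (None, None) (map_prod Some Some ` S)"
  fix T :: "'c set" assume "open T"
  from continuous_openin_preimage_gen[OF f this]
  have "openin (top_of_set S) {z\<in>S. map_prod Some Some z \<in> ?S \<inter> f -` T}"
    by (elim back_subst[of "openin _"]) auto
  then show "openin (top_of_set ?S) (?S \<inter> f -` T)" by (intro openin_insert_None2) auto
qed

lemma measurable_insert_None: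
  assumes S: "S \<in> sets borel" and f: "(\<lambda>x. f (Some x)) \<in> measurable (restrict_space borel S) N" "f None \<in> space N"
  shows "f \<in> measurable (restrict_space borel (insert None (Some ` S))) N"
proof (rule measurableI)
  fix z assume "z \<in> space (restrict_space borel (insert None (Some ` S)))"
  then show "f z \<in> space N" using f measurable_space[OF f(1)] by (auto simp: space_restrict_space)
next
  fix Y assume Y: "Y \<in> sets N"
  have "{x\<in>S. f (Some x) \<in> Y} \<in> sets borel"
    using measurable_sets[OF f(1) Y] S by (auto simp: sets_restrict_space_iff space_restrict_space vimage_def Int_def conj_commute)
  then have "Some ` {x\<in>S. f (Some x) \<in> Y} \<union> (if f None \<in> Y then {None} else {}) \<in> sets borel"
    using borel_open[OF open_None] by (intro sets.Un borel_Some_image) auto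
  moreover have "f -` Y \<inter> insert None (Some ` S) = Some ` {x\<in>S. f (Some x) \<in> Y} \<union> (if f None \<in> Y then {None} else {})"
    by auto
  moreover have "insert None (Some ` S) \<in> sets borel"
    using sets.Un[OF borel_open[OF open_None] borel_Some_image[OF S]] by simp
  ultimately show "f -` Y \<inter> space (restrict_space borel (insert None (Some ` S))) \<in> sets (restrict_space borel (insert None (Some ` S)))"
    by (auto simp: sets_restrict_space_iff space_restrict_space)
qed

lemma measurable_insert_None2:
  fixes S :: "('x::topological_space \<times> 'a::topological_space) set"
  assumes S: "S \<in> sets borel" and f: "(\<lambda>z. f (map_prod Some Some z)) \<in> measurable (restrict_space borel S) N" "f (None, None) \<in> space N"
  shows "insert (None, None) (map_prod Some Some ` S) \<in> sets borel"
    and "f \<in> measurable (restrict_space borel (insert (None, None) (map_prod Some Some ` S))) N"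
proof -
  let ?S = "insert (None, None) (map_prod Some Some ` S)"
  have N: "{(None, None)} \<in> sets (borel :: ('x option \<times> 'a option) measure)"
    using borel_open[OF open_Times[OF open_None open_None]] by simp
  then show S': "?S \<in> sets borel"
    using borel_Some2_image[OF S] by (auto simp: insert_is_Un[of _ "map_prod Some Some ` S"] simp del: Un_insert_left)
  show "f \<in> measurable (restrict_space borel ?S) N"
  proof (rule measurableI)
    fix z assume "z \<in> space (restrict_space borel ?S)"
    then show "f z \<in> space N" using f measurable_space[OF f(1)] by (auto simp: space_restrict_space)
  next
    fix Y assume Y: "Y \<in> sets N"
    have "{z\<in>S. f (map_prod Some Some z) \<in> Y} \<in> sets borel"
      using measurable_sets[OF f(1) Y] S by (auto simp: sets_restrict_space_iff space_restrict_space vimage_def Int_def conj_commute)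
    then have "map_prod Some Some ` {z\<in>S. f (map_prod Some Some z) \<in> Y} \<union> (if f (None, None) \<in> Y then {(None, None)} else {}) \<in> sets borel"
      using N by (intro sets.Un borel_Some2_image) auto
    moreover have "f -` Y \<inter> ?S = map_prod Some Some ` {z\<in>S. f (map_prod Some Some z) \<in> Y} \<union> (if f (None, None) \<in> Y then {(None, None)} else {})"
      by auto
    ultimately show "f -` Y \<inter> space (restrict_space borel ?S) \<in> sets (restrict_space borel ?S)"
      using S' by (auto simp: sets_restrict_space_iff space_restrict_space)
  qed
qed

section \<open>The HV transformation of the model\<close>

text \<open>The masses may exceed 1, so \<open>\<kappa>\<close> need not map into
  \<open>subprob_algebra\<close>. Induction on the integrand reduces the claim to the measurability
  of \<open>emeasure (\<kappa> s) B\<close>.\<close>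

lemma measurable_nn_integral_kernel:
  assumes \<kappa>: "transition_kernel S T \<kappa>" and u: "u \<in> borel_measurable (restrict_space borel T)"
  shows "(\<lambda>s. \<integral>\<^sup>+t. u t \<partial>\<kappa> s) \<in> borel_measurable (restrict_space borel S)"
  using u
proof (induction rule: borel_measurable_induct)
  case (cong f g)
  have "(\<integral>\<^sup>+t. f t \<partial>\<kappa> s) = (\<integral>\<^sup>+t. g t \<partial>\<kappa> s)" if "s \<in> S" for s
    using \<kappa> that cong(3) sets_eq_imp_space_eq[of "\<kappa> s" "restrict_space borel T"]
    by (intro nn_integral_cong) (auto simp: transition_kernel_def)
  then show ?case using cong(4) by (subst measurable_cong) (auto simp: space_restrict_space)
next
  case (set B)
  have "(\<integral>\<^sup>+t. indicator B t \<partial>\<kappa> s) = emeasure (\<kappa> s) B" if "s \<in> S" for s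
    using \<kappa> that set by (intro nn_integral_indicator) (auto simp: transition_kernel_def)
  then show ?case using set \<kappa>
    by (subst measurable_cong[where g = "\<lambda>s. emeasure (\<kappa> s) B"])
       (auto simp: space_restrict_space transition_kernel_def)
next
  case (mult f c)
  have "(\<integral>\<^sup>+t. c * f t \<partial>\<kappa> s) = c * (\<integral>\<^sup>+t. f t \<partial>\<kappa> s)" if "s \<in> S" for s
    using \<kappa> that mult(2) by (intro nn_integral_cmult) (auto simp: transition_kernel_def cong: measurable_cong_sets)
  then show ?case using mult(4)
    by (subst measurable_cong[where g = "\<lambda>s. c * (\<integral>\<^sup>+t. f t \<partial>\<kappa> s)"]) (auto simp: space_restrict_space)
next
  case (add f g)
  have "(\<integral>\<^sup>+t. g t + f t \<partial>\<kappa> s) = (\<integral>\<^sup>+t. g t \<partial>\<kappa> s) + (\<integral>\<^sup>+t. f t \<partial>\<kappa> s)" if "s \<in> S" for s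
    using \<kappa> that add by (intro nn_integral_add) (auto simp: transition_kernel_def cong: measurable_cong_sets)
  then show ?case using add
    by (subst measurable_cong[where g = "\<lambda>s. (\<integral>\<^sup>+t. g t \<partial>\<kappa> s) + (\<integral>\<^sup>+t. f t \<partial>\<kappa> s)"])
       (auto simp: space_restrict_space)
next
  case (seq U)
  have "(\<integral>\<^sup>+t. (SUP i. U i) t \<partial>\<kappa> s) = (SUP i. \<integral>\<^sup>+t. U i t \<partial>\<kappa> s)" if "s \<in> space (restrict_space borel S)" for s
  proof -
    have "(\<integral>\<^sup>+t. (SUP i. U i) t \<partial>\<kappa> s) = (\<integral>\<^sup>+t. (SUP i. U i t) \<partial>\<kappa> s)"
      by (simp add: image_comp)
    also have "\<dots> = (SUP i. \<integral>\<^sup>+t. U i t \<partial>\<kappa> s)"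
      using \<kappa> that seq
      by (intro nn_integral_monotone_convergence_SUP)
         (auto simp: transition_kernel_def space_restrict_space cong: measurable_cong_sets)
    finally show ?thesis .
  qed
  then show ?case using seq(5) by (subst measurable_cong) (assumption, intro borel_measurable_SUP, simp_all)
qed

text \<open>Subtracting the lower semicontinuous \<open>b\<close> from the continuous sum shows that
  \<open>a\<close> is upper semicontinuous. The set \<open>a < r\<close> is exhausted by
  intermediate levels \<open>t\<close> with \<open>a + b - r < t < b\<close>.\<close>

lemma continuous_on_if_lsc_sum:
  fixes a b :: "'s::topological_space \<Rightarrow> real"
  assumes a: "lsc S (\<lambda>x. ennreal (a x))" "\<And>x. x \<in> S \<Longrightarrow> 0 \<le> a x"
    and b: "lsc S (\<lambda>x. ennreal (b x))" "\<And>x. x \<in> S \<Longrightarrow> 0 \<le> b x"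
    and ab: "continuous_on S (\<lambda>x. a x + b x)"
  shows "continuous_on S a"
proof -
  have lower: "openin (top_of_set S) {x\<in>S. r < f x}"
    if "lsc S (\<lambda>x. ennreal (f x))" "\<And>x. x \<in> S \<Longrightarrow> 0 \<le> f x" for f :: "'s \<Rightarrow> real" and r
  \<comment> \<open>Negative levels are treated separately because \<open>ennreal\<close> sends them
    all to 0.\<close>
  proof (cases "r < 0")
    case True
    then have "{x\<in>S. r < f x} = S" using that(2) by fastforce
    then show ?thesis by simp
  next
    case False
    then have "{x\<in>S. r < f x} = {x\<in>S. ennreal r < ennreal (f x)}" by (auto simp: ennreal_less_iff)
    then show ?thesis using that(1) by (simp add: lsc_def)
  qed
  have upper: "openin (top_of_set S) {x\<in>S. a x < r}" for r
  proof -
    have "openin (top_of_set S) (S \<inter> (\<lambda>x. a x + b x) -` {..<r + t})" for t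
      by (intro continuous_openin_preimage_gen[OF ab] open_lessThan)
    then have "openin (top_of_set S) (\<Union>t. {x\<in>S. t < b x} \<inter> (S \<inter> (\<lambda>x. a x + b x) -` {..<r + t}))"
      by (intro openin_Union) (auto intro: lower[OF b])
    moreover have "(\<Union>t. {x\<in>S. t < b x} \<inter> (S \<inter> (\<lambda>x. a x + b x) -` {..<r + t})) = {x\<in>S. a x < r}"
    proof (intro antisym subsetI)
      fix x assume x: "x \<in> {x\<in>S. a x < r}"
      then obtain t where "a x + b x - r < t" "t < b x" using dense[of "a x + b x - r" "b x"] by auto
      then show "x \<in> (\<Union>t. {x\<in>S. t < b x} \<inter> (S \<inter> (\<lambda>x. a x + b x) -` {..<r + t}))" using x by auto
    qed auto
    ultimately show ?thesis by simp
  qed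
  have ev: "\<forall>\<^sub>F y in at x within S. P y" if "openin (top_of_set S) {y\<in>S. P y}" "x \<in> S" "P x" for x P
    using that by (auto simp: openin_open eventually_at_topological)
  show ?thesis
    unfolding continuous_on_def
    by (intro ballI order_tendstoI ev lower[OF a] upper)
qed

locale hv_transformation =
  fixes D :: "('x::polish_space, 'a::polish_space) mdp"
    and V \<mu> :: "'x \<Rightarrow> real" and K \<beta> :: real
  assumes model: "mdp_model D"
    and V_cont: "continuous_on (states D) V"
    and V_ge_1: "\<forall>x\<in>states D. 1 \<le> V x"
    and q_cont: "weakly_continuous (gr D) (states D) (kern D)"
    and qV_cont: "continuous_on (gr D) (\<lambda>z. \<integral>y. V y \<partial>kern D z)"
    and \<mu>_cont: "continuous_on (states D) \<mu>"
    and \<mu>_bounds: "\<forall>x\<in>states D. 1 \<le> \<mu> x \<and> V x \<le> \<mu> x \<and> \<mu> x \<le> K * V x"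
    and \<mu>_drift: "\<forall>(x, a)\<in>gr D.
          ennreal (V x) + (\<integral>\<^sup>+y. ennreal (\<mu> y) \<partial>kern D (x, a)) \<le> ennreal (\<mu> x)"
    and discount: "(K - 1) / K \<le> \<beta>" "0 < \<beta>"
begin

abbreviation "H \<equiv> hv_mdp \<beta> \<mu> D"

section \<open>Integrals of functions bounded by a multiple of \<open>V\<close>\<close>

lemma transition: "transition_kernel (gr D) (states D) (kern D)"
  using model by (simp add: mdp_model_def)

lemma gr_states: "z \<in> gr D \<Longrightarrow> fst z \<in> states D"
  by (auto simp: gr_def)

lemma measurable_kern_iff:
  assumes "z \<in> gr D"
  shows "f \<in> measurable (kern D z) N \<longleftrightarrow> f \<in> measurable (restrict_space borel (states D)) N"
  by (simp add: measurable_cong_sets[OF sets_kern(1)[OF model assms] refl] state_space_def)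

lemma continuous_measurable_kern:
  fixes g :: "'x \<Rightarrow> real"
  shows "z \<in> gr D \<Longrightarrow> continuous_on (states D) g \<Longrightarrow> g \<in> borel_measurable (kern D z)"
  by (simp add: measurable_kern_iff borel_measurable_continuous_on_restrict)

text \<open>The drift inequality bounds the extended integral of \<open>\<mu>\<close> by the finite
  number \<open>\<mu> (fst z)\<close>. This gives integrability, and with it the inequality between
  real numbers.\<close>

lemma integral_\<mu>:
  assumes z: "z \<in> gr D"
  shows "integrable (kern D z) \<mu>" "V (fst z) + (\<integral>y. \<mu> y \<partial>kern D z) \<le> \<mu> (fst z)"
proof -
  have V: "0 \<le> V (fst z)" using V_ge_1 gr_states[OF z] by (meson order_trans zero_le_one)
  have \<mu>0: "0 \<le> \<mu> y" if "y \<in> states D" for y using \<mu>_bounds that by force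
  have drift: "ennreal (V (fst z)) + (\<integral>\<^sup>+y. ennreal (\<mu> y) \<partial>kern D z) \<le> ennreal (\<mu> (fst z))"
    using bspec[OF \<mu>_drift z] by (simp add: case_prod_beta)
  have fin: "(\<integral>\<^sup>+y. ennreal (\<mu> y) \<partial>kern D z) < \<infinity>"
  proof -
    have "(\<integral>\<^sup>+y. ennreal (\<mu> y) \<partial>kern D z) \<le> ennreal (\<mu> (fst z))"
      by (rule order_trans[OF _ drift]) (simp add: add_increasing)
    then show ?thesis by (rule le_less_trans) simp
  qed
  have nn: "AE y in kern D z. 0 \<le> \<mu> y" using \<mu>0 by (intro AE_I2) (simp add: sets_kern[OF model z])
  then show int: "integrable (kern D z) \<mu>"
    using fin continuous_measurable_kern[OF z \<mu>_cont] by (intro integrableI_nonneg)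
  have "0 \<le> (\<integral>y. \<mu> y \<partial>kern D z)" by (intro integral_nonneg_AE nn)
  then have "ennreal (V (fst z) + (\<integral>y. \<mu> y \<partial>kern D z)) \<le> ennreal (\<mu> (fst z))"
    using drift V by (simp add: nn_integral_eq_integral[OF int nn] ennreal_plus)
  then show "V (fst z) + (\<integral>y. \<mu> y \<partial>kern D z) \<le> \<mu> (fst z)"
    using \<mu>0[OF gr_states[OF z]] by simp
qed

lemma integrable_V_bounded:
  assumes z: "z \<in> gr D" and g: "continuous_on (states D) g" "\<And>x. x \<in> states D \<Longrightarrow> \<bar>g x\<bar> \<le> C * V x"
  shows "integrable (kern D z) g"
proof (rule Bochner_Integration.integrable_bound)
  show "integrable (kern D z) (\<lambda>y. \<bar>C\<bar> * \<mu> y)" using integral_\<mu>(1)[OF z] by simp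
  show "g \<in> borel_measurable (kern D z)" by (rule continuous_measurable_kern[OF z g(1)])
  have "\<bar>g y\<bar> \<le> \<bar>C\<bar> * \<bar>\<mu> y\<bar>" if "y \<in> states D" for y
  proof -
    have "C * V y \<le> \<bar>C\<bar> * \<bar>\<mu> y\<bar>" using V_ge_1 \<mu>_bounds that by (intro mult_mono) force+
    then show ?thesis using g(2)[OF that] by simp
  qed
  then show "AE y in kern D z. norm (g y) \<le> norm (\<bar>C\<bar> * \<mu> y)"
    by (intro AE_I2) (simp add: sets_kern[OF model z] abs_mult)
qed

text \<open>Both \<open>\<integral>g dq\<close> and \<open>\<integral>(C V - g) dq\<close> are lower semicontinuous, while their sum is continuous.\<close>

lemma continuous_integral_V_bounded_nonneg:
  assumes g: "continuous_on (states D) g" "\<And>x. x \<in> states D \<Longrightarrow> 0 \<le> g x" "\<And>x. x \<in> states D \<Longrightarrow> g x \<le> C * V x"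
  shows "continuous_on (gr D) (\<lambda>z. \<integral>y. g y \<partial>kern D z)"
proof -
  have lsc: "lsc (gr D) (\<lambda>z. ennreal (\<integral>y. h y \<partial>kern D z))" "\<And>z. z \<in> gr D \<Longrightarrow> 0 \<le> (\<integral>y. h y \<partial>kern D z)"
    if h: "continuous_on (states D) h" "\<And>x. x \<in> states D \<Longrightarrow> 0 \<le> h x" "\<And>x. x \<in> states D \<Longrightarrow> h x \<le> C * V x" for h
  proof -
    have nn: "AE y in kern D z. 0 \<le> h y" if "z \<in> gr D" for z
      using h(2) by (intro AE_I2) (simp add: sets_kern[OF model that])
    have "lsc (gr D) (\<lambda>z. \<integral>\<^sup>+y. ennreal (h y) \<partial>kern D z)"
      by (intro lsc_nn_integral[OF transition q_cont] lsc_continuous continuous_on_ennreal h)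
    moreover have "(\<integral>\<^sup>+y. ennreal (h y) \<partial>kern D z) = ennreal (\<integral>y. h y \<partial>kern D z)" if "z \<in> gr D" for z
      using h by (intro nn_integral_eq_integral nn that integrable_V_bounded[OF that h(1), of C]) auto
    ultimately show "lsc (gr D) (\<lambda>z. ennreal (\<integral>y. h y \<partial>kern D z))"
      by (subst (asm) lsc_cong) auto
    show "0 \<le> (\<integral>y. h y \<partial>kern D z)" if "z \<in> gr D" for z by (intro integral_nonneg_AE nn that)
  qed
  have h: "continuous_on (states D) (\<lambda>x. C * V x - g x)"
    by (intro continuous_intros V_cont g)
  have sum: "(\<integral>y. g y \<partial>kern D z) + (\<integral>y. C * V y - g y \<partial>kern D z) = C * (\<integral>y. V y \<partial>kern D z)"
    if z: "z \<in> gr D" for z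
  proof -
    have "integrable (kern D z) g" "integrable (kern D z) V"
      using g V_ge_1 by (auto intro!: integrable_V_bounded[OF z, of _ C] integrable_V_bounded[OF z V_cont, of 1] simp: abs_le_iff)
    then show ?thesis by simp
  qed
  show ?thesis
  proof (rule continuous_on_if_lsc_sum)
    show "continuous_on (gr D) (\<lambda>z. (\<integral>y. g y \<partial>kern D z) + (\<integral>y. C * V y - g y \<partial>kern D z))"
      by (subst continuous_on_cong[OF refl sum]) (auto intro!: continuous_intros qV_cont)
  qed (use lsc[OF g] lsc[OF h] g in auto)
qed

text \<open>Since \<open>\<mu> \<le> K V\<close>, a factor bounded by \<open>M\<close> gives an
  integrand between 0 and \<open>K * M * V\<close>. These are the unnormalised integrals with
  respect to the new kernel; \<open>f = 1\<close> gives its mass on the old states.\<close>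

lemma continuous_integral_\<mu>_mult:
  assumes f: "continuous_on (states D) f" "\<And>x. x \<in> states D \<Longrightarrow> 0 \<le> f x" "\<And>x. x \<in> states D \<Longrightarrow> f x \<le> M"
  shows "continuous_on (gr D) (\<lambda>z. \<integral>y. \<mu> y * f y \<partial>kern D z)" "z \<in> gr D \<Longrightarrow> integrable (kern D z) (\<lambda>y. \<mu> y * f y)"
proof -
  have c: "continuous_on (states D) (\<lambda>y. \<mu> y * f y)" by (intro continuous_intros \<mu>_cont f)
  have nn: "0 \<le> \<mu> x * f x" if "x \<in> states D" for x
    using f(2)[OF that] \<mu>_bounds that by (intro mult_nonneg_nonneg) force+
  have le: "\<mu> x * f x \<le> (K * M) * V x" if x: "x \<in> states D" for x
  proof -
    have "0 \<le> M" using f(2,3)[OF x] by simp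
    have "0 \<le> K * V x" "\<mu> x \<le> K * V x" using \<mu>_bounds x by force+
    then have "\<mu> x * f x \<le> (K * V x) * M" by (intro mult_mono f x) simp_all
    then show ?thesis by (simp add: mult_ac)
  qed
  show "continuous_on (gr D) (\<lambda>z. \<integral>y. \<mu> y * f y \<partial>kern D z)"
    by (rule continuous_integral_V_bounded_nonneg[OF c nn le])
  show "z \<in> gr D \<Longrightarrow> integrable (kern D z) (\<lambda>y. \<mu> y * f y)"
    using nn le by (intro integrable_V_bounded[OF _ c, of z "K * M"]) auto
qed

lemma drift_ratio:
  assumes xa: "(x, a) \<in> gr D"
  shows "(\<integral>y. \<mu> y \<partial>kern D (x, a)) / (\<beta> * \<mu> x) \<le> 1" "0 < \<beta> * \<mu> x"
proof -
  have x: "x \<in> states D" using xa by (simp add: gr_def)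
  then have V: "1 \<le> V x" "1 \<le> \<mu> x" "V x \<le> \<mu> x" "\<mu> x \<le> K * V x" using V_ge_1 \<mu>_bounds by auto
  have K: "0 < K" using V by (smt (verit) mult_nonpos_nonneg)
  have "(\<integral>y. \<mu> y \<partial>kern D (x, a)) \<le> \<mu> x - V x" using integral_\<mu>(2)[OF xa] by simp
  \<comment> \<open>The bound \<open>\<mu> \<le> K V\<close> says \<open>V \<ge> \<mu> / K\<close>,
    so subtracting \<open>V\<close> removes at least the fraction \<open>1 / K\<close> of
    \<open>\<mu>\<close>. This is the origin of the lower bound on the discount factor.\<close>
  also have "\<dots> \<le> (K - 1) / K * \<mu> x" using V(4) K by (simp add: field_simps)
  also have "\<dots> \<le> \<beta> * \<mu> x" using discount(1) V(2) by (intro mult_right_mono) auto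
  finally show "(\<integral>y. \<mu> y \<partial>kern D (x, a)) / (\<beta> * \<mu> x) \<le> 1" "0 < \<beta> * \<mu> x"
    using discount(2) V(2) by (auto simp: divide_le_eq)
qed

lemma nn_integral_\<mu>:
  assumes xa: "(x, a) \<in> gr D"
  shows "(\<integral>\<^sup>+y. ennreal (\<mu> y) \<partial>kern D (x, a)) = ennreal (\<integral>y. \<mu> y \<partial>kern D (x, a))"
    "0 \<le> (\<integral>y. \<mu> y \<partial>kern D (x, a))"
proof -
  have nn: "AE y in kern D (x, a). 0 \<le> \<mu> y" using \<mu>_bounds by (force simp: sets_kern[OF model xa])
  show "(\<integral>\<^sup>+y. ennreal (\<mu> y) \<partial>kern D (x, a)) = ennreal (\<integral>y. \<mu> y \<partial>kern D (x, a))"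
    by (rule nn_integral_eq_integral[OF integral_\<mu>(1)[OF xa] nn])
  show "0 \<le> (\<integral>y. \<mu> y \<partial>kern D (x, a))" by (rule integral_nonneg_AE[OF nn])
qed

text \<open>The mass put on \<open>None\<close>, as a real number. In \<open>hv_kern\<close> it is a
  truncated \<open>ennreal\<close> difference; \<open>drift_ratio\<close> ensures that nothing is
  truncated.\<close>

definition exit_prob :: "'x \<Rightarrow> 'a \<Rightarrow> real" where
  "exit_prob x a = 1 - (\<integral>y. \<mu> y \<partial>kern D (x, a)) / (\<beta> * \<mu> x)"

lemma exit_prob_nonneg: "(x, a) \<in> gr D \<Longrightarrow> 0 \<le> exit_prob x a"
  using drift_ratio(1) by (simp add: exit_prob_def)

lemma sets_hv_kern: 
  assumes xa: "(x, a) \<in> gr D"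
  shows "sets (hv_kern \<beta> \<mu> D (Some x, Some a)) = sets (restrict_space borel (hv_states D))"
  by (rule hv_kern_Some(1)[OF model xa \<mu>_cont])

lemma emeasure_hv_kern_None:
  assumes xa: "(x, a) \<in> gr D"
  shows "emeasure (hv_kern \<beta> \<mu> D (Some x, Some a)) {None} = ennreal (exit_prob x a)"
  unfolding hv_kern_Some(3)[OF model xa \<mu>_cont] exit_prob_def nn_integral_\<mu>(1)[OF xa]
  using drift_ratio[OF xa] nn_integral_\<mu>(2)[OF xa]
  by (simp add: ennreal_mult[symmetric] ennreal_1[symmetric] ennreal_minus del: ennreal_1)

text \<open>\<open>hv_kern\<close> is known only through its values on sets, so the formula is
  lifted from indicators by induction on the integrand.\<close>

lemma nn_integral_hv_kern:
  assumes xa: "(x, a) \<in> gr D" and u: "u \<in> borel_measurable (restrict_space borel (hv_states D))"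
  shows "(\<integral>\<^sup>+y. u y \<partial>hv_kern \<beta> \<mu> D (Some x, Some a)) =
    ennreal (1 / (\<beta> * \<mu> x)) * (\<integral>\<^sup>+y. ennreal (\<mu> y) * u (Some y) \<partial>kern D (x, a)) + ennreal (exit_prob x a) * u None"
  using u
proof (induction rule: borel_measurable_induct)
  let ?P = "hv_kern \<beta> \<mu> D (Some x, Some a)" and ?c = "ennreal (1 / (\<beta> * \<mu> x))"
  note s = sets_hv_kern[OF xa]
  have sp: "space ?P = hv_states D" using sets_eq_imp_space_eq[OF s] by (simp add: space_restrict_space)
  have meas: "f \<in> borel_measurable ?P \<longleftrightarrow> f \<in> borel_measurable (restrict_space borel (hv_states D))" for f :: "'x option \<Rightarrow> ennreal"
    by (simp add: measurable_cong_sets[OF s refl])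
  have Some_meas[measurable]: "(\<lambda>y. f (Some y)) \<in> borel_measurable (kern D (x, a))"
    if "f \<in> borel_measurable (restrict_space borel (hv_states D))" for f :: "'x option \<Rightarrow> ennreal"
    using measurable_compose[OF measurable_Some_hv that] by (simp add: measurable_kern_iff[OF xa] state_space_def)
  have [measurable]: "\<mu> \<in> borel_measurable (kern D (x, a))" by (rule continuous_measurable_kern[OF xa \<mu>_cont])
  {
    case (cong f g)
    have "(\<integral>\<^sup>+y. f y \<partial>?P) = (\<integral>\<^sup>+y. g y \<partial>?P)"
      using cong(3) by (intro nn_integral_cong) (simp add: sp space_restrict_space)
    moreover have "(\<integral>\<^sup>+y. ennreal (\<mu> y) * f (Some y) \<partial>kern D (x, a)) = (\<integral>\<^sup>+y. ennreal (\<mu> y) * g (Some y) \<partial>kern D (x, a))"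
      using cong(3) by (intro nn_integral_cong) (simp add: sets_kern[OF model xa] space_restrict_space hv_states_def)
    moreover have "f None = g None" using cong(3) by (simp add: space_restrict_space hv_states_def)
    ultimately show ?case using cong(4) by simp
  next
    case (set B)
    then have B: "B \<in> sets ?P" by (simp add: s)
    let ?B = "{x\<in>states D. Some x \<in> B}"
    have B': "?B \<in> sets (state_space D)"
      using measurable_sets[OF measurable_Some_hv set] by (simp add: vimage_def Int_def conj_commute state_space_def space_restrict_space)
    have N: "{None} \<in> sets ?P"
      unfolding s using borel_open[OF open_None] by (auto simp: sets_restrict_space hv_states_def intro!: image_eqI[of _ _ "{None}"])
    \<comment> \<open>The kernel is described separately on the embedded old states and on the added
      point, so \<open>B\<close> is split accordingly.\<close>
    have eq: "B = Some ` ?B \<union> (B \<inter> {None})"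
      using sets.sets_into_space[OF set] by (auto simp: space_restrict_space hv_states_def)
    have "emeasure ?P B = emeasure ?P (Some ` ?B) + emeasure ?P (B \<inter> {None})"
    proof -
      have "Some ` ?B = B - {None}" using eq by auto
      then have "Some ` ?B \<in> sets ?P" using B N by auto
      then show ?thesis using B N by (subst eq) (intro plus_emeasure[symmetric], auto)
    qed
    also have "emeasure ?P (Some ` ?B) = ?c * (\<integral>\<^sup>+y. ennreal (\<mu> y) * indicator B (Some y) \<partial>kern D (x, a))"
      unfolding hv_kern_Some(2)[OF model xa \<mu>_cont B']
      by (intro arg_cong2[where f = "(*)"] nn_integral_cong refl) (auto simp: sets_kern[OF model xa] split: split_indicator)
    also have "emeasure ?P (B \<inter> {None}) = ennreal (exit_prob x a) * indicator B None"
      using emeasure_hv_kern_None[OF xa] by (auto split: split_indicator)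
    finally show ?case using B by simp
  next
    case (mult f c)
    have "(\<integral>\<^sup>+y. ennreal (\<mu> y) * (c * f (Some y)) \<partial>kern D (x, a)) = c * (\<integral>\<^sup>+y. ennreal (\<mu> y) * f (Some y) \<partial>kern D (x, a))"
      using Some_meas[OF mult(2)] by (subst nn_integral_cmult[symmetric]) (auto simp: mult_ac)
    then show ?case using mult(2,4) by (simp add: nn_integral_cmult meas distrib_left mult_ac)
  next
    case (add f g)
    have "(\<integral>\<^sup>+y. ennreal (\<mu> y) * (g (Some y) + f (Some y)) \<partial>kern D (x, a)) =
        (\<integral>\<^sup>+y. ennreal (\<mu> y) * g (Some y) \<partial>kern D (x, a)) + (\<integral>\<^sup>+y. ennreal (\<mu> y) * f (Some y) \<partial>kern D (x, a))"
      using Some_meas[OF add(1)] Some_meas[OF add(3)] by (subst nn_integral_add[symmetric]) (auto simp: distrib_left)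
    then show ?case using add by (simp add: nn_integral_add meas distrib_left distrib_right ac_simps)
  next
    case (seq U)
    have inc: "incseq (\<lambda>i. U i y)" for y using seq(3) by (auto simp: incseq_def le_fun_def)
    have "(\<integral>\<^sup>+y. (SUP i. U i) y \<partial>?P) = (SUP i. \<integral>\<^sup>+y. U i y \<partial>?P)"
      using seq(1,3) by (simp add: image_comp nn_integral_monotone_convergence_SUP meas)
    also have "\<dots> = (SUP i. ?c * (\<integral>\<^sup>+y. ennreal (\<mu> y) * U i (Some y) \<partial>kern D (x, a)) + ennreal (exit_prob x a) * U i None)"
      by (simp only: seq(5))
    also have "\<dots> = (SUP i. ?c * (\<integral>\<^sup>+y. ennreal (\<mu> y) * U i (Some y) \<partial>kern D (x, a))) + (SUP i. ennreal (exit_prob x a) * U i None)"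
      using inc by (intro ennreal_SUP_add) (auto simp: incseq_def intro!: mult_left_mono nn_integral_mono)
    also have "(SUP i. ennreal (exit_prob x a) * U i None) = ennreal (exit_prob x a) * (SUP i. U i) None"
      by (simp add: SUP_mult_left_ennreal image_comp)
    also have "(SUP i. ?c * (\<integral>\<^sup>+y. ennreal (\<mu> y) * U i (Some y) \<partial>kern D (x, a))) =
        ?c * (\<integral>\<^sup>+y. (SUP i. ennreal (\<mu> y) * U i (Some y)) \<partial>kern D (x, a))"
      using inc Some_meas[OF seq(1)]
      by (subst nn_integral_monotone_convergence_SUP)
         (auto simp: SUP_mult_left_ennreal incseq_def le_fun_def intro!: mult_left_mono)
    also have "\<dots> = ?c * (\<integral>\<^sup>+y. ennreal (\<mu> y) * (SUP i. U i) (Some y) \<partial>kern D (x, a))"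
      by (simp add: SUP_mult_left_ennreal image_comp)
    finally show ?case .
  }
qed

end

section \<open>Transfer of the model assumptions to the transformed process\<close>

context hv_transformation
begin

lemma hv_sel [simp]: "states H = hv_states D" "kern H = hv_kern \<beta> \<mu> D"
  "avail H (Some x) = Some ` avail D x" "avail H None = {None}"
  "actions H = insert None (Some ` actions D)"
  "cost H (Some x, Some a) = cost D (x, a) / \<mu> x" "cost H (None, None) = 0"
  by (simp_all add: hv_mdp_def)

lemma gr_hv: "gr H = insert (None, None) (map_prod Some Some ` gr D)"
  by (auto simp: gr_def hv_states_def image_iff)

lemma avail_props:
  "x \<in> states D \<Longrightarrow> avail D x \<noteq> {}" "x \<in> states D \<Longrightarrow> a \<in> avail D x \<Longrightarrow> a \<in> actions D"
  "x \<in> states D \<Longrightarrow> avail D x \<in> sets borel"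
  using model by (auto simp: mdp_model_def)

lemma borel_sets: "states D \<in> sets borel" "actions D \<in> sets borel" "gr D \<in> sets borel"
  using model by (auto simp: mdp_model_def)

lemma prob_space_hv_kern:
  assumes "z \<in> gr H"
  shows "sets (hv_kern \<beta> \<mu> D z) = sets (restrict_space borel (hv_states D))" "prob_space (hv_kern \<beta> \<mu> D z)"
proof -
  consider "z = (None, None)" | x a where "(x, a) \<in> gr D" "z = (Some x, Some a)"
    using assms by (auto simp: gr_hv)
  then have "sets (hv_kern \<beta> \<mu> D z) = sets (restrict_space borel (hv_states D)) \<and> prob_space (hv_kern \<beta> \<mu> D z)"
  proof cases
    case 1
    then show ?thesis by (auto simp: hv_kern_None hv_states_def space_restrict_space intro!: prob_space_return)
  next
    case 2
    let ?P = "hv_kern \<beta> \<mu> D (Some x, Some a)"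
    have r: "0 < \<beta> * \<mu> x" using drift_ratio[OF 2(1)] by simp
    \<comment> \<open>The total mass is the integral of 1, whose two parts add up to 1 by the choice
      of \<open>exit_prob\<close>.\<close>
    have "emeasure ?P (space ?P) = (\<integral>\<^sup>+y. 1 \<partial>?P)" by simp
    also have "\<dots> = ennreal (1 / (\<beta> * \<mu> x)) * ennreal (\<integral>y. \<mu> y \<partial>kern D (x, a)) + ennreal (exit_prob x a)"
      by (subst nn_integral_hv_kern[OF 2(1)]) (simp_all add: nn_integral_\<mu>[OF 2(1)])
    also have "\<dots> = ennreal (1 / (\<beta> * \<mu> x) * (\<integral>y. \<mu> y \<partial>kern D (x, a)) + exit_prob x a)"
      using r nn_integral_\<mu>(2)[OF 2(1)] exit_prob_nonneg[OF 2(1)]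
      by (simp add: ennreal_mult[symmetric] ennreal_plus[symmetric] del: ennreal_plus)
    also have "\<dots> = 1" by (simp add: exit_prob_def)
    finally show ?thesis using 2(2) sets_hv_kern[OF 2(1)] by (auto intro: prob_spaceI)
  qed
  then show "sets (hv_kern \<beta> \<mu> D z) = sets (restrict_space borel (hv_states D))" "prob_space (hv_kern \<beta> \<mu> D z)"
    by auto
qed

lemma measurable_fst_gr:
  assumes "f \<in> measurable (restrict_space borel (states D)) N"
  shows "(\<lambda>z. f (fst z)) \<in> measurable (restrict_space borel (gr D)) N"
proof -
  have "(fst :: 'x \<times> 'a \<Rightarrow> 'x) \<in> borel_measurable borel"
    by (intro borel_measurable_continuous_onI continuous_intros)
  then have "fst \<in> measurable (restrict_space borel (gr D)) (restrict_space borel (states D))"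
    by (rule measurable_restrict_space3) (auto simp: gr_def)
  then show ?thesis using assms by (rule measurable_compose)
qed

lemma borel_measurable_\<mu>: "\<mu> \<in> borel_measurable (restrict_space borel (states D))"
  by (rule borel_measurable_continuous_on_restrict[OF \<mu>_cont])

lemma transition_prob_kernel_hv: "transition_prob_kernel (gr H) (states H) (kern H)"
  unfolding transition_prob_kernel_def transition_kernel_def
proof (intro conjI ballI)
  fix B assume "B \<in> sets (restrict_space borel (states H))"
  then have B: "B \<in> sets (restrict_space borel (hv_states D))" by simp
  have [measurable]: "(\<lambda>z. \<mu> (fst z)) \<in> borel_measurable (restrict_space borel (gr D))"
    by (rule measurable_fst_gr[OF borel_measurable_\<mu>])
  have "(\<lambda>y. indicator B (Some y) :: ennreal) \<in> borel_measurable (restrict_space borel (states D))"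
    using measurable_compose[OF measurable_Some_hv[of D] borel_measurable_indicator[OF B]] by (simp add: state_space_def)
  then have "(\<lambda>y. ennreal (\<mu> y) * indicator B (Some y)) \<in> borel_measurable (restrict_space borel (states D))"
    using borel_measurable_\<mu> by measurable
  then have [measurable]: "(\<lambda>z. \<integral>\<^sup>+y. ennreal (\<mu> y) * indicator B (Some y) \<partial>kern D z) \<in> borel_measurable (restrict_space borel (gr D))"
    by (rule measurable_nn_integral_kernel[OF transition])
  have [measurable]: "(\<lambda>z. \<integral>y. \<mu> y \<partial>kern D z) \<in> borel_measurable (restrict_space borel (gr D))"
    using continuous_integral_\<mu>_mult(1)[of "\<lambda>_. 1" 1] by (intro borel_measurable_continuous_on_restrict) simp
  have eq: "emeasure (hv_kern \<beta> \<mu> D (map_prod Some Some z)) B =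
      ennreal (1 / (\<beta> * \<mu> (fst z))) * (\<integral>\<^sup>+y. ennreal (\<mu> y) * indicator B (Some y) \<partial>kern D z) +
      ennreal (1 - (\<integral>y. \<mu> y \<partial>kern D z) / (\<beta> * \<mu> (fst z))) * indicator B None"
    if "z \<in> space (restrict_space borel (gr D))" for z
  proof (cases z)
    case (Pair x a)
    then have xa: "(x, a) \<in> gr D" using that by (simp add: space_restrict_space)
    have "emeasure (hv_kern \<beta> \<mu> D (Some x, Some a)) B = (\<integral>\<^sup>+y. indicator B y \<partial>hv_kern \<beta> \<mu> D (Some x, Some a))"
      using B by (simp add: sets_hv_kern[OF xa])
    then show ?thesis using nn_integral_hv_kern[OF xa borel_measurable_indicator[OF B]] Pair
      by (simp add: exit_prob_def)
  qed
  have "(\<lambda>z. emeasure (hv_kern \<beta> \<mu> D (map_prod Some Some z)) B) \<in> borel_measurable (restrict_space borel (gr D))"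
    by (subst measurable_cong[OF eq], assumption) measurable
  from measurable_insert_None2(2)[OF borel_sets(3) this]
  show "(\<lambda>z. emeasure (kern H z) B) \<in> borel_measurable (restrict_space borel (gr H))"
    by (simp add: gr_hv)
next
  fix z assume "z \<in> gr H"
  from prob_space_hv_kern[OF this]
  show "sets (kern H z) = sets (restrict_space borel (states H))" "prob_space (kern H z)" "finite_measure (kern H z)"
    by (auto simp: prob_space_def)
qed

text \<open>Bounds on \<open>f\<close> from both sides make every term nonnegative and finite, so
  the \<open>ennreal\<close> formula can be read off as an identity of real integrals.\<close>

lemma integral_hv_kern:
  assumes xa: "(x, a) \<in> gr D" and f: "continuous_on (hv_states D) f"
    and bound: "\<And>y. y \<in> hv_states D \<Longrightarrow> 0 \<le> f y" "\<And>y. y \<in> hv_states D \<Longrightarrow> f y \<le> M"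
  shows "(\<integral>y. f y \<partial>hv_kern \<beta> \<mu> D (Some x, Some a)) =
    (\<integral>y. \<mu> y * f (Some y) \<partial>kern D (x, a)) / (\<beta> * \<mu> x) + (1 - (\<integral>y. \<mu> y \<partial>kern D (x, a)) / (\<beta> * \<mu> x)) * f None"
proof -
  let ?P = "hv_kern \<beta> \<mu> D (Some x, Some a)"
  have fm: "f \<in> borel_measurable (restrict_space borel (hv_states D))"
    by (rule borel_measurable_continuous_on_restrict[OF f])
  have sp: "space ?P = hv_states D"
    using sets_eq_imp_space_eq[OF sets_hv_kern[OF xa]] by (simp add: space_restrict_space)
  have Some_in: "y \<in> states D \<Longrightarrow> Some y \<in> hv_states D" for y by (simp add: hv_states_def)
  have fS: "continuous_on (states D) (\<lambda>y. f (Some y))"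
    by (rule continuous_on_compose2[OF f continuous_on_subset[OF continuous_on_Some]]) (auto simp: hv_states_def)
  have \<mu>0: "0 \<le> \<mu> y" if "y \<in> states D" for y using \<mu>_bounds that by force
  have nn: "AE y in kern D (x, a). 0 \<le> \<mu> y * f (Some y)"
    using \<mu>0 bound(1) Some_in by (intro AE_I2) (simp add: sets_kern[OF model xa])
  have int: "integrable (kern D (x, a)) (\<lambda>y. \<mu> y * f (Some y))"
    using bound Some_in by (intro continuous_integral_\<mu>_mult(2)[OF fS _ _ xa]) auto
  let ?I = "\<integral>y. \<mu> y * f (Some y) \<partial>kern D (x, a)"
  have I0: "0 \<le> ?I" by (rule integral_nonneg_AE[OF nn])
  have f0: "0 \<le> f None" using bound(1) by (simp add: hv_states_def)
  have "(\<integral>\<^sup>+y. ennreal (\<mu> y) * ennreal (f (Some y)) \<partial>kern D (x, a)) = (\<integral>\<^sup>+y. ennreal (\<mu> y * f (Some y)) \<partial>kern D (x, a))"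
    using \<mu>0 bound(1) Some_in by (intro nn_integral_cong) (simp add: sets_kern[OF model xa] ennreal_mult)
  also have "\<dots> = ennreal ?I" by (rule nn_integral_eq_integral[OF int nn])
  finally have "(\<integral>\<^sup>+y. ennreal (f y) \<partial>?P) = ennreal (1 / (\<beta> * \<mu> x)) * ennreal ?I + ennreal (exit_prob x a) * ennreal (f None)"
    using nn_integral_hv_kern[OF xa measurable_compose[OF fm measurable_ennreal]] by simp
  also have "\<dots> = ennreal (1 / (\<beta> * \<mu> x) * ?I + exit_prob x a * f None)"
    using drift_ratio(2)[OF xa] I0 exit_prob_nonneg[OF xa] f0
    by (simp add: ennreal_mult[symmetric] ennreal_plus[symmetric] del: ennreal_plus)
  finally have "(\<integral>\<^sup>+y. ennreal (f y) \<partial>?P) = ennreal (1 / (\<beta> * \<mu> x) * ?I + exit_prob x a * f None)" .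
  moreover have "(\<integral>y. f y \<partial>?P) = enn2real (\<integral>\<^sup>+y. ennreal (f y) \<partial>?P)"
    using fm bound(1) by (intro integral_eq_nn_integral AE_I2)
      (simp_all add: sp measurable_cong_sets[OF sets_hv_kern[OF xa] refl])
  moreover have "0 \<le> 1 / (\<beta> * \<mu> x) * ?I + exit_prob x a * f None"
    using drift_ratio(2)[OF xa] I0 exit_prob_nonneg[OF xa] f0 by simp
  ultimately show ?thesis by (simp add: exit_prob_def del: ennreal_plus)
qed

lemma weakly_continuous_hv: "weakly_continuous (gr H) (states H) (kern H)"
  unfolding weakly_continuous_def
proof (intro allI impI)
  fix f :: "'x option \<Rightarrow> real"
  assume "continuous_on (states H) f \<and> bounded (f ` states H)"
  then obtain M where f: "continuous_on (hv_states D) f" and M: "\<And>y. y \<in> hv_states D \<Longrightarrow> \<bar>f y\<bar> \<le> M"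
    by (auto simp: bounded_iff)
  \<comment> \<open>The continuity result covers nonnegative integrands, so \<open>f\<close> is
    shifted by its bound. The new kernel is a probability, so the shift changes the integral by
    exactly \<open>M\<close>.\<close>
  let ?g = "\<lambda>y. f y + M"
  have g: "continuous_on (hv_states D) ?g" by (intro continuous_intros f)
  have g_bound: "0 \<le> ?g y" "?g y \<le> 2 * M" if "y \<in> hv_states D" for y using M[OF that] by auto
  have gS: "continuous_on (states D) (\<lambda>y. ?g (Some y))"
    by (rule continuous_on_compose2[OF g continuous_on_subset[OF continuous_on_Some]]) (auto simp: hv_states_def)
  have int_g: "(\<integral>y. ?g y \<partial>hv_kern \<beta> \<mu> D z) = (\<integral>y. f y \<partial>hv_kern \<beta> \<mu> D z) + M" if z: "z \<in> gr H" for z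
  proof -
    interpret prob_space "hv_kern \<beta> \<mu> D z" by (rule prob_space_hv_kern[OF z])
    have sp: "space (hv_kern \<beta> \<mu> D z) = hv_states D"
      using sets_eq_imp_space_eq[OF prob_space_hv_kern(1)[OF z]] by (simp add: space_restrict_space)
    have "f \<in> borel_measurable (hv_kern \<beta> \<mu> D z)"
      using borel_measurable_continuous_on_restrict[OF f]
      by (simp add: measurable_cong_sets[OF prob_space_hv_kern(1)[OF z] refl])
    then have "integrable (hv_kern \<beta> \<mu> D z) f"
      using M by (intro integrable_const_bound[of _ M] AE_I2) (simp_all add: sp)
    then show ?thesis by (simp add: prob_space)
  qed
  have "continuous_on (gr D) (\<lambda>z. \<integral>y. ?g y \<partial>hv_kern \<beta> \<mu> D (map_prod Some Some z))"
  proof (subst continuous_on_cong[OF refl])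
    show "(\<integral>y. ?g y \<partial>hv_kern \<beta> \<mu> D (map_prod Some Some z)) =
        (\<integral>y. \<mu> y * ?g (Some y) \<partial>kern D z) / (\<beta> * \<mu> (fst z)) + (1 - (\<integral>y. \<mu> y \<partial>kern D z) / (\<beta> * \<mu> (fst z))) * ?g None"
      if "z \<in> gr D" for z
      using integral_hv_kern[OF _ g g_bound, of "fst z" "snd z"] that by (cases z) simp
    have "continuous_on (gr D) (\<lambda>z. \<mu> (fst z))"
      by (rule continuous_on_compose2[OF \<mu>_cont]) (auto intro!: continuous_intros simp: gr_def)
    moreover have "continuous_on (gr D) (\<lambda>z. \<integral>y. \<mu> y * ?g (Some y) \<partial>kern D z)"
      using g_bound by (intro continuous_integral_\<mu>_mult(1)[OF gS, where M = "2 * M"]) (auto simp: hv_states_def)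
    moreover have "continuous_on (gr D) (\<lambda>z. \<integral>y. \<mu> y \<partial>kern D z)"
      using continuous_integral_\<mu>_mult(1)[of "\<lambda>_. 1" 1] by simp
    moreover have "\<beta> * \<mu> (fst z) \<noteq> 0" if "z \<in> gr D" for z
      using drift_ratio(2)[of "fst z" "snd z"] that by (metis prod.collapse less_irrefl)
    ultimately show "continuous_on (gr D) (\<lambda>z. (\<integral>y. \<mu> y * ?g (Some y) \<partial>kern D z) / (\<beta> * \<mu> (fst z)) +
        (1 - (\<integral>y. \<mu> y \<partial>kern D z) / (\<beta> * \<mu> (fst z))) * ?g None)"
      by (intro continuous_intros) auto
  qed
  then have "continuous_on (gr D) (\<lambda>z. \<integral>y. f y \<partial>hv_kern \<beta> \<mu> D (map_prod Some Some z))"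
  proof -
    assume "continuous_on (gr D) (\<lambda>z. \<integral>y. ?g y \<partial>hv_kern \<beta> \<mu> D (map_prod Some Some z))"
    then have "continuous_on (gr D) (\<lambda>z. (\<integral>y. ?g y \<partial>hv_kern \<beta> \<mu> D (map_prod Some Some z)) - M)"
      by (intro continuous_intros)
    then show ?thesis
      by (subst (asm) continuous_on_cong[OF refl, where g = "\<lambda>z. \<integral>y. f y \<partial>hv_kern \<beta> \<mu> D (map_prod Some Some z)"])
         (simp add: int_g gr_hv)
  qed
  then show "continuous_on (gr H) (\<lambda>z. \<integral>y. f y \<partial>kern H z)"
    unfolding gr_hv hv_sel by (rule continuous_on_insert_None2)
qed

lemma stationary_map_option:
  assumes \<phi>: "\<phi> \<in> stationary D"
  shows "map_option \<phi> \<in> stationary H"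
proof -
  have "\<phi> \<in> borel_measurable (restrict_space borel (states D))"
    using \<phi> by (simp add: stationary_def state_space_def action_space_def measurable_restrict_space2_iff)
  then have "(\<lambda>x. map_option \<phi> (Some x)) \<in> borel_measurable (restrict_space borel (states D))"
    using measurable_compose[OF _ borel_measurable_continuous_onI[OF continuous_on_Some]] by simp
  then have "map_option \<phi> \<in> borel_measurable (restrict_space borel (hv_states D))"
    unfolding hv_states_def by (intro measurable_insert_None borel_sets) auto
  moreover have av: "map_option \<phi> x \<in> avail H x" "map_option \<phi> x \<in> actions H" if "x \<in> hv_states D" for x
    using that \<phi> by (auto simp: hv_states_def stationary_def intro!: avail_props)
  ultimately have "map_option \<phi> \<in> measurable (state_space H) (action_space H)"
    unfolding state_space_def action_space_def hv_sel(1)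
    by (intro measurable_restrict_space2) (simp_all only: space_restrict_space, blast)
  then show ?thesis using av by (simp add: stationary_def)
qed

lemma mdp_model_hv: "mdp_model H"
proof -
  have av: "avail H x \<noteq> {} \<and> avail H x \<subseteq> actions H \<and> avail H x \<in> sets borel" if "x \<in> hv_states D" for x
    using that borel_open[OF open_None]
    by (auto simp: hv_states_def intro!: borel_Some_image avail_props(2,3) dest: avail_props(1))
  have cost: "(\<lambda>z. cost H (map_prod Some Some z)) \<in> borel_measurable (restrict_space borel (gr D))"
  proof -
    have "(\<lambda>z. cost D z / \<mu> (fst z)) \<in> borel_measurable (restrict_space borel (gr D))"
      using measurable_fst_gr[OF borel_measurable_\<mu>] model by (auto simp: mdp_model_def gr_space_def)
    moreover have "cost H (map_prod Some Some z) = cost D z / \<mu> (fst z)" for z by (cases z) simp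
    ultimately show ?thesis by simp
  qed
  have "\<forall>z\<in>gr H. 0 \<le> cost H z"
    using model \<mu>_bounds unfolding gr_hv by (force simp: mdp_model_def gr_def)
  moreover have "\<exists>C. \<forall>z\<in>gr H. measure (kern H z) (states H) \<le> C"
    using prob_space_hv_kern by (intro exI[of _ 1]) (simp add: prob_space.prob_le_1)
  moreover have "states H \<in> sets borel" "actions H \<in> sets borel"
    using sets.Un[OF borel_open[OF open_None] borel_Some_image] borel_sets by (simp_all add: hv_states_def)
  moreover have "stationary H \<noteq> {}"
    using stationary_map_option model by (auto simp: mdp_model_def)
  moreover have "gr H \<in> sets borel" "cost H \<in> borel_measurable (gr_space H)"
    using measurable_insert_None2[OF borel_sets(3) cost] by (simp_all add: gr_hv gr_space_def)
  moreover have "transition_kernel (gr H) (states H) (kern H)"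
    using transition_prob_kernel_hv by (simp only: transition_prob_kernel_def)
  moreover have "\<forall>x\<in>states H. avail H x \<noteq> {} \<and> avail H x \<subseteq> actions H \<and> avail H x \<in> sets borel"
    unfolding hv_sel(1) using av by blast
  ultimately show ?thesis unfolding mdp_model_def by (intro conjI)
qed

lemma lsc_cost_hv:
  assumes c: "lower_semicontinuous_on (gr D) (cost D)"
  shows "lsc (gr H) (\<lambda>z. ennreal (cost H z))"
  unfolding lsc_def
proof
  fix r :: ennreal
  have \<mu>c: "continuous_on (gr D) (\<lambda>z. \<mu> (fst z))"
    by (rule continuous_on_compose2[OF \<mu>_cont]) (auto intro!: continuous_intros simp: gr_def)
  have pos: "0 < \<mu> (fst z)" if "z \<in> gr D" for z using \<mu>_bounds gr_states[OF that] by force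
  have costH: "cost H (map_prod Some Some z) = cost D z / \<mu> (fst z)" for z by (cases z) simp
  have "openin (top_of_set (gr D)) {z\<in>gr D. r < ennreal (cost D z / \<mu> (fst z))}"
  proof (cases r)
    case (real s)
    \<comment> \<open>\<open>s < c / \<mu>\<close> means \<open>s * \<mu> < c\<close>; an
      intermediate \<open>t\<close> separates the lower semicontinuous \<open>c\<close> from the
      continuous \<open>s * \<mu>\<close>.\<close>
    have "openin (top_of_set (gr D)) (\<Union>t. {z\<in>gr D. t < cost D z} \<inter> (gr D \<inter> (\<lambda>z. s * \<mu> (fst z)) -` {..<t}))"
      using c by (intro openin_Union) (auto simp: lower_semicontinuous_on_def
        intro!: openin_Int continuous_openin_preimage_gen continuous_intros \<mu>c)
    moreover have "(\<Union>t. {z\<in>gr D. t < cost D z} \<inter> (gr D \<inter> (\<lambda>z. s * \<mu> (fst z)) -` {..<t})) =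
        {z\<in>gr D. r < ennreal (cost D z / \<mu> (fst z))}"
    proof -
      have "r < ennreal (cost D z / \<mu> (fst z)) \<longleftrightarrow> (\<exists>t. t < cost D z \<and> s * \<mu> (fst z) < t)" if "z \<in> gr D" for z
      proof -
        have "r < ennreal (cost D z / \<mu> (fst z)) \<longleftrightarrow> s * \<mu> (fst z) < cost D z"
          using real pos[OF that] by (simp add: ennreal_less_iff pos_less_divide_eq)
        then show ?thesis using dense[of "s * \<mu> (fst z)" "cost D z"] by (auto intro: less_trans)
      qed
      then show ?thesis by auto
    qed
    ultimately show ?thesis by simp
  qed simp
  moreover have "{z\<in>gr D. map_prod Some Some z \<in> {z\<in>gr H. r < ennreal (cost H z)}} =
      {z\<in>gr D. r < ennreal (cost D z / \<mu> (fst z))}"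
    by (auto simp: gr_hv)
  ultimately have "openin (top_of_set (gr D)) {z\<in>gr D. map_prod Some Some z \<in> {z\<in>gr H. r < ennreal (cost H z)}}"
    by (simp only:)
  then show "openin (top_of_set (gr H)) {z\<in>gr H. r < ennreal (cost H z)}"
    unfolding gr_hv by (intro openin_insert_None2) auto
qed

lemma compact_valued_hv:
  assumes "compact_valued (states D) (avail D)" shows "compact_valued (states H) (avail H)"
  using assms compact_continuous_image[OF continuous_on_subset[OF continuous_on_Some]]
  by (auto simp: compact_valued_def hv_states_def)

lemma continuous_set_valued_hv:
  assumes A: "continuous_set_valued (states D) (actions D) (avail D)"
  shows "continuous_set_valued (states H) (actions H) (avail H)"
  unfolding continuous_set_valued_def
proof (intro allI impI)
  fix U assume "openin (top_of_set (actions H)) U"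
  then obtain T where T: "open T" "U = actions H \<inter> T" by (auto simp: openin_open)
  then have "openin (top_of_set (actions D)) (actions D \<inter> Some -` T)"
    by (auto simp: open_option_def)
  then have o: "openin (top_of_set (states D)) {x\<in>states D. avail D x \<subseteq> actions D \<inter> Some -` T}"
    "openin (top_of_set (states D)) {x\<in>states D. avail D x \<inter> (actions D \<inter> Some -` T) \<noteq> {}}"
    using A unfolding continuous_set_valued_def by blast+
  have "{x\<in>states D. Some x \<in> {s\<in>hv_states D. avail H s \<subseteq> U}} = {x\<in>states D. avail D x \<subseteq> actions D \<inter> Some -` T}"
    "{x\<in>states D. Some x \<in> {s\<in>hv_states D. avail H s \<inter> U \<noteq> {}}} = {x\<in>states D. avail D x \<inter> (actions D \<inter> Some -` T) \<noteq> {}}"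
    unfolding T(2) by (auto simp: hv_states_def)
  then have o': "openin (top_of_set (states D)) {x\<in>states D. Some x \<in> {s\<in>hv_states D. avail H s \<subseteq> U}}"
    "openin (top_of_set (states D)) {x\<in>states D. Some x \<in> {s\<in>hv_states D. avail H s \<inter> U \<noteq> {}}}"
    using o by (simp_all only:)
  have "{s\<in>hv_states D. avail H s \<subseteq> U} \<subseteq> insert None (Some ` states D)"
    "{s\<in>hv_states D. avail H s \<inter> U \<noteq> {}} \<subseteq> insert None (Some ` states D)"
    by (auto simp: hv_states_def)
  then show "openin (top_of_set (states H)) {s\<in>states H. avail H s \<subseteq> U} \<and>
      openin (top_of_set (states H)) {s\<in>states H. avail H s \<inter> U \<noteq> {}}"
    using openin_insert_None[OF _ o'(1)] openin_insert_None[OF _ o'(2)] by (simp only: hv_sel hv_states_def[of D] simp_thms)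
qed

section \<open>The optimality equation of the transformed model in terms of the old states and
  actions\<close>

abbreviation "v \<equiv> opt_value \<beta> H"

lemma optimality:
  assumes A: "compact_valued (states D) (avail D)" "continuous_set_valued (states D) (actions D) (avail D)"
    and c: "lower_semicontinuous_on (gr D) (cost D)"
  shows "\<exists>\<phi>\<in>stationary D. optimal_policy \<beta> H (hv_policy \<beta> \<mu> D \<phi>)"
    and "\<phi> \<in> stationary D \<Longrightarrow> optimal_policy \<beta> H (hv_policy \<beta> \<mu> D \<phi>) \<longleftrightarrow>
      (\<forall>x\<in>states D. v (Some x) = one_step_value \<beta> H v (Some x, Some (\<phi> x)) \<and>
         is_minimum (one_step_value \<beta> H v (Some x, Some (\<phi> x)))
           (\<lambda>a. one_step_value \<beta> H v (Some x, Some a)) (avail D x))"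
proof -
  interpret H: continuous_mdp H \<beta>
    using mdp_model_hv transition_prob_kernel_hv weakly_continuous_hv compact_valued_hv[OF A(1)]
      continuous_set_valued_hv[OF A(2)] lsc_cost_hv[OF c] discount(2)
    by unfold_locales auto
  have None_state: "None \<in> states H" by (simp add: hv_states_def)
  \<comment> \<open>With a single action at the absorbing state, the optimality equation there holds
    for every policy; only the old states impose a condition.\<close>
  have None_eq: "one_step_value \<beta> H v (None, None) = v None"
    using H.bellman_opt_value[OF None_state] by simp
  have optimal_iff: "optimal_policy \<beta> H (hv_policy \<beta> \<mu> D \<phi>) \<longleftrightarrow>
      (\<forall>x\<in>states D. one_step_value \<beta> H v (Some x, Some (\<phi> x)) = v (Some x))"
    if "\<phi> \<in> stationary D" for \<phi>
    unfolding hv_policy_def H.optimal_iff_conserving[OF stationary_map_option[OF that]]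
    using None_eq by (auto simp: hv_states_def)
  \<comment> \<open>The optimality equation identifies \<open>v (Some x)\<close> with the infimum
    over all actions; an action attaining this value turns the infimum into a minimum.\<close>
  have minimum: "is_minimum (v (Some x)) (\<lambda>a. one_step_value \<beta> H v (Some x, Some a)) (avail D x)"
    if "x \<in> states D" "a \<in> avail D x" "one_step_value \<beta> H v (Some x, Some a) = v (Some x)" for x a
  proof -
    have "(INF b\<in>avail D x. one_step_value \<beta> H v (Some x, Some b)) = v (Some x)"
      using H.bellman_opt_value[of "Some x"] that(1) by (simp add: hv_states_def image_comp)
    then have "v (Some x) \<le> one_step_value \<beta> H v (Some x, Some b)" if "b \<in> avail D x" for b
      using INF_lower[OF that] by metis
    then show ?thesis
      unfolding is_minimum_def using that(2,3) by (intro conjI image_eqI[of _ _ a] ballI) simp_all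
  qed
  show "optimal_policy \<beta> H (hv_policy \<beta> \<mu> D \<phi>) \<longleftrightarrow>
      (\<forall>x\<in>states D. v (Some x) = one_step_value \<beta> H v (Some x, Some (\<phi> x)) \<and>
         is_minimum (one_step_value \<beta> H v (Some x, Some (\<phi> x)))
           (\<lambda>a. one_step_value \<beta> H v (Some x, Some a)) (avail D x))" if \<phi>: "\<phi> \<in> stationary D"
  proof -
    have "one_step_value \<beta> H v (Some x, Some (\<phi> x)) = v (Some x) \<longleftrightarrow>
        v (Some x) = one_step_value \<beta> H v (Some x, Some (\<phi> x)) \<and>
        is_minimum (one_step_value \<beta> H v (Some x, Some (\<phi> x)))
          (\<lambda>a. one_step_value \<beta> H v (Some x, Some a)) (avail D x)" if x: "x \<in> states D" for x
    proof -
      have "\<phi> x \<in> avail D x" using \<phi> x by (simp add: stationary_def)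
      note min = minimum[OF x this]
      show ?thesis
      proof
        assume eq: "one_step_value \<beta> H v (Some x, Some (\<phi> x)) = v (Some x)"
        show "v (Some x) = one_step_value \<beta> H v (Some x, Some (\<phi> x)) \<and>
            is_minimum (one_step_value \<beta> H v (Some x, Some (\<phi> x)))
              (\<lambda>a. one_step_value \<beta> H v (Some x, Some a)) (avail D x)"
          using min[OF eq] unfolding eq by simp
      qed simp
    qed
    then show ?thesis unfolding optimal_iff[OF \<phi>] by (intro ball_cong refl)
  qed
  obtain \<psi> where \<psi>: "\<psi> \<in> stationary H" "\<And>x. x \<in> states H \<Longrightarrow> one_step_value \<beta> H v (x, \<psi> x) = v x"
    using H.exists_conserving_policy by blast
  \<comment> \<open>The new model supplies a rule on the enlarged spaces. On old states its actions
    have the form \<open>Some a\<close>, so \<open>the\<close> recovers a stationary policy of the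
    original model.\<close>
  define \<phi> where "\<phi> x = the (\<psi> (Some x))" for x
  have in_avail: "\<phi> x \<in> avail D x" and Some_\<phi>: "Some (\<phi> x) = \<psi> (Some x)" if "x \<in> states D" for x
  proof -
    have "\<psi> (Some x) \<in> Some ` avail D x"
      using \<psi>(1) that by (auto simp: stationary_def hv_states_def)
    then show "\<phi> x \<in> avail D x" "Some (\<phi> x) = \<psi> (Some x)" by (auto simp: \<phi>_def)
  qed
  have \<phi>: "\<phi> \<in> stationary D"
  proof -
    have "\<psi> \<in> borel_measurable (restrict_space borel (hv_states D))"
      using \<psi>(1) by (simp add: stationary_def state_space_def action_space_def measurable_restrict_space2_iff)
    from measurable_compose[OF measurable_Some_hv this]
    have "\<phi> \<in> borel_measurable (state_space D)"
      unfolding \<phi>_def by (rule measurable_compose[OF _ borel_measurable_continuous_onI[OF continuous_on_the]])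
    then show ?thesis using in_avail avail_props(2)
      by (auto simp: stationary_def state_space_def action_space_def space_restrict_space intro!: measurable_restrict_space2)
  qed
  have "one_step_value \<beta> H v (Some x, Some (\<phi> x)) = v (Some x)" if "x \<in> states D" for x
    using \<psi>(2)[of "Some x"] Some_\<phi>[OF that] that by (simp add: hv_states_def)
  then have "optimal_policy \<beta> H (hv_policy \<beta> \<mu> D \<phi>)" unfolding optimal_iff[OF \<phi>] by blast
  then show "\<exists>\<phi>\<in>stationary D. optimal_policy \<beta> H (hv_policy \<beta> \<mu> D \<phi>)" using \<phi> by blast
qed

end

theorem theorem2:
  fixes D :: "('x::polish_space, 'a::polish_space) mdp"
    and V \<mu> :: "'x \<Rightarrow> real" and K \<beta> :: real
  assumes model: "mdp_model D"
    and V_cont: "continuous_on (states D) V"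
    and V_ge_1: "\<forall>x\<in>states D. 1 \<le> V x"
    and transient: "\<forall>\<phi>\<in>stationary D. \<forall>x\<in>states D.
          (\<Sum>n. (Qop D \<phi> ^^ n) (\<lambda>y. ennreal (V y)) x) \<le> ennreal (K * V x)"
    and avail_compact: "compact_valued (states D) (avail D)"
    and avail_cont: "continuous_set_valued (states D) (actions D) (avail D)"
    and q_cont: "weakly_continuous (gr D) (states D) (kern D)"
    and qV_cont: "continuous_on (gr D) (\<lambda>z. \<integral>y. V y \<partial>kern D z)"
    and \<mu>_cont: "continuous_on (states D) \<mu>"
    and \<mu>_bounds: "\<forall>x\<in>states D. 1 \<le> \<mu> x \<and> V x \<le> \<mu> x \<and> \<mu> x \<le> K * V x"
    and \<mu>_drift: "\<forall>(x, a)\<in>gr D.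
          ennreal (V x) + (\<integral>\<^sup>+y. ennreal (\<mu> y) \<partial>kern D (x, a)) \<le> ennreal (\<mu> x)"
    and \<beta>: "(K - 1) / K \<le> \<beta>" "\<beta> < 1" "0 < \<beta>"
  shows "let H = hv_mdp \<beta> \<mu> D; v = opt_value \<beta> H in
      transition_prob_kernel (gr H) (states H) (kern H) \<and>
      weakly_continuous (gr H) (states H) (kern H) \<and>
      (lower_semicontinuous_on (gr D) (cost D) \<longrightarrow>
        (\<exists>\<phi>\<in>stationary D. optimal_policy \<beta> H (hv_policy \<beta> \<mu> D \<phi>)) \<and>
        (\<forall>\<phi>\<in>stationary D.
           optimal_policy \<beta> H (hv_policy \<beta> \<mu> D \<phi>) \<longleftrightarrow>
           (\<forall>x\<in>states D.
              v (Some x) = one_step_value \<beta> H v (Some x, Some (\<phi> x)) \<and>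
              is_minimum (one_step_value \<beta> H v (Some x, Some (\<phi> x)))
                (\<lambda>a. one_step_value \<beta> H v (Some x, Some a)) (avail D x))))"
proof -
  interpret hv_transformation D V \<mu> K \<beta>
    using model V_cont V_ge_1 q_cont qV_cont \<mu>_cont \<mu>_bounds \<mu>_drift \<beta>(1,3) by unfold_locales
  show ?thesis
    unfolding Let_def
  proof (intro conjI impI ballI, goal_cases)
    case 1 show ?case by (rule transition_prob_kernel_hv)
  next
    case 2 show ?case by (rule weakly_continuous_hv)
  next
    case 3 then show ?case by (rule optimality(1)[OF avail_compact avail_cont])
  next
    case (4 \<phi>) then show ?case by (rule optimality(2)[OF avail_compact avail_cont])
  qed
qed

end
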